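(* Let $G$ be a finite group and let $\varphi\in\mathrm{IBr}_2(G)$ be a nontrivial real-valued irreducible Brauer character of $G$ at the prime $2$. Then there exist a subgroup $H$ of $G$ and a real-valued irreducible Brauer character $\theta\in\mathrm{IBr}_2(H)$ for which the multiplicity of $\theta$ in $\varphi_H$ is odd. Moreover, $H$ can be chosen as a semi-direct product $\langle h\rangle\rtimes\langle t\rangle$, where $h$ is a real element of odd order and $t$ is a $2$-element inverting $h$. In particular, the inner product $[\varphi_{\langle h\rangle},\lambda]$ of complex characters is odd for some $\lambda\in\mathrm{Irr}(\langle h\rangle)$.
   Context: $\mathrm{IBr}_2(G)$ denotes the set of irreducible $2$-Brauer characters of $G$, and $\mathrm{Irr}(G)$ the set of irreducible complex characters. $\varphi_H$ is the restriction of $\varphi$ to $H$; the multiplicity of $\theta$ in $\varphi_H$ is the coefficient of $\theta$ when $\varphi_H$ is written as a sum of irreducible Brauer characters of $H$. An element $h\in G$ is real if $h^x=h^{-1}$ for some $x\in G$, and $t$ inverts $h$ means $t^{-1}ht=h^{-1}$. Since $\langle h\rangle$ has odd order, $\varphi_{\langle h\rangle}$ is an ordinary complex character of $\langle h\rangle$. *)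

theory Defs
  imports
    "Jordan_Normal_Form.VS_Connect"
    "Jordan_Normal_Form.Char_Poly"
    "HOL-Algebra.Multiplicative_Group"
    "HOL-Algebra.Generated_Groups"
    "HOL-Computational_Algebra.Fundamental_Theorem_Algebra"
begin

section \<open>Matrix representations\<close>

definition GL :: "'k::field itself \<Rightarrow> nat \<Rightarrow> 'k mat monoid" where
  "GL ty n = units_of (ring_mat ty n ())"

definition irreducible_rep ::
    "('g, 'b) monoid_scheme \<Rightarrow> nat \<Rightarrow> ('g \<Rightarrow> 'k::field mat) \<Rightarrow> bool" where
  "irreducible_rep G n X \<longleftrightarrow>
     X \<in> hom G (GL TYPE('k) n) \<and> 0 < n \<and>
     (\<forall>W. VectorSpace.subspace class_ring W (module_vec TYPE('k) n) \<and>
          (\<forall>g \<in> carrier G. \<forall>w \<in> W. X g *\<^sub>v w \<in> W) \<longrightarrow>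
          W = {0\<^sub>v n} \<or> W = carrier_vec n)"

definition Irr :: "('g, 'b) monoid_scheme \<Rightarrow> ('g \<Rightarrow> complex) set" where
  "Irr G = {(\<lambda>g\<in>carrier G. \<Sum>i<n. X g $$ (i, i)) | n X. irreducible_rep G n X}"

definition char_inner ::
    "('g, 'b) monoid_scheme \<Rightarrow> ('g \<Rightarrow> complex) \<Rightarrow> ('g \<Rightarrow> complex) \<Rightarrow> complex" where
  "char_inner G \<chi> \<psi> = (\<Sum>g\<in>carrier G. \<chi> g * cnj (\<psi> g)) / of_nat (Coset.order G)"

section \<open>Brauer characters\<close>

text \<open>
  Let \<open>R\<close> be the ring of algebraic integers in the complex numbers.  Brauer characters at a prime
  \<open>p\<close> are defined relative to a maximal ideal \<open>M\<close> of \<open>R\<close> containing \<open>p\<close>, with \<open>F = R/M\<close>.  Here the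
  type \<open>'k\<close> plays the role of \<open>F\<close> and \<open>red\<close> that of the quotient map \<open>R \<rightarrow> F\<close>, so that \<open>M\<close> is the
  kernel of \<open>red\<close> and \<open>p = CHAR('k)\<close>.  The field \<open>R/M\<close> is automatically algebraically closed.
  Values of \<open>red\<close> outside \<open>R\<close> are irrelevant.
\<close>

definition modular_reduction :: "(complex \<Rightarrow> 'k::field) \<Rightarrow> bool" where
  "modular_reduction red \<longleftrightarrow>
     red 1 = 1 \<and>
     (\<forall>x y. algebraic_int x \<and> algebraic_int y \<longrightarrow>
        red (x + y) = red x + red y \<and> red (x * y) = red x * red y) \<and>
     red ` {x. algebraic_int x} = UNIV"

text \<open>
  Reduction is an isomorphism from the group of complex roots of unity of order prime to \<open>p\<close> onto
  the multiplicative group of \<open>F\<close>; \<open>brauer_lift\<close> is its inverse.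
\<close>

definition brauer_lift :: "(complex \<Rightarrow> 'k::field) \<Rightarrow> 'k \<Rightarrow> complex" where
  "brauer_lift red a = (THE z. (\<exists>m. coprime m CHAR('k) \<and> 0 < m \<and> z ^ m = 1) \<and> red z = a)"

definition p_regular :: "nat \<Rightarrow> ('g, 'b) monoid_scheme \<Rightarrow> 'g set" where
  "p_regular p G = {g \<in> carrier G. \<not> p dvd group.ord G g}"

text \<open>
  Brauer characters are functions on the \<open>p\<close>-regular elements only, hence the extensional
  abstraction.  The sum runs over the eigenvalues counted with algebraic multiplicity.
\<close>

definition brauer_character ::
    "(complex \<Rightarrow> 'k::field) \<Rightarrow> ('g, 'b) monoid_scheme \<Rightarrow> ('g \<Rightarrow> 'k mat) \<Rightarrow> 'g \<Rightarrow> complex" where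
  "brauer_character red G X =
     (\<lambda>g\<in>p_regular CHAR('k) G. \<Sum>a\<in>#proots (char_poly (X g)). brauer_lift red a)"

definition IBr :: "(complex \<Rightarrow> 'k::field) \<Rightarrow> ('g, 'b) monoid_scheme \<Rightarrow> ('g \<Rightarrow> complex) set" where
  "IBr red G = {brauer_character red G X | n X. irreducible_rep G n X}"

text \<open>
  The coefficients are well defined because irreducible Brauer characters of a finite group are
  finite in number and linearly independent.
\<close>

definition brauer_multiplicity ::
    "(complex \<Rightarrow> 'k::field) \<Rightarrow> ('g, 'b) monoid_scheme \<Rightarrow>
     ('g \<Rightarrow> complex) \<Rightarrow> ('g \<Rightarrow> complex) \<Rightarrow> nat" where
  "brauer_multiplicity red G \<chi> \<theta> =
     (THE m. \<exists>c :: ('g \<Rightarrow> complex) \<Rightarrow> nat.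
        (\<forall>g \<in> p_regular CHAR('k) G. \<chi> g = (\<Sum>\<psi>\<in>IBr red G. of_nat (c \<psi>) * \<psi> g)) \<and> m = c \<theta>)"

section \<open>Group elements and semidirect products\<close>

definition inverts :: "('g, 'b) monoid_scheme \<Rightarrow> 'g \<Rightarrow> 'g \<Rightarrow> bool" where
  "inverts G t h \<longleftrightarrow> inv\<^bsub>G\<^esub> t \<otimes>\<^bsub>G\<^esub> h \<otimes>\<^bsub>G\<^esub> t = inv\<^bsub>G\<^esub> h"

definition real_element :: "('g, 'b) monoid_scheme \<Rightarrow> 'g \<Rightarrow> bool" where
  "real_element G h \<longleftrightarrow> h \<in> carrier G \<and> (\<exists>x \<in> carrier G. inverts G x h)"

definition internal_semidirect_product ::
    "('g, 'b) monoid_scheme \<Rightarrow> 'g set \<Rightarrow> 'g set \<Rightarrow> 'g set \<Rightarrow> bool" where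
  "internal_semidirect_product G H N K \<longleftrightarrow>
     subgroup H G \<and> N \<lhd> G\<lparr>carrier := H\<rparr> \<and> subgroup K (G\<lparr>carrier := H\<rparr>) \<and>
     H = N <#>\<^bsub>G\<^esub> K \<and> N \<inter> K = {\<one>\<^bsub>G\<^esub>}"

end

theory Submission
  imports
    Defs
    "Jordan_Normal_Form.Schur_Decomposition"
    "Jordan_Normal_Form.DL_Rank"
begin

text \<open>
Let \<open>F\<close> be the residue field, of characteristic 2, and let \<open>\<chi>\<close> be the trace function of an
irreducible \<open>F\<close>-representation \<open>X\<close> affording \<open>\<phi>\<close>.  The theorem follows once \<open>\<chi> h \<noteq> 0\<close> for some
real element \<open>h\<close> of odd order, for two reasons.

The multiplicity of a linear character of \<open>\<langle>h\<rangle>\<close> in \<open>\<phi>\<close> is the multiplicity of the corresponding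
eigenvalue of \<open>X h\<close>.  Eigenvalues of even multiplicity contribute nothing to a trace in
characteristic 2, so some multiplicity is odd when \<open>\<chi> h \<noteq> 0\<close>.

If \<open>t\<close> is a 2-element inverting \<open>h\<close> and \<open>H = \<langle>h\<rangle>\<langle>t\<rangle>\<close>, then \<open>t\<^sup>2\<close> is a central 2-element of \<open>H\<close> and so
acts trivially on every irreducible \<open>F\<close>-representation; \<open>H\<close> behaves like a dihedral group.  Its
irreducible Brauer characters live on \<open>\<langle>h\<rangle>\<close>: they are the trivial one and the sums of a nontrivial
linear character and its complex conjugate (\<open>irreducible_rep_GH_eigenvalues\<close>, \<open>IBr_GH\<close>).  All of
them are real, and distinct ones have no linear constituent in common, so that multiplicities in
\<open>\<phi>\<^sub>H\<close> are multiplicities in \<open>\<phi>\<close> restricted to \<open>\<langle>h\<rangle>\<close> (\<open>brauer_multiplicity_GH\<close>).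

It remains to find \<open>h\<close>.  Replacing \<open>g\<close> by \<open>g\<close> to the power \<open>2\<^sup>k\<close> raises \<open>\<chi> g\<close> to that power, keeps \<open>g\<close>
real, and makes its order odd for suitable \<open>k\<close>; hence any real \<open>g\<close> with \<open>\<chi> g \<noteq> 0\<close> will do.  Suppose
that \<open>\<chi>\<close> vanishes at all real elements.  Since \<open>\<phi>\<close> is real, \<open>\<chi>\<close> is invariant under \<open>g \<mapsto> g\<inverse>\<close>, and
choosing one class from each pair of mutually inverse classes writes \<open>\<chi> = f + f\<^sup>*\<close> with a class
function \<open>f\<close> and \<open>f\<^sup>* g = f (g\<inverse>)\<close> (\<open>split_symmetric_class_function\<close>).  Take a primitive idempotent \<open>e\<close>
of the group algebra not killed by \<open>X\<close> (\<open>exists_primitive_idempotent\<close>).  Then \<open>X e\<close> has rank one, so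
\<open>\<chi> e \<noteq> 0\<close>.  The image \<open>e\<^sup>*\<close> of \<open>e\<close> under inversion of group elements is not killed either, because
\<open>\<chi> (e\<^sup>*) = \<chi> e\<close>, and this makes the two idempotents equivalent: \<open>e = u v\<close> and \<open>e\<^sup>* = v u\<close> for some
\<open>u\<close> and \<open>v\<close> (\<open>idempotent_equivalent_to_image\<close>).  Class functions agree at \<open>u v\<close> and \<open>v u\<close>, so
\<open>\<chi> e = f e + f (e\<^sup>*) = 2 f e = 0\<close>, a contradiction (\<open>exists_real_element_trace_nonzero\<close>).
\<close>

section \<open>Primitive idempotents of finite-dimensional algebras\<close>

text \<open>
The algebra is a subset \<open>A\<close> of a type of rings, with scalars embedded by \<open>\<iota>\<close>: the group algebra of a
group given by a carrier set is not a type of its own.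
\<close>

locale fin_dim_subalgebra =
  fixes \<iota> :: "'k::alg_closed_field \<Rightarrow> 'a::ring_1" and A B :: "'a set"
  assumes scal_add: "\<iota> (x + y) = \<iota> x + \<iota> y"
    and scal_mult: "\<iota> (x * y) = \<iota> x * \<iota> y"
    and scal_1: "\<iota> 1 = 1"
    and scal_central: "\<iota> x * a = a * \<iota> x"
    and A_scal: "\<iota> x \<in> A"
    and A_add: "a \<in> A \<Longrightarrow> b \<in> A \<Longrightarrow> a + b \<in> A"
    and A_mult: "a \<in> A \<Longrightarrow> b \<in> A \<Longrightarrow> a * b \<in> A"
    and finite_B: "finite B"
    and A_span: "a \<in> A \<Longrightarrow> \<exists>f. a = (\<Sum>b\<in>B. \<iota> (f b) * b)"
begin

lemma scal_0: "\<iota> 0 = 0"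
  using scal_add[of 0 0] by simp

lemma A_1: "1 \<in> A"
  using A_scal[of 1] by (simp add: scal_1)

lemma A_uminus: "a \<in> A \<Longrightarrow> - a \<in> A"
proof -
  assume "a \<in> A"
  have "\<iota> (- 1) + 1 = 0"
    using scal_add[of "-1" 1] by (simp add: scal_0 scal_1)
  then have "\<iota> (- 1) = - 1"
    by (simp add: eq_neg_iff_add_eq_0)
  then show ?thesis
    using A_mult[OF A_scal[of "-1"] \<open>a \<in> A\<close>] by simp
qed

lemma A_diff: "a \<in> A \<Longrightarrow> b \<in> A \<Longrightarrow> a - b \<in> A"
  using A_add[of a "- b"] A_uminus by simp

lemmas A_closed = A_scal A_1 A_add A_mult A_diff

sublocale vs: vector_space "\<lambda>c a. \<iota> c * a"
  by unfold_locales (simp_all add: distrib_left distrib_right scal_add scal_mult scal_1 mult.assoc)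

lemma A_subset_span: "A \<subseteq> vs.span B"
proof
  fix a assume "a \<in> A"
  then obtain f where "a = (\<Sum>b\<in>B. \<iota> (f b) * b)"
    using A_span by blast
  moreover have "(\<Sum>b\<in>B. \<iota> (f b) * b) \<in> vs.span B"
    by (intro vs.span_sum vs.span_scale vs.span_base)
  ultimately show "a \<in> vs.span B"
    by simp
qed

lemma dim_strict_mono:
  assumes "vs.subspace S" "S \<subset> T" "T \<subseteq> A"
  shows "vs.dim S < vs.dim T"
proof -
  obtain s where s: "s \<subseteq> S" "vs.independent s" "S \<subseteq> vs.span s" "card s = vs.dim S"
    using vs.basis_exists by blast
  obtain t where t: "t \<subseteq> T" "vs.independent t" "T \<subseteq> vs.span t" "card t = vs.dim T"
    using vs.basis_exists by blast
  obtain x where x: "x \<in> T" "x \<notin> S"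
    using assms by blast
  have fin_t: "finite t"
    using vs.independent_span_bound[OF finite_B t(2)] t(1) assms(3) A_subset_span by blast
  have "vs.span s \<subseteq> S"
    using s(1) assms(1) by (simp add: vs.span_minimal)
  then have "x \<notin> vs.span s"
    using x(2) by blast
  then have "x \<notin> s"
    using vs.span_base[of x s] by argo
  have "vs.independent (insert x s)"
    by (rule vs.independent_insertI) fact+
  moreover have "insert x s \<subseteq> vs.span t"
    using x(1) s(1) t(3) assms(2) by blast
  ultimately have "finite (insert x s) \<and> card (insert x s) \<le> card t"
    by (rule vs.independent_span_bound[OF fin_t])
  then show ?thesis
    using s(4) t(4) \<open>x \<notin> s\<close> by auto
qed

definition eval_poly :: "'a \<Rightarrow> 'k poly \<Rightarrow> 'a" where
  "eval_poly c p = fold_coeffs (\<lambda>x y. \<iota> x + c * y) p 0"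

lemma eval_poly_0: "eval_poly c 0 = 0"
  by (simp add: eval_poly_def)

lemma eval_poly_pCons: "eval_poly c (pCons x p) = \<iota> x + c * eval_poly c p"
  by (cases "p = 0 \<and> x = 0") (auto simp: eval_poly_def scal_0)

lemma eval_poly_add: "eval_poly c (p + q) = eval_poly c p + eval_poly c q"
  by (induction p q rule: poly_induct2) (simp_all add: eval_poly_0 eval_poly_pCons scal_add algebra_simps)

lemma eval_poly_smult: "eval_poly c (smult x p) = \<iota> x * eval_poly c p"
proof (induction p)
  case (pCons y p)
  have "c * (\<iota> x * eval_poly c p) = \<iota> x * (c * eval_poly c p)"
    by (metis mult.assoc scal_central)
  then show ?case
    using pCons by (simp add: eval_poly_pCons scal_mult distrib_left)
qed (simp add: eval_poly_0)

lemma eval_poly_commute: "c * eval_poly c p = eval_poly c p * c"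
  by (induction p)
    (simp_all add: eval_poly_0 eval_poly_pCons distrib_left distrib_right scal_central mult.assoc[symmetric])

lemma eval_poly_mult: "eval_poly c (p * q) = eval_poly c p * eval_poly c q"
  by (induction p)
    (simp_all add: eval_poly_0 eval_poly_pCons eval_poly_add eval_poly_smult distrib_right mult.assoc scal_0)

lemma eval_poly_closed: "c \<in> A \<Longrightarrow> eval_poly c p \<in> A"
  by (induction p) (auto simp: eval_poly_0 eval_poly_pCons A_closed intro: A_scal[of 0, unfolded scal_0])

lemma eval_poly_monom: "eval_poly c (Polynomial.monom x n) = \<iota> x * c ^ n"
proof (induction n)
  case (Suc n)
  then show ?case
    by (simp add: monom_Suc eval_poly_pCons scal_0) (metis mult.assoc scal_central)
qed (simp add: monom_0 eval_poly_pCons eval_poly_0)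

lemma eval_poly_sum: "eval_poly c (sum p I) = (\<Sum>i\<in>I. eval_poly c (p i))"
  by (induction I rule: infinite_finite_induct) (simp_all add: eval_poly_0 eval_poly_add)

lemma exists_annihilating_poly:
  assumes "c \<in> A" "a \<in> A"
  shows "\<exists>p. p \<noteq> 0 \<and> eval_poly c p * a = 0"
proof -
  define N where "N = Suc (card B)"
  define g where "g i = c ^ i * a" for i
  have gA: "g i \<in> A" for i
    unfolding g_def by (induction i) (use assms in \<open>auto simp: A_closed mult.assoc\<close>)
  have poly: "eval_poly c (\<Sum>i\<in>I. Polynomial.monom (u i) i) * a = (\<Sum>i\<in>I. \<iota> (u i) * g i)" for I u
    by (simp add: eval_poly_sum eval_poly_monom g_def sum_distrib_right mult.assoc)
  have coeffs: "Polynomial.coeff (\<Sum>i<N. Polynomial.monom (u i) i) j = (if j < N then u j else 0)" for u :: "nat \<Rightarrow> 'k" and j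
    by (simp add: coeff_sum)
  show ?thesis
  proof (cases "inj_on g {..<N}")
    case False
    then obtain i j where ij: "i < N" "j < N" "i \<noteq> j" "g i = g j"
      by (auto simp: inj_on_def)
    define p where "p = Polynomial.monom (1::'k) i + Polynomial.monom (- 1) j"
    have "Polynomial.coeff p i = 1"
      using ij(3) by (simp add: p_def)
    moreover have "eval_poly c p * a = (\<iota> 1 + \<iota> (- 1)) * g i"
      unfolding p_def eval_poly_add eval_poly_monom distrib_right mult.assoc g_def[symmetric]
      using ij(4) by simp
    ultimately show ?thesis
      by (metis scal_add scal_0 add.right_inverse mult_zero_left coeff_0 zero_neq_one)
  next
    case True
    have "\<not> vs.independent (g ` {..<N})"
      using vs.independent_span_bound[OF finite_B, of "g ` {..<N}"] True gA A_subset_span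
      by (auto simp: card_image N_def)
    then obtain u where u: "\<exists>v\<in>g ` {..<N}. u v \<noteq> 0" "(\<Sum>v\<in>g ` {..<N}. \<iota> (u v) * v) = 0"
      by (auto simp: vs.dependent_finite)
    define p where "p = (\<Sum>i<N. Polynomial.monom (u (g i)) i)"
    have "eval_poly c p * a = 0"
      unfolding p_def poly using u(2) True by (simp add: sum.reindex)
    moreover have "p \<noteq> 0"
    proof -
      obtain i where "i < N" "u (g i) \<noteq> 0"
        using u(1) by auto
      then have "Polynomial.coeff p i \<noteq> 0"
        by (simp add: p_def coeffs)
      then show ?thesis
        by auto
    qed
    ultimately show ?thesis
      by blast
  qed
qed

lemma exists_minimal_annihilating_poly:
  assumes "c \<in> A" "a \<in> A"
  obtains p where "p \<noteq> 0" "eval_poly c p * a = 0"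
    "\<And>q. q \<noteq> 0 \<Longrightarrow> degree q < degree p \<Longrightarrow> eval_poly c q * a \<noteq> 0"
proof -
  let ?P = "\<lambda>p. p \<noteq> 0 \<and> eval_poly c p * a = 0"
  obtain p where "?P p"
    using exists_annihilating_poly[OF assms] by blast
  then have "?P (arg_min degree ?P) \<and> (\<forall>q. ?P q \<longrightarrow> degree (arg_min degree ?P) \<le> degree q)"
    by (rule arg_min_nat_lemma)
  then show ?thesis
    using that[of "arg_min degree ?P"] by (meson leD)
qed

text \<open>
The point is the existence of \<open>w\<close>: it shows that \<open>a\<close> does not lie in the right ideal generated by
\<open>(c - \<iota> \<mu>) * a\<close>, since \<open>w\<close> annihilates the latter but not \<open>a\<close>.  If \<open>p = (x - \<mu>) q\<close> has minimal degree among
the nonzero polynomials with \<open>p(c) a = 0\<close>, then \<open>w = q(c)\<close> works.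
\<close>

lemma exists_eigenvalue:
  assumes "c \<in> A" "a \<in> A" "a \<noteq> 0"
  shows "\<exists>\<mu> w. w * a \<noteq> 0 \<and> w * ((c - \<iota> \<mu>) * a) = 0"
proof -
  obtain p where p: "p \<noteq> 0" "eval_poly c p * a = 0"
      "\<And>q. q \<noteq> 0 \<Longrightarrow> degree q < degree p \<Longrightarrow> eval_poly c q * a \<noteq> 0"
    using exists_minimal_annihilating_poly[OF assms(1,2)] by metis
  have "degree p > 0"
  proof (rule ccontr)
    assume "\<not> degree p > 0"
    then obtain x where px: "p = [:x:]"
      by (auto elim: degree_eq_zeroE)
    then have "x \<noteq> 0" "\<iota> x * a = 0"
      using p(1,2) by (auto simp: eval_poly_pCons eval_poly_0)
    then have "\<iota> (inverse x * x) * a = 0"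
      by (simp only: scal_mult mult.assoc mult_zero_right)
    then show False
      using \<open>x \<noteq> 0\<close> assms(3) by (simp add: scal_1)
  qed
  then obtain \<mu> where "poly p \<mu> = 0"
    using alg_closed_imp_poly_has_root by blast
  then obtain q where q: "p = [:- \<mu>, 1:] * q"
    by (auto simp: poly_eq_0_iff_dvd dvd_def)
  then have q0: "q \<noteq> 0"
    using p(1) by auto
  then have "degree q < degree p"
    unfolding q by (subst degree_mult_eq) auto
  then have 1: "eval_poly c q * a \<noteq> 0"
    using p(3) q0 by blast
  have "\<iota> (- \<mu>) = - \<iota> \<mu>"
    using scal_add[of "- \<mu>" \<mu>] by (simp add: scal_0 eq_neg_iff_add_eq_0)
  then have "eval_poly c [:- \<mu>, 1:] = c - \<iota> \<mu>"
    by (simp add: eval_poly_pCons eval_poly_0 scal_1)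
  then have "eval_poly c q * ((c - \<iota> \<mu>) * a) = eval_poly c (q * [:- \<mu>, 1:]) * a"
    by (simp add: eval_poly_mult mult.assoc del: mult_pCons_right)
  also have "\<dots> = 0"
    using p(2) unfolding q by (simp only: mult.commute)
  finally show ?thesis
    using 1 by blast
qed

text \<open>
The hypothesis says that \<open>c\<close> acts invertibly on the right ideal that it generates.  So the polynomial
of minimal degree with \<open>p(c) c = 0\<close> has a nonzero constant term, and solving \<open>p(c) c = 0\<close> for \<open>c\<close>
exhibits the identity of that right ideal as a polynomial in \<open>c\<close>.
\<close>

lemma exists_idempotent:
  assumes "c \<in> A" "y \<in> A" "c = c * c * y"
  shows "\<exists>z\<in>A. c * z * (c * z) = c * z \<and> c * (c * z) = c"
proof -
  obtain p where p: "p \<noteq> 0" "eval_poly c p * c = 0"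
      "\<And>q. q \<noteq> 0 \<Longrightarrow> degree q < degree p \<Longrightarrow> eval_poly c q * c \<noteq> 0"
    using exists_minimal_annihilating_poly[OF assms(1,1)] by metis
  obtain x q where pq: "p = pCons x q"
    by (cases p)
  have "x \<noteq> 0"
  proof
    assume x0: "x = 0"
    have "eval_poly c q * c = eval_poly c q * (c * c * y)"
      by (simp only: assms(3)[symmetric])
    also have "\<dots> = eval_poly c p * c * y"
      unfolding pq eval_poly_pCons x0 scal_0 eval_poly_commute by (simp add: mult.assoc)
    finally have "eval_poly c q * c = 0"
      by (simp add: p(2))
    moreover have "q \<noteq> 0" "degree q < degree p"
      using p(1) x0 by (auto simp: pq)
    ultimately show False
      using p(3) by blast
  qed
  define z where "z = - (\<iota> (inverse x) * eval_poly c q)"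
  have zA: "z \<in> A"
    unfolding z_def by (intro A_uminus A_mult A_scal eval_poly_closed assms)
  have cz: "c * z = z * c"
    unfolding z_def by (metis eval_poly_commute minus_mult_commute mult.assoc scal_central)
  have "\<iota> x * c = - (c * eval_poly c q * c)"
    using p(2) by (simp add: pq eval_poly_pCons distrib_right eq_neg_iff_add_eq_0)
  then have "c * z * c = \<iota> (inverse x) * (\<iota> x * c)"
    unfolding z_def by (simp add: mult.assoc) (metis mult.assoc scal_central)
  also have "\<dots> = c"
    using \<open>x \<noteq> 0\<close> by (simp add: mult.assoc[symmetric] scal_mult[symmetric] scal_1)
  finally have czc: "c * z * c = c" .
  have "c * (c * z) = c"
    by (subst cz) (simp add: mult.assoc[symmetric] czc)
  moreover have "c * z * (c * z) = c * z"
    using czc by (simp add: mult.assoc[symmetric])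
  ultimately show ?thesis
    using zA by blast
qed

end

text \<open>
The ideal \<open>I\<close> stands for the kernel of an irreducible representation of \<open>A\<close>.
\<close>

locale fin_dim_subalgebra_prime = fin_dim_subalgebra \<iota> A B
  for \<iota> :: "'k::alg_closed_field \<Rightarrow> 'a::ring_1" and A B +
  fixes I :: "'a set"
  assumes I_0: "0 \<in> I"
    and I_add: "a \<in> I \<Longrightarrow> b \<in> I \<Longrightarrow> a + b \<in> I"
    and I_left: "a \<in> A \<Longrightarrow> b \<in> I \<Longrightarrow> a * b \<in> I"
    and I_right: "a \<in> I \<Longrightarrow> b \<in> A \<Longrightarrow> a * b \<in> I"
    and one_notin_I: "1 \<notin> I"
    and I_prime: "a \<in> A \<Longrightarrow> b \<in> A \<Longrightarrow> a \<notin> I \<Longrightarrow> b \<notin> I \<Longrightarrow> \<exists>s\<in>A. a * s * b \<notin> I"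
begin

definition right_ideal :: "'a \<Rightarrow> 'a set" where
  "right_ideal a = (\<lambda>y. a * y) ` A"

lemma right_ideal_subset_A: "a \<in> A \<Longrightarrow> right_ideal a \<subseteq> A"
  by (auto simp: right_ideal_def A_closed)

lemma right_ideal_self: "a \<in> right_ideal a"
  unfolding right_ideal_def using A_1 by force

lemma right_ideal_mult_subset: "x \<in> A \<Longrightarrow> right_ideal (a * x) \<subseteq> right_ideal a"
  by (auto simp: right_ideal_def mult.assoc A_closed)

lemma right_ideal_subspace: "vs.subspace (right_ideal a)"
  unfolding vs.subspace_def right_ideal_def
proof (intro conjI ballI allI)
  show "0 \<in> (*) a ` A"
    using A_scal[of 0] by (force simp: scal_0)
  fix x assume x: "x \<in> (*) a ` A"
  show "x + y \<in> (*) a ` A" if "y \<in> (*) a ` A" for y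
    using x that by (auto simp: distrib_left[symmetric] A_closed)
  show "\<iota> c * x \<in> (*) a ` A" for c
  proof -
    obtain y where "y \<in> A" "x = a * y"
      using x by blast
    then have "\<iota> c * x = a * (\<iota> c * y)"
      by (metis mult.assoc scal_central)
    then show ?thesis
      using \<open>y \<in> A\<close> A_closed by blast
  qed
qed

lemma exists_minimal_element:
  "\<exists>a\<in>A. a \<notin> I \<and> (\<forall>x\<in>A. a * x \<notin> I \<longrightarrow> (\<exists>y\<in>A. a = a * x * y))"
proof -
  let ?P = "\<lambda>a. a \<in> A \<and> a \<notin> I"
  let ?d = "\<lambda>a. vs.dim (right_ideal a)"
  define a where "a = arg_min ?d ?P"
  have a: "?P a" "\<And>x. ?P x \<Longrightarrow> ?d a \<le> ?d x"
    unfolding a_def using arg_min_nat_lemma[of ?P 1 ?d] A_1 one_notin_I by blast+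
  have "\<exists>y\<in>A. a = a * x * y" if x: "x \<in> A" "a * x \<notin> I" for x
  proof -
    have "right_ideal (a * x) \<subseteq> right_ideal a"
      using x(1) by (rule right_ideal_mult_subset)
    moreover have "\<not> right_ideal (a * x) \<subset> right_ideal a"
    proof
      assume "right_ideal (a * x) \<subset> right_ideal a"
      then have "?d (a * x) < ?d a"
        using a(1) right_ideal_subset_A right_ideal_subspace dim_strict_mono by blast
      moreover have "?d a \<le> ?d (a * x)"
        using a x by (simp add: A_closed)
      ultimately show False
        by simp
    qed
    ultimately have "a \<in> right_ideal (a * x)"
      using right_ideal_self by blast
    then show ?thesis
      by (auto simp: right_ideal_def)
  qed
  then show ?thesis
    using a(1) by blast
qed

text \<open>
A right ideal \<open>a A\<close> of minimal dimension among those not contained in \<open>I\<close> is generated by an idempotent: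
primeness gives \<open>a s a \<notin> I\<close>, by minimality \<open>c = a s\<close> acts invertibly on \<open>a A\<close>, and
\<open>exists_idempotent\<close> applies to \<open>c\<close>.
\<close>

lemma exists_primitive_idempotent:
  "\<exists>e\<in>A. e \<notin> I \<and> e * e = e \<and> (\<forall>x\<in>A. e * x \<notin> I \<longrightarrow> (\<exists>y\<in>A. e = e * x * y))"
proof -
  obtain a where a: "a \<in> A" "a \<notin> I" and min: "\<And>x. x \<in> A \<Longrightarrow> a * x \<notin> I \<Longrightarrow> \<exists>y\<in>A. a = a * x * y"
    using exists_minimal_element by blast
  obtain s where s: "s \<in> A" "a * s * a \<notin> I"
    using I_prime a by blast
  define c where "c = a * s"
  have cA: "c \<in> A"
    using a s by (simp add: c_def A_closed)
  obtain y where y: "y \<in> A" "a = c * a * y"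
    using min[of "s * a"] a s by (auto simp: c_def mult.assoc A_closed)
  have "c = c * a * y * s"
    by (subst c_def, rule arg_cong[OF y(2), of "\<lambda>w. w * s"])
  then have 1: "c = c * (a * (y * s))"
    unfolding mult.assoc .
  have "a * (y * s) = c * a * y * (y * s)"
    by (rule arg_cong[OF y(2), of "\<lambda>w. w * (y * s)"])
  then have "c * (a * (y * s)) = c * c * (a * y * y * s)"
    by (simp only: mult.assoc)
  with 1 have "c = c * c * (a * y * y * s)"
    by (rule trans)
  moreover have "a * y * y * s \<in> A"
    using a s y by (intro A_mult)
  ultimately obtain z where z: "z \<in> A" "c * z * (c * z) = c * z" "c * (c * z) = c"
    using exists_idempotent[OF cA] by blast
  define e where "e = c * z"
  have eA: "e \<in> A"
    using cA z by (simp add: e_def A_closed)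
  have cI: "c \<notin> I"
    using s(2) a(1) I_right c_def by blast
  have eI: "e \<notin> I"
    using cI z(3) I_left[OF cA, of e] by (auto simp: e_def)
  have "\<exists>y'\<in>A. e = e * x * y'" if x: "x \<in> A" "e * x \<notin> I" for x
  proof -
    have "a * (s * z * x) \<notin> I"
      using x(2) by (simp add: e_def c_def mult.assoc)
    then obtain y' where y': "y' \<in> A" "a = a * (s * z * x) * y'"
      using min[of "s * z * x"] s z x A_mult by blast
    from y'(2) have "a = e * x * y'"
      unfolding e_def c_def mult.assoc .
    then have "a * (s * z) = e * x * y' * (s * z)"
      by (rule arg_cong[of a _ "\<lambda>w. w * (s * z)"])
    then have "e = e * x * (y' * s * z)"
      unfolding e_def c_def mult.assoc .
    moreover have "y' * s * z \<in> A"
      using y' s z by (intro A_mult)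
    ultimately show ?thesis
      by blast
  qed
  then show ?thesis
    using eA eI z(2) e_def by blast
qed

text \<open>
Schur's lemma for \<open>e A e\<close>: by minimality of \<open>e A\<close>, an eigenvalue \<open>\<mu>\<close> of \<open>e x e\<close> forces
\<open>e x e - \<mu> e\<close> into \<open>I\<close>.
\<close>

lemma idempotent_corner_scalar:
  assumes e: "e \<in> A" "e \<notin> I" "e * e = e"
    and min: "\<And>x. x \<in> A \<Longrightarrow> e * x \<notin> I \<Longrightarrow> \<exists>y\<in>A. e = e * x * y"
    and x: "x \<in> A"
  shows "\<exists>\<mu>. e * x * e - \<iota> \<mu> * e \<in> I"
proof -
  have "e \<noteq> 0"
    using e(2) I_0 by auto
  have "e * x * e \<in> A"
    using e x by (intro A_mult)
  then obtain \<mu> w where w: "w * e \<noteq> 0" "w * ((e * x * e - \<iota> \<mu>) * e) = 0"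
    using exists_eigenvalue e(1) \<open>e \<noteq> 0\<close> by blast
  have eq: "(e * x * e - \<iota> \<mu>) * e = e * (x * e - \<iota> \<mu>)"
    using e(3) by (simp add: left_diff_distrib right_diff_distrib mult.assoc scal_central)
  have "e * (x * e - \<iota> \<mu>) \<in> I"
  proof (rule ccontr)
    assume "e * (x * e - \<iota> \<mu>) \<notin> I"
    moreover have "x * e - \<iota> \<mu> \<in> A"
      using x e by (intro A_diff A_mult A_scal)
    ultimately obtain y where "e = e * (x * e - \<iota> \<mu>) * y"
      using min by blast
    then have "w * e = w * (e * (x * e - \<iota> \<mu>) * y)"
      by (rule arg_cong)
    also have "\<dots> = w * ((e * x * e - \<iota> \<mu>) * e) * y"
      unfolding eq by (simp only: mult.assoc)
    finally show False
      using w by simp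
  qed
  then show ?thesis
    by (auto simp: right_diff_distrib mult.assoc scal_central)
qed

text \<open>
Primeness provides \<open>u \<in> e A e\<^sup>*\<close> and \<open>r\<close> with \<open>u r e \<notin> I\<close>; minimality of \<open>e\<close> then turns \<open>r\<close> into some
\<open>v \<in> e\<^sup>* A e\<close> with \<open>u v = e\<close>.  Now \<open>v u\<close> is an idempotent below \<open>e\<^sup>*\<close>, and its image under the involution
is a nonzero idempotent below \<open>e\<close>, which must be \<open>e\<close> since \<open>e\<close> is primitive.
\<close>

lemma idempotent_equivalent_to_image:
  fixes star :: "'a \<Rightarrow> 'a"
  assumes star_closed: "\<And>a. a \<in> A \<Longrightarrow> star a \<in> A"
    and star_diff: "\<And>a b. a \<in> A \<Longrightarrow> b \<in> A \<Longrightarrow> star (a - b) = star a - star b"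
    and star_mult: "\<And>a b. a \<in> A \<Longrightarrow> b \<in> A \<Longrightarrow> star (a * b) = star b * star a"
    and star_star: "\<And>a. a \<in> A \<Longrightarrow> star (star a) = a"
    and e: "e \<in> A" "e \<notin> I" "e * e = e" "star e \<notin> I"
    and min: "\<And>x. x \<in> A \<Longrightarrow> e * x \<notin> I \<Longrightarrow> \<exists>y\<in>A. e = e * x * y"
  shows "\<exists>u\<in>A. \<exists>v\<in>A. u * v = e \<and> v * u = star e"
proof -
  note cl = A_closed star_closed e(1)
  define e' where "e' = star e"
  have e': "e' \<in> A" "e' \<notin> I" "e' * e' = e'" "star e' = e"
    using e star_mult[of e e] star_star cl by (auto simp: e'_def)
  obtain s where s: "s \<in> A" "e * s * e' \<notin> I"
    using I_prime e e' by blast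
  define u where "u = e * s * e'"
  have u: "u \<in> A" "e * u = u" "u * e' = u"
    using s e e' by (simp_all add: u_def cl mult.assoc) (simp add: mult.assoc[symmetric])
  obtain r where r: "r \<in> A" "u * r * e \<notin> I"
    using I_prime e u s unfolding u_def by blast
  have eure: "e * (u * r * e) = u * r * e"
    using u by (simp add: mult.assoc[symmetric])
  have "u * r * e \<in> A"
    using u r e by (intro A_mult)
  then obtain y where y: "y \<in> A" "e = u * r * e * y"
    using min[of "u * r * e"] r(2) unfolding eure by blast
  define v where "v = e' * r * e * y * e"
  have v: "v \<in> A" "e' * v = v" "v * e = v"
    using r e e' y by (simp_all add: v_def cl mult.assoc) (simp add: mult.assoc[symmetric])
  have "u * v = (u * e') * r * e * y * e"
    by (simp add: v_def mult.assoc)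
  also have "\<dots> = u * r * e * y * e"
    by (simp only: u(3))
  also have "\<dots> = e"
    by (simp only: y(2)[symmetric] e(3))
  finally have uv: "u * v = e" .
  define f where "f = v * u"
  have f: "f \<in> A" "f * f = f" "e' * f = f" "f * e' = f"
  proof -
    show "f \<in> A"
      using u v by (simp add: f_def cl)
    have "f * f = v * (u * v) * u"
      by (simp only: f_def mult.assoc)
    then show "f * f = f"
      by (simp add: uv v(3) f_def)
    show "e' * f = f"
      by (simp add: f_def mult.assoc[symmetric] v(2))
    show "f * e' = f"
      by (simp add: f_def mult.assoc u(3))
  qed
  define g where "g = star f"
  have g: "g \<in> A" "g * g = g" "g * e = g" "e * g = g" "star g = f"
    using f e' star_mult[of f f] star_mult[of e' f] star_mult[of f e'] star_star cl
    by (auto simp: g_def)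
  define d where "d = e - g"
  have d: "d \<in> A" "d * d = d" "e * d = d" "d * e = d" "d * g = 0"
    using g e by (auto simp: d_def cl left_diff_distrib right_diff_distrib)
  have "d \<in> I"
  proof (rule ccontr)
    assume "d \<notin> I"
    then obtain y where y: "e = d * y"
      using min[of d] d by auto
    have "d * e = d * d * y"
      by (simp only: y mult.assoc)
    then have "d * e = e"
      by (simp only: d(2) y[symmetric])
    then have "g = 0"
      using d(4) by (simp add: d_def)
    then have "f = 0"
      using g(5) star_diff[of 0 0] A_scal[of 0] by (simp add: scal_0)
    moreover have "u * f * v = (u * v) * (u * v)"
      unfolding f_def by (simp only: mult.assoc)
    ultimately have "e = 0"
      using uv e(3) by simp
    then show False
      using e(2) I_0 by simp
  qed
  have "g \<notin> I"
    using I_add[OF \<open>d \<in> I\<close>, of g] e(2) by (auto simp: d_def)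
  then obtain y where y: "e = g * y"
    using min[of g] g by auto
  have "d * e = d * g * y"
    by (simp only: y mult.assoc)
  then have "d * e = 0"
    by (simp add: d(5))
  then have "g = e"
    using d by (simp add: d_def)
  then have "v * u = star e"
    using g(5) by (simp add: f_def)
  with uv show ?thesis
    using u(1) v(1) by blast
qed

end

section \<open>The group algebra\<close>

text \<open>
The group algebra is realized inside the ring of linear endomorphisms of the space of all functions
on the type of group elements.  This ring is a type of class \<^class>\<open>ring_1\<close>, which the group algebra,
depending on a carrier set, cannot be.
\<close>

typedef (overloaded) ('g, 'k) lin_endo =
  "{T :: ('g \<Rightarrow> 'k::field) \<Rightarrow> 'g \<Rightarrow> 'k.
      \<forall>a b u v. T (\<lambda>x. a * u x + b * v x) = (\<lambda>x. a * T u x + b * T v x)}"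
  by (rule exI[of _ "\<lambda>u. u"]) simp

setup_lifting type_definition_lin_endo

instantiation lin_endo :: (type, field) ring_1
begin

lift_definition zero_lin_endo :: "('a, 'b) lin_endo" is "\<lambda>u x. 0" by simp
lift_definition one_lin_endo :: "('a, 'b) lin_endo" is "\<lambda>u. u" by simp
lift_definition plus_lin_endo :: "('a, 'b) lin_endo \<Rightarrow> ('a, 'b) lin_endo \<Rightarrow> ('a, 'b) lin_endo"
  is "\<lambda>S T u x. S u x + T u x" by (simp add: fun_eq_iff algebra_simps)
lift_definition minus_lin_endo :: "('a, 'b) lin_endo \<Rightarrow> ('a, 'b) lin_endo \<Rightarrow> ('a, 'b) lin_endo"
  is "\<lambda>S T u x. S u x - T u x" by (simp add: fun_eq_iff algebra_simps)
lift_definition uminus_lin_endo :: "('a, 'b) lin_endo \<Rightarrow> ('a, 'b) lin_endo"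
  is "\<lambda>S u x. - S u x" by (simp add: fun_eq_iff algebra_simps)
lift_definition times_lin_endo :: "('a, 'b) lin_endo \<Rightarrow> ('a, 'b) lin_endo \<Rightarrow> ('a, 'b) lin_endo"
  is "\<lambda>S T u. S (T u)" by simp

instance
proof
  fix a b c :: "('a, 'b) lin_endo"
  show "a * (b + c) = a * b + a * c"
  proof transfer
    fix a b c :: "('a \<Rightarrow> 'b) \<Rightarrow> 'a \<Rightarrow> 'b"
    assume a: "\<forall>x y u v. a (\<lambda>z. x * u z + y * v z) = (\<lambda>z. x * a u z + y * a v z)"
    show "(\<lambda>u. a (\<lambda>x. b u x + c u x)) = (\<lambda>u x. a (b u) x + a (c u) x)"
      using a[rule_format, of 1 _ 1] by simp
  qed
  show "(0 :: ('a, 'b) lin_endo) \<noteq> 1"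
    by transfer (metis zero_neq_one)
qed (transfer; simp add: fun_eq_iff algebra_simps)+

end

lift_definition scalar :: "'k::field \<Rightarrow> ('g, 'k) lin_endo" is "\<lambda>c u x. c * u x"
  by (simp add: fun_eq_iff algebra_simps)

lemma scalar_simps:
  "scalar (x + y) = scalar x + scalar y" "scalar (x * y) = scalar x * scalar y" "scalar 1 = 1" "scalar 0 = 0"
  by (transfer; simp add: fun_eq_iff algebra_simps)+

lemma scalar_commute: "scalar c * T = T * scalar c"
proof transfer
  fix c :: 'b and T :: "('a \<Rightarrow> 'b) \<Rightarrow> 'a \<Rightarrow> 'b"
  assume T: "\<forall>x y u v. T (\<lambda>z. x * u z + y * v z) = (\<lambda>z. x * T u z + y * T v z)"
  show "(\<lambda>u x. c * T u x) = (\<lambda>u. T (\<lambda>x. c * u x))"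
    using T[rule_format, of c _ 0] by simp
qed

locale finite_group = group G for G :: "('g, 'b) monoid_scheme" (structure) +
  assumes finite_carrier: "finite (carrier G)"
begin

text \<open>
The left regular representation, extended by the identity outside the carrier so that the unit of
the group acts as the unit of the ring.
\<close>

definition translate_fun :: "'g \<Rightarrow> ('g \<Rightarrow> 'k) \<Rightarrow> 'g \<Rightarrow> 'k" where
  "translate_fun g u x = (if x \<in> carrier G then u (inv g \<otimes> x) else u x)"

lift_definition translate :: "'g \<Rightarrow> ('g, 'k::field) lin_endo" is translate_fun
  by (simp add: translate_fun_def fun_eq_iff)

lemma translate_mult:
  assumes "g \<in> carrier G" "h \<in> carrier G"
  shows "translate g * translate h = (translate (g \<otimes> h) :: ('g, 'k::field) lin_endo)"
proof -
  have "translate_fun g (translate_fun h u) = translate_fun (g \<otimes> h) u" for u :: "'g \<Rightarrow> 'k"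
    using assms by (simp add: translate_fun_def fun_eq_iff inv_mult_group m_assoc)
  then show ?thesis
    by (simp add: Rep_lin_endo_inject[symmetric] times_lin_endo.rep_eq translate.rep_eq)
qed

lemma translate_one: "translate \<one> = 1"
  by transfer (auto simp: translate_fun_def fun_eq_iff)

definition combination :: "('g \<Rightarrow> 'k::field) \<Rightarrow> ('g, 'k) lin_endo" where
  "combination a = (\<Sum>g\<in>carrier G. scalar (a g) * translate g)"

text \<open>
Applying an element of the group algebra to the indicator function of the unit recovers its
coefficients.
\<close>

lift_definition coef :: "('g, 'k::field) lin_endo \<Rightarrow> 'g \<Rightarrow> 'k"
  is "\<lambda>T. T (\<lambda>x. if x = \<one> then 1 else 0)" .

definition group_algebra :: "('g, 'k::field) lin_endo set" where
  "group_algebra = range combination"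

lemma coef_add: "coef (S + T) g = coef S g + coef T g"
  and coef_scal: "coef (scalar c * T) g = c * coef T g"
  and coef_0: "coef 0 g = 0"
  by (transfer; simp)+

lemma coef_sum: "coef (sum T I) g = (\<Sum>i\<in>I. coef (T i) g)"
  by (induction I rule: infinite_finite_induct) (simp_all add: coef_0 coef_add)

lemma coef_translate:
  assumes "g \<in> carrier G" "h \<in> carrier G"
  shows "coef (translate g) h = (if h = g then 1 else 0)"
proof -
  have "inv g \<otimes> h = \<one> \<longleftrightarrow> h = g"
    using assms inv_equality l_inv by (metis inv_closed inv_inv)
  then show ?thesis
    using assms(2) by transfer (simp add: translate_fun_def)
qed

lemma coef_combination: "g \<in> carrier G \<Longrightarrow> coef (combination a) g = a g"
  by (simp add: combination_def coef_sum coef_scal coef_translate finite_carrier if_distrib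
      cong: if_cong)

lemma combination_cong: "(\<And>g. g \<in> carrier G \<Longrightarrow> a g = b g) \<Longrightarrow> combination a = combination b"
  unfolding combination_def by (intro sum.cong) auto

lemma combination_coef: "T \<in> group_algebra \<Longrightarrow> combination (coef T) = T"
  unfolding group_algebra_def by (auto intro!: combination_cong simp: coef_combination)

lemma combination_in: "combination a \<in> group_algebra"
  by (simp add: group_algebra_def)

lemma group_algebra_cases:
  assumes "T \<in> group_algebra"
  obtains a where "T = combination a"
  using assms by (auto simp: group_algebra_def)

lemma combination_add: "combination a + combination b = combination (\<lambda>g. a g + b g)"
  by (simp add: combination_def sum.distrib distrib_right scalar_simps)

lemma combination_single:
  assumes "h \<in> carrier G"
  shows "combination (\<lambda>g. if g = h then c else 0) = scalar c * translate h"
proof -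
  have "combination (\<lambda>g. if g = h then c else 0) = (\<Sum>g\<in>carrier G. if g = h then scalar c * translate g else 0)"
    unfolding combination_def by (intro sum.cong) (auto simp: scalar_simps)
  then show ?thesis
    using assms finite_carrier by simp
qed

lemma group_algebra_add: "S \<in> group_algebra \<Longrightarrow> T \<in> group_algebra \<Longrightarrow> S + T \<in> group_algebra"
  by (auto simp: combination_add combination_in elim!: group_algebra_cases)

lemma group_algebra_sum: "(\<And>i. i \<in> I \<Longrightarrow> T i \<in> group_algebra) \<Longrightarrow> sum T I \<in> group_algebra"
proof (induction I rule: infinite_finite_induct)
  case empty
  have "combination (\<lambda>_. 0) = 0"
    by (simp add: combination_def scalar_simps)
  then show ?case
    by (metis combination_in sum.empty)
next
  case (infinite I)
  have "combination (\<lambda>_. 0) = 0"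
    by (simp add: combination_def scalar_simps)
  then show ?case
    using infinite by (metis combination_in sum.infinite)
qed (simp add: group_algebra_add)

lemma scal_translate_in: "h \<in> carrier G \<Longrightarrow> scalar c * translate h \<in> group_algebra"
  by (metis combination_in combination_single)

lemma combination_mult:
  "combination a * combination b = (\<Sum>g\<in>carrier G. \<Sum>h\<in>carrier G. scalar (a g * b h) * translate (g \<otimes> h))"
proof -
  have "scalar (a g) * translate g * (scalar (b h) * translate h) = scalar (a g * b h) * translate (g \<otimes> h)"
    if "g \<in> carrier G" "h \<in> carrier G" for g h
  proof -
    have "scalar (a g) * translate g * (scalar (b h) * translate h)
        = scalar (a g) * (translate g * scalar (b h)) * translate h"
      by (simp only: mult.assoc)
    also have "\<dots> = scalar (a g) * (scalar (b h) * translate g) * translate h"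
      by (simp only: scalar_commute)
    also have "\<dots> = scalar (a g) * scalar (b h) * (translate g * translate h)"
      by (simp only: mult.assoc)
    finally show ?thesis
      using that by (simp add: translate_mult scalar_simps)
  qed
  then show ?thesis
    unfolding combination_def sum_product by (intro sum.cong refl) simp
qed

lemma group_algebra_mult: "S \<in> group_algebra \<Longrightarrow> T \<in> group_algebra \<Longrightarrow> S * T \<in> group_algebra"
  by (auto simp: combination_mult elim!: group_algebra_cases intro!: group_algebra_sum scal_translate_in)

lemma scal_in: "scalar c \<in> group_algebra"
  using scal_translate_in[of \<one> c] by (simp add: translate_one)

lemma fin_dim_subalgebra_group_algebra:
  "fin_dim_subalgebra (scalar :: 'k::alg_closed_field \<Rightarrow> _) group_algebra (translate ` carrier G)"
proof
  fix T :: "('g, 'k) lin_endo" assume "T \<in> group_algebra"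
  have inj: "inj_on (translate :: 'g \<Rightarrow> ('g, 'k) lin_endo) (carrier G)"
    by (rule inj_onI) (metis coef_translate zero_neq_one)
  have "T = (\<Sum>b\<in>translate ` carrier G. scalar (coef T (inv_into (carrier G) translate b)) * b)"
    by (subst combination_coef[OF \<open>T \<in> group_algebra\<close>, symmetric])
      (simp add: combination_def sum.reindex[OF inj] inv_into_f_f[OF inj])
  then show "\<exists>f. T = (\<Sum>b\<in>translate ` carrier G. scalar (f b) * b)"
    by (rule exI[of _ "\<lambda>b. coef T (inv_into (carrier G) translate b)"])
qed (auto simp: scalar_simps finite_carrier
    intro: scal_in group_algebra_add group_algebra_mult scalar_commute)

definition linear_extension :: "('g \<Rightarrow> 'k::field) \<Rightarrow> ('g, 'k) lin_endo \<Rightarrow> 'k" where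
  "linear_extension f T = (\<Sum>g\<in>carrier G. coef T g * f g)"

lemma linear_extension_add: "linear_extension f (S + T) = linear_extension f S + linear_extension f T"
  by (simp add: linear_extension_def coef_add sum.distrib distrib_right)

lemma linear_extension_scal: "linear_extension f (scalar c * T) = c * linear_extension f T"
  by (simp add: linear_extension_def coef_scal sum_distrib_left mult.assoc)

lemma linear_extension_0: "linear_extension f 0 = 0"
  by (simp add: linear_extension_def coef_0)

lemma linear_extension_diff: "linear_extension f (S - T) = linear_extension f S - linear_extension f T"
  using linear_extension_add[of f "S - T" T] by simp

lemma linear_extension_sum: "linear_extension f (sum T I) = (\<Sum>i\<in>I. linear_extension f (T i))"
  by (induction I rule: infinite_finite_induct) (simp_all add: linear_extension_0 linear_extension_add)

lemma linear_extension_translate: "g \<in> carrier G \<Longrightarrow> linear_extension f (translate g) = f g"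
  by (simp add: linear_extension_def coef_translate finite_carrier if_distrib if_distribR cong: if_cong)

lemma linear_extension_combination: "linear_extension f (combination a) = (\<Sum>g\<in>carrier G. a g * f g)"
  by (simp add: linear_extension_def coef_combination)

lemma linear_extension_combination_mult:
  "linear_extension f (combination a * combination b) = (\<Sum>g\<in>carrier G. \<Sum>h\<in>carrier G. a g * b h * f (g \<otimes> h))"
  by (simp add: combination_mult linear_extension_sum linear_extension_scal linear_extension_translate)

lemma linear_extension_class_function_commute:
  assumes "S \<in> group_algebra" "T \<in> group_algebra"
    and "\<And>g h. g \<in> carrier G \<Longrightarrow> h \<in> carrier G \<Longrightarrow> f (g \<otimes> h) = f (h \<otimes> g)"
  shows "linear_extension f (S * T) = linear_extension f (T * S)"
proof -
  obtain a b where "S = combination a" "T = combination b"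
    using assms(1,2) group_algebra_cases by metis
  moreover have "(\<Sum>g\<in>carrier G. \<Sum>h\<in>carrier G. a g * b h * f (g \<otimes> h))
      = (\<Sum>h\<in>carrier G. \<Sum>g\<in>carrier G. b h * a g * f (h \<otimes> g))"
    by (subst sum.swap) (intro sum.cong refl, simp add: assms(3) mult.commute)
  ultimately show ?thesis
    by (simp add: linear_extension_combination_mult)
qed

text \<open>
The linear extension of inversion, an involutive anti-automorphism of the group algebra.
\<close>

definition star :: "('g, 'k::field) lin_endo \<Rightarrow> ('g, 'k) lin_endo" where
  "star T = combination (\<lambda>g. coef T (inv g))"

lemma star_in: "star T \<in> group_algebra"
  by (simp add: star_def combination_in)

lemma star_add: "star (S + T) = star S + star T"
  by (simp add: star_def combination_add coef_add)

lemma star_0: "star 0 = 0"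
  by (simp add: star_def coef_0 combination_def scalar_simps)

lemma star_diff: "star (S - T) = star S - star T"
  using star_add[of "S - T" T] by simp

lemma star_sum: "star (sum T I) = (\<Sum>i\<in>I. star (T i))"
  by (induction I rule: infinite_finite_induct) (simp_all add: star_0 star_add)

lemma star_star: "T \<in> group_algebra \<Longrightarrow> star (star T) = T"
  by (subst (2) combination_coef[symmetric]) (auto simp: star_def coef_combination intro!: combination_cong)

lemma star_scal_translate:
  assumes "g \<in> carrier G"
  shows "star (scalar c * translate g) = scalar c * translate (inv g)"
proof -
  have "star (scalar c * translate g) = combination (\<lambda>h. if h = inv g then c else 0)"
    unfolding star_def using assms
    by (intro combination_cong) (auto simp: coef_scal coef_translate)
  then show ?thesis
    using assms by (simp add: combination_single)
qed

lemma star_combination': "star (combination a) = combination (\<lambda>g. a (inv g))"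
  unfolding star_def by (intro combination_cong) (simp add: coef_combination)

lemma sum_inv: "(\<Sum>g\<in>carrier G. f (inv g)) = (\<Sum>g\<in>carrier G. f g)"
  by (rule sum.reindex_bij_witness[of _ "\<lambda>g. inv g" "\<lambda>g. inv g"]) auto

lemma star_mult:
  assumes "S \<in> group_algebra" "T \<in> group_algebra"
  shows "star (S * T) = star T * star S"
proof -
  obtain a b where ab: "S = combination a" "T = combination b"
    using assms group_algebra_cases by metis
  have "star (S * T)
      = (\<Sum>g\<in>carrier G. \<Sum>h\<in>carrier G. scalar (a g * b h) * translate (inv h \<otimes> inv g))"
    by (simp add: ab combination_mult star_sum star_scal_translate inv_mult_group)
  also have "\<dots> = (\<Sum>h\<in>carrier G. \<Sum>g\<in>carrier G. scalar (b h * a g) * translate (inv h \<otimes> inv g))"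
    by (subst sum.swap) (simp add: mult.commute)
  also have "\<dots> = (\<Sum>h\<in>carrier G. \<Sum>g\<in>carrier G. scalar (b (inv h) * a (inv g)) * translate (h \<otimes> g))"
    by (subst sum_inv[symmetric], subst sum_inv[symmetric]) (intro sum.cong refl, simp)
  also have "\<dots> = star T * star S"
    by (simp add: ab star_combination' combination_mult)
  finally show ?thesis .
qed

lemma linear_extension_star: "linear_extension f (star T) = linear_extension (\<lambda>g. f (inv g)) T"
  unfolding star_def linear_extension_combination unfolding linear_extension_def
  by (subst sum_inv[symmetric]) simp

end

section \<open>Real elements and self-dual irreducible representations\<close>

text \<open>
In characteristic 2 one cannot take \<open>f = \<chi> / 2\<close>.  Instead \<open>f\<close> keeps the values of \<open>\<chi>\<close> on one class out of
each pair of mutually inverse classes and is 0 on the other; on a class equal to its inverse, \<open>\<chi>\<close>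
vanishes by assumption.
\<close>

lemma (in finite_group) split_symmetric_class_function:
  fixes \<chi> :: "'g \<Rightarrow> 'k::field"
  assumes comm: "\<And>g h. g \<in> carrier G \<Longrightarrow> h \<in> carrier G \<Longrightarrow> \<chi> (g \<otimes> h) = \<chi> (h \<otimes> g)"
    and inv: "\<And>g. g \<in> carrier G \<Longrightarrow> \<chi> (inv g) = \<chi> g"
    and real: "\<And>g. real_element G g \<Longrightarrow> \<chi> g = 0"
  shows "\<exists>f. (\<forall>g\<in>carrier G. \<forall>h\<in>carrier G. f (g \<otimes> h) = f (h \<otimes> g)) \<and>
    (\<forall>g\<in>carrier G. f g + f (inv g) = \<chi> g)"
proof -
  define C where "C g = {inv x \<otimes> g \<otimes> x | x. x \<in> carrier G}" for g
  have self: "g \<in> C g" if "g \<in> carrier G" for g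
    unfolding C_def using that by (intro CollectI exI[of _ \<one>]) simp
  have C_sub: "C y \<subseteq> C g" if g: "g \<in> carrier G" and y: "y \<in> C g" for g y
  proof
    fix z assume "z \<in> C y"
    then obtain w where w: "w \<in> carrier G" "z = inv w \<otimes> y \<otimes> w"
      by (auto simp: C_def)
    obtain x where x: "x \<in> carrier G" "y = inv x \<otimes> g \<otimes> x"
      using y by (auto simp: C_def)
    have "z = inv (x \<otimes> w) \<otimes> g \<otimes> (x \<otimes> w)"
      unfolding w(2) x(2) using w(1) x(1) g by (simp add: inv_mult_group m_assoc)
    then show "z \<in> C g"
      unfolding C_def using w(1) x(1) by blast
  qed
  have C_sym: "g \<in> C y" "y \<in> carrier G" if g: "g \<in> carrier G" and y: "y \<in> C g" for g y
  proof -
    obtain x where x: "x \<in> carrier G" "y = inv x \<otimes> g \<otimes> x"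
      using y unfolding C_def by blast
    then show "y \<in> carrier G"
      using g by simp
    have "x \<otimes> y = g \<otimes> x"
      using x g by (simp add: m_assoc[symmetric])
    then have "g = x \<otimes> y \<otimes> inv x"
      using x g by (simp add: m_assoc)
    then have "g = inv (inv x) \<otimes> y \<otimes> inv x"
      using x by simp
    then show "g \<in> C y"
      unfolding C_def using x(1) by blast
  qed
  have C_eq: "C y = C g" if "g \<in> carrier G" "y \<in> C g" for g y
    using C_sub[OF that] C_sub[of y g] C_sym[OF that] by blast
  have C_comm: "C (g \<otimes> h) = C (h \<otimes> g)" if "g \<in> carrier G" "h \<in> carrier G" for g h
  proof (rule C_eq)
    have "g \<otimes> h = inv h \<otimes> (h \<otimes> g) \<otimes> h"
      using that by (simp add: m_assoc[symmetric])
    then show "g \<otimes> h \<in> C (h \<otimes> g)"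
      unfolding C_def using that(2) by blast
  qed (use that in simp)
  have inv_real: "real_element G g" if g: "g \<in> carrier G" and eq: "C (inv g) = C g" for g
  proof -
    have "inv g \<in> C g"
      using self[of "inv g"] g eq by simp
    then obtain x where x: "x \<in> carrier G" "inv g = inv x \<otimes> g \<otimes> x"
      by (auto simp: C_def)
    have "inverts G x g"
      unfolding inverts_def by (rule x(2)[symmetric])
    then show ?thesis
      unfolding real_element_def using g x(1) by auto
  qed
  define r where "r g = (SOME x. x \<in> C g \<union> C (inv g))" for g
  have r: "r g \<in> C g \<union> C (inv g)" if "g \<in> carrier G" for g
    unfolding r_def using self[OF that] by (intro someI[of "\<lambda>x. x \<in> C g \<union> C (inv g)" g]) simp
  define f where "f g = (if r g \<in> C g then \<chi> g else 0)" for g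
  have "f (g \<otimes> h) = f (h \<otimes> g)" if "g \<in> carrier G" "h \<in> carrier G" for g h
  proof -
    have "C (inv (g \<otimes> h)) = C (inv (h \<otimes> g))"
      using that C_comm[of "inv h" "inv g"] by (simp add: inv_mult_group)
    then have "r (g \<otimes> h) = r (h \<otimes> g)"
      unfolding r_def using C_comm[OF that] by simp
    then show ?thesis
      unfolding f_def using C_comm[OF that] comm[OF that] by simp
  qed
  moreover have "f g + f (inv g) = \<chi> g" if g: "g \<in> carrier G" for g
  proof -
    have r_inv: "r (inv g) = r g"
      unfolding r_def using g by (simp add: Un_commute)
    show ?thesis
    proof (cases "r g \<in> C g \<and> r g \<in> C (inv g)")
      case True
      then have "C (inv g) = C g"
        using C_eq[of g "r g"] C_eq[of "inv g" "r g"] g by simp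
      then have "\<chi> g = 0"
        using real inv_real g by blast
      then show ?thesis
        using inv[OF g] by (simp add: f_def)
    next
      case False
      then show ?thesis
        using r[OF g] r_inv inv[OF g] by (auto simp: f_def)
    qed
  qed
  ultimately show ?thesis
    by blast
qed

lemma subspace_vecI:
  fixes W :: "'k::field vec set"
  assumes "W \<subseteq> carrier_vec n" "0\<^sub>v n \<in> W"
    and "\<And>v w. v \<in> W \<Longrightarrow> w \<in> W \<Longrightarrow> v + w \<in> W"
    and "\<And>c v. v \<in> W \<Longrightarrow> c \<cdot>\<^sub>v v \<in> W"
  shows "VectorSpace.subspace class_ring W (module_vec TYPE('k) n)"
proof -
  have "submodule class_ring W (module_vec TYPE('k) n)"
    by (rule submodule.intro[OF vec_module]) (use assms in \<open>auto simp: module_vec_simps\<close>)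
  then show ?thesis
    by (rule subspace.intro[OF vec_vs])
qed

locale matrix_rep = group G for G :: "('g, 'b) monoid_scheme" (structure) +
  fixes n :: nat and X :: "'g \<Rightarrow> 'k::field mat"
  assumes X_hom: "X \<in> hom G (GL TYPE('k) n)"
begin

lemma X_carrier [simp, intro]: "g \<in> carrier G \<Longrightarrow> X g \<in> carrier_mat n n"
  using X_hom by (auto simp: hom_def GL_def units_of_def Units_def ring_mat_simps)

lemma X_dim [simp]: "g \<in> carrier G \<Longrightarrow> dim_row (X g) = n" "g \<in> carrier G \<Longrightarrow> dim_col (X g) = n"
  using X_carrier by (meson carrier_matD)+

lemma X_mult: "g \<in> carrier G \<Longrightarrow> h \<in> carrier G \<Longrightarrow> X (g \<otimes> h) = X g * X h"
  using X_hom by (auto simp: hom_def GL_def units_of_def ring_mat_simps)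

lemma X_one: "X \<one> = 1\<^sub>m n"
proof -
  interpret M: ring "ring_mat TYPE('k) n ()"
    by (rule ring_mat)
  have "group (GL TYPE('k) n)"
    unfolding GL_def by (rule M.units_group)
  then have "X \<one> = \<one>\<^bsub>GL TYPE('k) n\<^esub>"
    using X_hom is_group by (intro hom_one)
  then show ?thesis
    by (simp add: GL_def units_of_def ring_mat_simps)
qed

lemma X_pow: "g \<in> carrier G \<Longrightarrow> X (g [^] (k::nat)) = X g ^\<^sub>m k"
  by (induction k) (simp_all add: X_one X_mult)

end

lemma matrix_repI:
  "group G \<Longrightarrow> X \<in> hom G (GL TYPE('k) n) \<Longrightarrow> matrix_rep G n (X :: 'g \<Rightarrow> 'k::field mat)"
  by (simp add: matrix_rep_def matrix_rep_axioms_def)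

definition mat_trace :: "'k::comm_ring_1 mat \<Rightarrow> 'k" where
  "mat_trace M = (\<Sum>i<dim_row M. M $$ (i, i))"

lemma mat_trace_mult_commute:
  assumes "M \<in> carrier_mat n m" "N \<in> carrier_mat m n"
  shows "mat_trace (M * N) = mat_trace (N * M)"
proof -
  have "mat_trace (M * N) = (\<Sum>i<n. \<Sum>j<m. M $$ (i, j) * N $$ (j, i))"
    using assms by (auto simp: mat_trace_def scalar_prod_def atLeast0LessThan intro!: sum.cong)
  also have "\<dots> = (\<Sum>j<m. \<Sum>i<n. N $$ (j, i) * M $$ (i, j))"
    by (subst sum.swap) (simp add: mult.commute)
  also have "\<dots> = mat_trace (N * M)"
    using assms by (auto simp: mat_trace_def scalar_prod_def atLeast0LessThan intro!: sum.cong)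
  finally show ?thesis .
qed

lemma sum_mult_delta:
  "j < (n::nat) \<Longrightarrow> (\<Sum>k<n. f k * (if k = j then 1 else 0)) = (f j :: 'k::semiring_1)"
  by (simp add: if_distrib cong: if_cong)

locale finite_irreducible_rep = finite_group G + matrix_rep G n X
  for G :: "('g, 'b) monoid_scheme" (structure) and n and X :: "'g \<Rightarrow> 'k::alg_closed_field mat" +
  assumes irreducible: "irreducible_rep G n X"
begin

lemma n_pos: "0 < n"
  using irreducible by (simp add: irreducible_rep_def)

definition entry :: "nat \<Rightarrow> nat \<Rightarrow> ('g, 'k) lin_endo \<Rightarrow> 'k" where
  "entry i j T = linear_extension (\<lambda>g. X g $$ (i, j)) T"

lemma entry_mult:
  assumes "S \<in> group_algebra" "T \<in> group_algebra" "i < n" "j < n"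
  shows "entry i j (S * T) = (\<Sum>k<n. entry i k S * entry k j T)"
proof -
  obtain a b where ab: "S = combination a" "T = combination b"
    using assms(1,2) group_algebra_cases by metis
  have X: "X (g \<otimes> h) $$ (i, j) = (\<Sum>k<n. X g $$ (i, k) * X h $$ (k, j))"
    if "g \<in> carrier G" "h \<in> carrier G" for g h
    using that assms(3,4) by (simp add: X_mult scalar_prod_def atLeast0LessThan)
  have "entry i j (S * T)
      = (\<Sum>g\<in>carrier G. \<Sum>h\<in>carrier G. \<Sum>k<n. (a g * X g $$ (i, k)) * (b h * X h $$ (k, j)))"
    unfolding entry_def ab linear_extension_combination_mult
    by (intro sum.cong refl) (simp add: X sum_distrib_left mult_ac)
  also have "\<dots> = (\<Sum>k<n. \<Sum>g\<in>carrier G. \<Sum>h\<in>carrier G. (a g * X g $$ (i, k)) * (b h * X h $$ (k, j)))"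
    by (subst (2) sum.swap, subst sum.swap) (rule refl)
  also have "\<dots> = (\<Sum>k<n. entry i k S * entry k j T)"
    unfolding entry_def ab linear_extension_combination by (simp add: sum_product)
  finally show ?thesis .
qed

lemma entry_add: "entry i j (S + T) = entry i j S + entry i j T"
  and entry_diff: "entry i j (S - T) = entry i j S - entry i j T"
  and entry_scal: "entry i j (scalar c * T) = c * entry i j T"
  and entry_0: "entry i j 0 = 0"
  by (simp_all add: entry_def linear_extension_add linear_extension_diff linear_extension_scal linear_extension_0)

lemma entry_translate: "g \<in> carrier G \<Longrightarrow> entry i j (translate g) = X g $$ (i, j)"
  by (simp add: entry_def linear_extension_translate)

lemma entry_1: "i < n \<Longrightarrow> j < n \<Longrightarrow> entry i j 1 = (if i = j then 1 else 0)"
  using entry_translate[of \<one> i j] by (simp add: translate_one X_one)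

definition annihilator :: "('g, 'k) lin_endo set" where
  "annihilator = {T \<in> group_algebra. \<forall>i<n. \<forall>j<n. entry i j T = 0}"

lemma annihilator_entry: "T \<in> annihilator \<Longrightarrow> i < n \<Longrightarrow> j < n \<Longrightarrow> entry i j T = 0"
  by (simp add: annihilator_def)

text \<open>
The column \<open>l\<close> of the matrices of \<open>s * b\<close>, for varying \<open>s\<close>, runs through an invariant subspace, which
is everything by irreducibility.
\<close>

lemma exists_unit_column:
  assumes b: "b \<in> group_algebra" and kl: "k < n" "l < n" "entry k l b \<noteq> 0" and j: "j < n"
  shows "\<exists>s\<in>group_algebra. \<forall>i<n. entry i l (s * b) = (if i = j then 1 else 0)"
proof -
  define col where "col s = vec n (\<lambda>i. entry i l (s * b))" for s
  define W where "W = col ` group_algebra"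
  have "VectorSpace.subspace class_ring W (module_vec TYPE('k) n)"
  proof (rule subspace_vecI)
    show "W \<subseteq> carrier_vec n"
      by (auto simp: W_def col_def)
    have "col 0 = 0\<^sub>v n"
      by (auto simp: col_def entry_0)
    moreover have "(0 :: ('g, 'k) lin_endo) \<in> group_algebra"
      using scal_in[of 0] by (simp add: scalar_simps)
    ultimately show "0\<^sub>v n \<in> W"
      unfolding W_def by (metis imageI)
    fix v w assume vw: "v \<in> W" "w \<in> W"
    then obtain s t where st: "s \<in> group_algebra" "t \<in> group_algebra" "v = col s" "w = col t"
      by (auto simp: W_def)
    have "v + w = col (s + t)"
      by (auto simp: st col_def entry_add distrib_right)
    then show "v + w \<in> W"
      using st group_algebra_add by (auto simp: W_def)
  next
    fix c v assume "v \<in> W"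
    then obtain s where s: "s \<in> group_algebra" "v = col s"
      by (auto simp: W_def)
    have "c \<cdot>\<^sub>v v = col (scalar c * s)"
      by (auto simp: s col_def entry_scal mult.assoc)
    then show "c \<cdot>\<^sub>v v \<in> W"
      using s group_algebra_mult scal_in by (auto simp: W_def)
  qed
  moreover have "X g *\<^sub>v w \<in> W" if g: "g \<in> carrier G" and "w \<in> W" for g w
  proof -
    obtain s where s: "s \<in> group_algebra" "w = col s"
      using \<open>w \<in> W\<close> by (auto simp: W_def)
    have tg: "translate g \<in> (group_algebra :: ('g, 'k) lin_endo set)"
      using scal_translate_in[OF g, of 1] by (simp add: scalar_simps)
    have "X g *\<^sub>v w = col (translate g * s)"
      using g s b kl tg
      by (intro eq_vecI)
        (auto simp: col_def mult.assoc entry_mult group_algebra_mult entry_translate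
          scalar_prod_def atLeast0LessThan intro!: sum.cong)
    then show ?thesis
      using tg s group_algebra_mult by (auto simp: W_def)
  qed
  ultimately have "W = {0\<^sub>v n} \<or> W = carrier_vec n"
    using irreducible unfolding irreducible_rep_def by blast
  moreover have "W \<noteq> {0\<^sub>v n}"
  proof
    assume "W = {0\<^sub>v n}"
    moreover have "col 1 \<in> W"
      unfolding W_def using scal_in[of 1] by (intro imageI) (simp add: scalar_simps)
    ultimately have "col 1 $ k = 0\<^sub>v n $ k"
      by simp
    then show False
      using kl by (simp add: col_def)
  qed
  ultimately have "unit_vec n j \<in> W"
    by simp
  then obtain s where s: "s \<in> group_algebra" "unit_vec n j = col s"
    by (auto simp: W_def)
  have "entry i l (s * b) = (if i = j then 1 else 0)" if "i < n" for i
    using arg_cong[OF s(2), of "\<lambda>v. v $ i"] that j by (simp add: col_def)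
  then show ?thesis
    using s(1) by blast
qed

sublocale fin_dim_subalgebra_prime scalar group_algebra "translate ` carrier G" annihilator
proof -
  interpret fin_dim_subalgebra "scalar :: 'k \<Rightarrow> ('g, 'k) lin_endo" group_algebra "translate ` carrier G"
    by (rule fin_dim_subalgebra_group_algebra)
  show "fin_dim_subalgebra_prime (scalar :: 'k \<Rightarrow> ('g, 'k) lin_endo) group_algebra
      (translate ` carrier G) annihilator"
  proof
    show "0 \<in> annihilator"
      using A_scal[of 0] by (simp add: annihilator_def entry_0 scalar_simps)
    show "1 \<notin> annihilator"
      using n_pos by (auto simp: annihilator_def entry_1)
    fix a b :: "('g, 'k) lin_endo"
    show "a + b \<in> annihilator" if "a \<in> annihilator" "b \<in> annihilator"
      using that A_add by (simp add: annihilator_def entry_add)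
    show "a * b \<in> annihilator" if "a \<in> group_algebra" "b \<in> annihilator"
      using that A_mult by (simp add: annihilator_def entry_mult)
    show "a * b \<in> annihilator" if "a \<in> annihilator" "b \<in> group_algebra"
      using that A_mult by (simp add: annihilator_def entry_mult)
    show "\<exists>s\<in>group_algebra. a * s * b \<notin> annihilator"
      if a: "a \<in> group_algebra" "a \<notin> annihilator" and b: "b \<in> group_algebra" "b \<notin> annihilator"
    proof -
      obtain i j where ij: "i < n" "j < n" "entry i j a \<noteq> 0"
        using a by (auto simp: annihilator_def)
      obtain k l where kl: "k < n" "l < n" "entry k l b \<noteq> 0"
        using b by (auto simp: annihilator_def)
      obtain s where s: "s \<in> group_algebra" "\<forall>i<n. entry i l (s * b) = (if i = j then 1 else 0)"
        using exists_unit_column[OF b(1) kl ij(2)] by blast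
      have "entry i l (a * s * b) = (\<Sum>k<n. entry i k a * (if k = j then 1 else 0))"
        using a b s ij kl by (simp add: mult.assoc entry_mult A_mult)
      also have "\<dots> = entry i j a"
        using ij(2) by (rule sum_mult_delta)
      finally have "a * s * b \<notin> annihilator"
        using ij kl annihilator_entry[of "a * s * b" i l] by auto
      then show ?thesis
        using s(1) by blast
    qed
  qed
qed

text \<open>
The matrix of \<open>e\<close> has rank one: by \<open>exists_unit_column\<close> every column of it is a column of the matrix of
some \<open>e x e\<close>, hence a multiple of one fixed column.  A nonzero idempotent of rank one has trace 1.
\<close>

lemma trace_idempotent_nonzero:
  assumes e: "e \<in> group_algebra" "e \<notin> annihilator" "e * e = e"
    and corner: "\<And>x. x \<in> group_algebra \<Longrightarrow> \<exists>\<mu>. e * x * e - scalar \<mu> * e \<in> annihilator"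
  shows "(\<Sum>i<n. entry i i e) \<noteq> 0"
proof -
  obtain i\<^sub>0 l where il: "i\<^sub>0 < n" "l < n" "entry i\<^sub>0 l e \<noteq> 0"
    using e by (auto simp: annihilator_def)
  have "\<exists>\<mu>. \<forall>i<n. entry i j e = \<mu> * entry i l e" if j: "j < n" for j
  proof -
    obtain s where s: "s \<in> group_algebra" "\<forall>i<n. entry i l (s * e) = (if i = j then 1 else 0)"
      using exists_unit_column[OF e(1) il j] by blast
    obtain \<mu> where \<mu>: "e * s * e - scalar \<mu> * e \<in> annihilator"
      using corner[OF s(1)] by blast
    have "entry i j e = \<mu> * entry i l e" if i: "i < n" for i
    proof -
      have "entry i j e = entry i l (e * s * e)"
        using e s i il j by (simp add: mult.assoc entry_mult[of e "s * e"] A_mult sum_mult_delta)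
      moreover have "entry i l (e * s * e - scalar \<mu> * e) = 0"
        using \<mu> i il by (simp add: annihilator_def)
      ultimately show ?thesis
        by (simp add: entry_diff entry_scal)
    qed
    then show ?thesis
      by blast
  qed
  then obtain \<mu> where \<mu>: "\<And>i j. i < n \<Longrightarrow> j < n \<Longrightarrow> entry i j e = \<mu> j * entry i l e"
    by metis
  have "entry i\<^sub>0 l e = (\<Sum>k<n. entry i\<^sub>0 k e * entry k l e)"
    using entry_mult[of e e i\<^sub>0 l] e il by simp
  also have "\<dots> = (\<Sum>k<n. entry i\<^sub>0 l e * (\<mu> k * entry k l e))"
    by (intro sum.cong refl) (subst \<mu>, use il in auto)
  also have "\<dots> = entry i\<^sub>0 l e * (\<Sum>k<n. entry k k e)"
    unfolding sum_distrib_left[symmetric] using \<mu> by simp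
  finally show ?thesis
    using il(3) by auto
qed

text \<open>
With \<open>\<chi>\<close> the trace function of \<open>X\<close>: if \<open>\<chi>\<close> vanished at the real elements, then \<open>\<chi> = f + f\<^sup>*\<close> and \<open>e = u v\<close>, \<open>e\<^sup>* = v u\<close> would give
\<open>\<chi> e = 2 f e = 0\<close>.
\<close>

theorem exists_real_element_trace_nonzero:
  assumes char2: "CHAR('k) = 2"
    and inv: "\<And>g. g \<in> carrier G \<Longrightarrow> mat_trace (X (inv g)) = mat_trace (X g)"
  shows "\<exists>g. real_element G g \<and> mat_trace (X g) \<noteq> 0"
proof (rule ccontr)
  assume neg: "\<not> ?thesis"
  define \<chi> where "\<chi> g = mat_trace (X g)" for g
  have comm: "\<chi> (g \<otimes> h) = \<chi> (h \<otimes> g)" if "g \<in> carrier G" "h \<in> carrier G" for g h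
    using that by (simp add: \<chi>_def X_mult mat_trace_mult_commute[of "X g" n n "X h"])
  obtain f where f: "\<And>g h. g \<in> carrier G \<Longrightarrow> h \<in> carrier G \<Longrightarrow> f (g \<otimes> h) = f (h \<otimes> g)"
      "\<And>g. g \<in> carrier G \<Longrightarrow> f g + f (inv g) = \<chi> g"
  proof -
    have "\<exists>f. (\<forall>g\<in>carrier G. \<forall>h\<in>carrier G. f (g \<otimes> h) = f (h \<otimes> g)) \<and>
        (\<forall>g\<in>carrier G. f g + f (inv g) = \<chi> g)"
    proof (rule split_symmetric_class_function)
      show "\<chi> g = 0" if "real_element G g" for g
        using neg that unfolding \<chi>_def by blast
      show "\<chi> (inv g) = \<chi> g" if "g \<in> carrier G" for g
        unfolding \<chi>_def using that by (rule inv)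
    qed (rule comm)
    then show ?thesis
      using that by blast
  qed
  have linear_extension_\<chi>: "linear_extension \<chi> T = (\<Sum>i<n. entry i i T)" for T
    unfolding \<chi>_def mat_trace_def entry_def linear_extension_def
    by (subst sum.swap) (simp add: sum_distrib_left)
  obtain e where e: "e \<in> group_algebra" "e \<notin> annihilator" "e * e = e"
      and min: "\<And>x. x \<in> group_algebra \<Longrightarrow> e * x \<notin> annihilator \<Longrightarrow> \<exists>y\<in>group_algebra. e = e * x * y"
    using exists_primitive_idempotent by blast
  have nz: "linear_extension \<chi> e \<noteq> 0"
    unfolding linear_extension_\<chi> using e idempotent_corner_scalar[OF e min] by (rule trace_idempotent_nonzero)
  have "linear_extension \<chi> (star e) = linear_extension \<chi> e"
    unfolding linear_extension_star by (simp add: linear_extension_def inv \<chi>_def)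
  then have "(\<Sum>i<n. entry i i (star e)) \<noteq> 0"
    using nz by (simp add: linear_extension_\<chi>)
  then obtain i where "i < n" "entry i i (star e) \<noteq> 0"
    by (elim sum.not_neutral_contains_not_neutral) simp
  then have "star e \<notin> annihilator"
    using annihilator_entry by blast
  then obtain u v where uv: "u \<in> group_algebra" "v \<in> group_algebra" "u * v = e" "v * u = star e"
    using idempotent_equivalent_to_image[OF star_in star_diff star_mult star_star e
        \<open>star e \<notin> annihilator\<close> min] by auto
  have "linear_extension \<chi> e = linear_extension f e + linear_extension (\<lambda>g. f (inv g)) e"
    unfolding linear_extension_def sum.distrib[symmetric] distrib_left[symmetric] using f(2) by simp
  also have "linear_extension (\<lambda>g. f (inv g)) e = linear_extension f e"
    using linear_extension_class_function_commute[OF uv(1,2), of f] f(1) uv by (simp add: linear_extension_star[symmetric])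
  also have "linear_extension f e + linear_extension f e = of_nat 2 * linear_extension f e"
    by simp
  also have "of_nat 2 = (0 :: 'k)"
    using char2 by (metis of_nat_CHAR)
  finally show False
    using nz by simp
qed

end

section \<open>Eigenvalues with multiplicity, and sums of roots of unity\<close>

lemma exists_invertible_first_column:
  fixes v :: "'k::field vec"
  assumes v: "v \<in> carrier_vec n" "v \<noteq> 0\<^sub>v n" and n: "0 < n"
  shows "\<exists>W W'. W \<in> carrier_mat n n \<and> W' \<in> carrier_mat n n \<and> W * W' = 1\<^sub>m n \<and> W' * W = 1\<^sub>m n \<and> col W 0 = v"
proof -
  interpret vec_space "TYPE('k)" n .
  define b where "b = basis_completion v"
  note b = basis_completion[OF v, folded b_def]
  define W where "W = mat_of_cols n b"
  have W: "W \<in> carrier_mat n n"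
    unfolding W_def using b(6) mat_of_cols_carrier(1)[of n b] by simp
  have "rank W = n"
    using lin_indpt_full_rank[OF W] b(2,4,5) by (simp add: W_def)
  then have "det W \<noteq> 0"
    using det_rank_iff[OF W] by simp
  then have "W \<in> Units (ring_mat TYPE('k) n ())"
    by (rule det_non_zero_imp_unit[OF W])
  then obtain W' where W': "W' \<in> carrier_mat n n" "W * W' = 1\<^sub>m n" "W' * W = 1\<^sub>m n"
    by (auto simp: Units_def ring_mat_simps)
  have "b ! 0 = v"
    using b(6,7) n by (cases b) auto
  then have "col W 0 = v"
    unfolding W_def using b(6) v(1) n by simp
  then show ?thesis
    using W W' by blast
qed

lemma exists_eigenvector:
  fixes A :: "'k::alg_closed_field mat"
  assumes A: "A \<in> carrier_mat n n" and n: "0 < n"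
  shows "\<exists>a v. v \<in> carrier_vec n \<and> v \<noteq> 0\<^sub>v n \<and> A *\<^sub>v v = a \<cdot>\<^sub>v v"
proof -
  have "degree (char_poly A) > 0"
    using degree_monic_char_poly[OF A] n by simp
  then obtain a where "poly (char_poly A) a = 0"
    using alg_closed_imp_poly_has_root by blast
  then have "eigenvalue A a"
    using eigenvalue_root_char_poly[OF A] by simp
  then show ?thesis
    using A unfolding eigenvalue_def eigenvector_def by auto
qed

text \<open>
An eigenvector, completed to a basis, splits off a block of size 1; the rest is induction.
\<close>

lemma exists_similar_upper_triangular:
  fixes A :: "'k::alg_closed_field mat"
  assumes "A \<in> carrier_mat n n"
  shows "\<exists>U. U \<in> carrier_mat n n \<and> upper_triangular U \<and> similar_mat A U"
  using assms
proof (induction n arbitrary: A)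
  case 0
  then show ?case
    by (intro exI[of _ A]) (auto intro: similar_mat_refl)
next
  case (Suc n)
  note A = Suc.prems
  obtain a v where v: "v \<in> carrier_vec (Suc n)" "v \<noteq> 0\<^sub>v (Suc n)" "A *\<^sub>v v = a \<cdot>\<^sub>v v"
    using exists_eigenvector[OF A] by auto
  obtain W W' where W: "W \<in> carrier_mat (Suc n) (Suc n)" "W' \<in> carrier_mat (Suc n) (Suc n)"
      "W * W' = 1\<^sub>m (Suc n)" "W' * W = 1\<^sub>m (Suc n)" "col W 0 = v"
    using exists_invertible_first_column[OF v(1,2)] by auto
  define B where "B = W' * A * W"
  have B: "B \<in> carrier_mat (Suc n) (Suc n)"
    using A W by (simp add: B_def)
  have "W * B * W' = A"
  proof -
    have "W * B * W' = W * (W' * (A * (W * W')))"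
      using A W(1,2) by (simp add: B_def assoc_mult_mat[of _ "Suc n" "Suc n" _ "Suc n" _ "Suc n"])
    also have "\<dots> = (W * W') * A"
      unfolding W(3) using A W(1,2) W(3)
      by (simp add: assoc_mult_mat[of W "Suc n" "Suc n" W' "Suc n" A "Suc n", symmetric])
    finally show ?thesis
      using A by (simp add: W(3))
  qed
  then have AB: "similar_mat A B"
    by (intro similar_matI[of _ _ W W' "Suc n"]) (use A B W in auto)
  have WA: "W' * A \<in> carrier_mat (Suc n) (Suc n)"
    using A W by simp
  have "col B 0 = (W' * A) *\<^sub>v v"
    unfolding B_def W(5)[symmetric] by (rule col_mult2[OF WA W(1)]) simp
  also have "\<dots> = W' *\<^sub>v (a \<cdot>\<^sub>v v)"
    using assoc_mult_mat_vec[OF W(2) A v(1)] v(3) by simp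
  also have "\<dots> = a \<cdot>\<^sub>v (W' *\<^sub>v col W 0)"
    using W(2,5) v(1) by (simp add: mult_mat_vec)
  also have "W' *\<^sub>v col W 0 = col (W' * W) 0"
    by (rule col_mult2[OF W(2,1), symmetric]) simp
  finally have col0: "col B 0 = a \<cdot>\<^sub>v col (1\<^sub>m (Suc n)) 0"
    by (simp add: W(4))
  have B0: "B $$ (i, 0) = 0" if "0 < i" "i < Suc n" for i
    using arg_cong[OF col0, of "\<lambda>w. w $ i"] that B by simp
  obtain B1 B2 B3 B4 where split: "split_block B 1 1 = (B1, B2, B3, B4)"
    by (cases "split_block B 1 1") auto
  have dims: "dim_row B = 1 + n" "dim_col B = 1 + n"
    using B by auto
  note sb = split_block[OF split dims]
  have "B3 = 0\<^sub>m n 1"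
    using split B0 B by (auto simp: split_block_def Let_def)
  then have Bblock: "B = four_block_mat B1 B2 (0\<^sub>m n 1) B4"
    using sb(5) by simp
  obtain U where U: "U \<in> carrier_mat n n" "upper_triangular U" "similar_mat B4 U"
    using Suc.IH[OF sb(4)] by blast
  obtain B0 where B0': "B0 \<in> carrier_mat 1 n"
      "similar_mat (four_block_mat B1 B2 (0\<^sub>m n 1) B4) (four_block_mat B1 B0 (0\<^sub>m n 1) U)"
    using similar_mat_four_block_0_ex[OF similar_mat_refl[OF sb(1)] U(3) sb(2,1,4)] by blast
  define C where "C = four_block_mat B1 B0 (0\<^sub>m n 1) U"
  have "upper_triangular C"
    unfolding C_def by (rule upper_triangular_four_block[OF sb(1) U(1) _ U(2)]) (use sb(1) in auto)
  moreover have "C \<in> carrier_mat (Suc n) (Suc n)"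
    using sb(1) U(1) by (auto simp: C_def)
  moreover have "similar_mat A C"
    using B0'(2) unfolding C_def Bblock[symmetric] by (rule similar_mat_trans[OF AB])
  ultimately show ?case
    by blast
qed

lemma upper_triangular_mult:
  fixes U V :: "'k::comm_ring_1 mat"
  assumes U: "U \<in> carrier_mat n n" "upper_triangular U" and V: "V \<in> carrier_mat n n" "upper_triangular V"
  shows "upper_triangular (U * V)"
    and "i < n \<Longrightarrow> (U * V) $$ (i, i) = U $$ (i, i) * V $$ (i, i)"
proof -
  have entry: "(U * V) $$ (i, j) = (\<Sum>k<n. U $$ (i, k) * V $$ (k, j))" if "i < n" "j < n" for i j
    using that U V by (simp add: scalar_prod_def atLeast0LessThan)
  have zero: "U $$ (i, k) * V $$ (k, j) = 0" if "i < n" "k < n" "k < i \<or> j < k" for i j k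
    using that U V by (auto dest: upper_triangularD)
  show "upper_triangular (U * V)"
  proof (rule upper_triangularI)
    fix i j assume "j < i" "i < dim_row (U * V)"
    then show "(U * V) $$ (i, j) = 0"
      using U(1) by (subst entry) (auto intro!: sum.neutral zero)
  qed
  show "(U * V) $$ (i, i) = U $$ (i, i) * V $$ (i, i)" if "i < n"
  proof -
    have "(U * V) $$ (i, i) = (\<Sum>k\<in>{i}. U $$ (i, k) * V $$ (k, i))"
      unfolding entry[OF that that]
      by (rule sum.mono_neutral_right) (use that zero nat_neq_iff in auto)
    then show ?thesis
      by simp
  qed
qed

lemma upper_triangular_pow:
  fixes U :: "'k::comm_ring_1 mat"
  assumes U: "U \<in> carrier_mat n n" "upper_triangular U"
  shows "upper_triangular (U ^\<^sub>m k) \<and> (\<forall>i<n. (U ^\<^sub>m k) $$ (i, i) = (U $$ (i, i)) ^ k)"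
proof (induction k)
  case 0
  then show ?case
    using U(1) by auto
next
  case (Suc k)
  have Uk: "U ^\<^sub>m k \<in> carrier_mat n n"
    using U(1) by simp
  show ?case
    using upper_triangular_mult[OF Uk _ U] Suc by simp
qed

abbreviation eigenvalues :: "'k::idom mat \<Rightarrow> 'k multiset" where
  "eigenvalues A \<equiv> proots (char_poly A)"

lemma eigenvalues_similar: "similar_mat A B \<Longrightarrow> eigenvalues A = eigenvalues B"
  by (simp add: char_poly_similar)

lemma eigenvalues_upper_triangular:
  fixes U :: "'k::idom mat"
  assumes "U \<in> carrier_mat n n" "upper_triangular U"
  shows "eigenvalues U = image_mset (\<lambda>i. U $$ (i, i)) (mset [0..<n])"
proof -
  have nz: "(\<Prod>a\<leftarrow>as. [:- a, 1:]) \<noteq> 0" for as :: "'k list"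
    by (induction as) (simp_all del: mult_pCons_left)
  have "proots (\<Prod>a\<leftarrow>as. [:- a, 1:]) = mset as" for as :: "'k list"
  proof (induction as)
    case (Cons a as)
    have "proots ([:- a, 1:] * (\<Prod>a\<leftarrow>as. [:- a, 1:])) = {#a#} + mset as"
      by (subst proots_mult[OF _ nz]) (simp_all only: Cons.IH proots_linear_factor minus_minus, simp)
    then show ?case
      by (simp del: mult_pCons_left)
  qed simp
  moreover have "char_poly U = (\<Prod>a\<leftarrow>diag_mat U. [:- a, 1:])"
    using char_poly_upper_triangular[OF assms] .
  ultimately have "eigenvalues U = mset (diag_mat U)"
    by (simp only:)
  then show ?thesis
    using assms(1) by (simp add: diag_mat_def)
qed

lemma eigenvalues_pow:
  fixes A :: "'k::alg_closed_field mat"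
  assumes A: "A \<in> carrier_mat n n"
  shows "eigenvalues (A ^\<^sub>m k) = image_mset (\<lambda>a. a ^ k) (eigenvalues A)"
proof -
  obtain U where U: "U \<in> carrier_mat n n" "upper_triangular U" "similar_mat A U"
    using exists_similar_upper_triangular[OF A] by blast
  have "similar_mat (A ^\<^sub>m k) (U ^\<^sub>m k)"
    using U(3) similar_mat_wit_pow unfolding similar_mat_def by blast
  then have "eigenvalues (A ^\<^sub>m k) = eigenvalues (U ^\<^sub>m k)"
    by (rule eigenvalues_similar)
  also have "\<dots> = image_mset (\<lambda>i. (U ^\<^sub>m k) $$ (i, i)) (mset [0..<n])"
    using upper_triangular_pow[OF U(1,2)] U(1) by (intro eigenvalues_upper_triangular) auto
  also have "\<dots> = image_mset (\<lambda>i. (U $$ (i, i)) ^ k) (mset [0..<n])"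
    using upper_triangular_pow[OF U(1,2)] by (intro image_mset_cong) auto
  also have "\<dots> = image_mset (\<lambda>a. a ^ k) (eigenvalues U)"
    by (simp add: eigenvalues_upper_triangular[OF U(1,2)] image_mset.compositionality comp_def)
  finally show ?thesis
    by (simp add: eigenvalues_similar[OF U(3)])
qed

lemma trace_eq_sum_eigenvalues:
  fixes A :: "'k::alg_closed_field mat"
  assumes A: "A \<in> carrier_mat n n"
  shows "mat_trace A = \<Sum>\<^sub># (eigenvalues A)"
proof -
  obtain U where U: "U \<in> carrier_mat n n" "upper_triangular U" "similar_mat A U"
    using exists_similar_upper_triangular[OF A] by blast
  obtain P Q where "similar_mat_wit A U P Q"
    using U(3) unfolding similar_mat_def by blast
  note w = similar_mat_witD2[OF A this]
  have "mat_trace A = mat_trace (P * (U * Q))"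
    using w by (simp add: assoc_mult_mat[of _ n n _ n _ n])
  also have "\<dots> = mat_trace (U * Q * P)"
    using w by (intro mat_trace_mult_commute[of _ n n]) auto
  also have "U * Q * P = U"
    using w by (simp add: assoc_mult_mat[of _ n n _ n _ n])
  also have "mat_trace U = \<Sum>\<^sub># (eigenvalues U)"
    using U(1) by (simp add: eigenvalues_upper_triangular[OF U(1,2)] mat_trace_def
        sum_unfold_sum_mset atLeast0LessThan)
  finally show ?thesis
    by (simp add: eigenvalues_similar[OF U(3)])
qed

lemma eigenvalues_one: "eigenvalues (1\<^sub>m n :: 'k::idom mat) = replicate_mset n 1"
proof -
  have "eigenvalues (1\<^sub>m n :: 'k mat) = image_mset (\<lambda>i. 1) (mset [0..<n])"
    by (subst eigenvalues_upper_triangular[of _ n]) (auto intro!: image_mset_cong)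
  then show ?thesis
    by (simp add: image_mset_const_eq)
qed

lemma size_eigenvalues:
  fixes A :: "'k::alg_closed_field mat"
  assumes "A \<in> carrier_mat n n"
  shows "size (eigenvalues A) = n"
proof -
  obtain U where U: "U \<in> carrier_mat n n" "upper_triangular U" "similar_mat A U"
    using exists_similar_upper_triangular[OF assms] by blast
  then show ?thesis
    by (simp add: eigenvalues_similar[OF U(3)] eigenvalues_upper_triangular[OF U(1,2)])
qed

lemma eigenvalue_iff_in_eigenvalues:
  fixes A :: "'k::field mat"
  assumes "A \<in> carrier_mat n n"
  shows "a \<in># eigenvalues A \<longleftrightarrow> eigenvalue A a"
proof -
  have "char_poly A \<noteq> 0"
    using degree_monic_char_poly[OF assms] by auto
  then show ?thesis
    using eigenvalue_root_char_poly[OF assms] by simp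
qed

lemma eigenvalues_roots_of_unity:
  fixes A :: "'k::alg_closed_field mat"
  assumes "A \<in> carrier_mat n n" "A ^\<^sub>m m = 1\<^sub>m n" "a \<in># eigenvalues A"
  shows "a ^ m = 1"
proof -
  have "image_mset (\<lambda>a. a ^ m) (eigenvalues A) = replicate_mset n 1"
    using eigenvalues_pow[OF assms(1), of m] assms(2) by (simp add: eigenvalues_one)
  moreover have "a ^ m \<in># image_mset (\<lambda>a. a ^ m) (eigenvalues A)"
    using assms(3) by simp
  ultimately have "a ^ m \<in># replicate_mset n 1"
    by (simp only:)
  then show ?thesis
    unfolding in_replicate_mset by simp
qed

text \<open>
A number mapping a nonzero finitely generated group of numbers into itself is an algebraic integer,
since it is an eigenvalue of an integer matrix.
\<close>

lemma algebraic_int_module_criterion: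
  fixes v :: "'u \<Rightarrow> complex" and c :: "'u \<Rightarrow> 'u \<Rightarrow> int"
  assumes fin: "finite U" and u: "u \<in> U" "v u \<noteq> 0"
    and eq: "\<And>u. u \<in> U \<Longrightarrow> x * v u = (\<Sum>w\<in>U. of_int (c u w) * v w)"
  shows "algebraic_int x"
proof -
  define N where "N = card U"
  obtain h where h: "bij_betw h {..<N} U"
    using ex_bij_betw_nat_finite[OF fin] by (auto simp: N_def atLeast0LessThan)
  define C where "C = mat N N (\<lambda>(i, j). c (h i) (h j))"
  define w where "w = vec N (\<lambda>i. v (h i))"
  let ?C = "map_mat of_int C :: complex mat"
  have C: "C \<in> carrier_mat N N" "?C \<in> carrier_mat N N"
    by (auto simp: C_def)
  have "?C *\<^sub>v w = x \<cdot>\<^sub>v w"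
  proof (rule eq_vecI)
    fix i assume "i < dim_vec (x \<cdot>\<^sub>v w)"
    then have i: "i < N" "h i \<in> U"
      using h by (auto simp: w_def bij_betw_def)
    have "(?C *\<^sub>v w) $ i = (\<Sum>j<N. of_int (c (h i) (h j)) * v (h j))"
      using i by (simp add: C_def w_def scalar_prod_def atLeast0LessThan)
    also have "\<dots> = x * v (h i)"
      unfolding eq[OF i(2)] by (rule sum.reindex_bij_betw[OF h])
    finally show "(?C *\<^sub>v w) $ i = (x \<cdot>\<^sub>v w) $ i"
      using i by (simp add: w_def)
  qed (simp add: C_def w_def)
  moreover obtain k where "k < N" "h k = u"
    using h u(1) by (auto simp: bij_betw_def)
  then have "w \<noteq> 0\<^sub>v N"
    using u(2) by (metis index_vec index_zero_vec(1) w_def)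
  ultimately have "eigenvalue ?C x"
    unfolding eigenvalue_def eigenvector_def using C by (intro exI[of _ w]) (simp add: w_def)
  then have "poly (char_poly ?C) x = 0"
    using eigenvalue_root_char_poly[OF C(2)] by simp
  moreover have "char_poly ?C = map_poly of_int (char_poly C)"
    by (rule of_int_hom.char_poly_hom[OF C(1)])
  moreover have "lead_coeff (char_poly ?C) = 1"
    using degree_monic_char_poly[OF C(2)] by simp
  ultimately show ?thesis
    by (intro algebraic_int.intros[of "char_poly ?C"]) auto
qed

lemma sum_mset_eq_sum_count:
  fixes S :: "'a::comm_semiring_1 multiset"
  assumes "finite U" "set_mset S \<subseteq> U"
  shows "\<Sum>\<^sub># S = (\<Sum>z\<in>U. of_nat (count S z) * z)"
  using assms(2)
proof (induction S)
  case (add x S)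
  have "(\<Sum>z\<in>U. of_nat (count (add_mset x S) z) * z)
      = (\<Sum>z\<in>U. of_nat (count S z) * z + (if z = x then x else 0))"
    by (intro sum.cong refl) (simp add: algebra_simps)
  also have "\<dots> = (\<Sum>z\<in>U. of_nat (count S z) * z) + x"
    using add.prems assms(1) by (simp add: sum.distrib)
  finally show ?case
    using add by (simp add: add.commute)
qed simp

text \<open>
Such a sum maps the group generated by all \<open>m\<close>-th roots of unity into itself.
\<close>

lemma algebraic_int_sum_roots_of_unity:
  assumes m: "0 < m" and S: "\<And>z. z \<in># S \<Longrightarrow> z ^ m = (1::complex)"
  shows "algebraic_int (\<Sum>\<^sub># S)"
proof -
  let ?U = "{z::complex. z ^ m = 1}"
  have fin: "finite ?U"
    using m by (intro finite_roots_unity) simp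
  show ?thesis
  proof (rule algebraic_int_module_criterion[where U = ?U and u = 1 and v = "\<lambda>z. z"
        and c = "\<lambda>u w. int (count S (w / u))"])
    fix u assume u: "u \<in> ?U"
    then have u0: "u \<noteq> 0"
      using m by (auto simp: power_0_left)
    have "\<Sum>\<^sub># S * u = (\<Sum>z\<in>?U. of_nat (count S z) * z) * u"
      using sum_mset_eq_sum_count[OF fin] S by (simp add: subset_iff)
    also have "\<dots> = (\<Sum>z\<in>?U. of_nat (count S z) * (z * u))"
      by (simp add: sum_distrib_right mult.assoc)
    also have "\<dots> = (\<Sum>w\<in>?U. of_int (int (count S (w / u))) * w)"
      by (rule sum.reindex_bij_witness[of _ "\<lambda>w. w / u" "\<lambda>z. z * u"])
        (use u u0 in \<open>auto simp: power_mult_distrib power_divide\<close>)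
    finally show "\<Sum>\<^sub># S * u = (\<Sum>w\<in>?U. of_int (int (count S (w / u))) * w)" .
  qed (use fin in auto)
qed

section \<open>Reduction modulo 2 and the Brauer lift\<close>

lemma finite_roots_of_unity_bound:
  assumes "0 < m"
  shows "finite {x::'f::field. x ^ m = 1}" "card {x::'f::field. x ^ m = 1} \<le> m"
proof -
  define p where "p = Polynomial.monom (1::'f) m - 1"
  have "Polynomial.coeff p m = 1"
    using assms by (simp add: p_def)
  then have p0: "p \<noteq> 0"
    by auto
  have roots: "{x. x ^ m = 1} = {x. poly p x = 0}"
    by (auto simp: p_def poly_monom)
  have "degree p \<le> m"
    unfolding p_def by (intro degree_diff_le) (auto simp: degree_monom_le)
  then show "finite {x::'f. x ^ m = 1}" "card {x::'f. x ^ m = 1} \<le> m"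
    unfolding roots using poly_roots_finite[OF p0] card_poly_roots_bound[OF p0] by auto
qed

lemma inverse_root_of_unity:
  assumes "odd m" "(x::'f::field) ^ m = 1"
  shows "inverse x = x ^ (m - 1)"
proof (rule inverse_unique)
  show "x * x ^ (m - 1) = 1"
    using assms by (cases m) simp_all
qed

locale modular_reduction_2 =
  fixes red :: "complex \<Rightarrow> 'k::alg_closed_field"
  assumes char_2: "CHAR('k) = 2" and modular_reduction: "modular_reduction red"
begin

lemma red_1: "red 1 = 1"
  and red_add: "algebraic_int x \<Longrightarrow> algebraic_int y \<Longrightarrow> red (x + y) = red x + red y"
  and red_mult: "algebraic_int x \<Longrightarrow> algebraic_int y \<Longrightarrow> red (x * y) = red x * red y"
  using modular_reduction by (auto simp: modular_reduction_def)

lemma red_0: "red 0 = 0"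
proof -
  have "red 0 + red 0 = red 0 + 0"
    using red_add[of 0 0] by simp
  then show ?thesis
    by (rule add_left_imp_eq)
qed

lemma two_eq_0: "(2 :: 'k) = 0"
  using of_nat_CHAR[where ?'a = 'k] char_2 by simp

lemma add_self: "x + x = (0 :: 'k)"
  using two_eq_0 by (metis mult_2 mult_zero_left)

lemma prime_char: "prime CHAR('k)"
  by (simp add: char_2)

lemma of_nat_odd: "odd m \<Longrightarrow> (of_nat m :: 'k) \<noteq> 0"
  by (simp add: of_nat_eq_0_iff_char_dvd char_2)

lemma frobenius_sum_mset: "(\<Sum>\<^sub># M) ^ (2 ^ k) = \<Sum>\<^sub># (image_mset (\<lambda>x. x ^ (2 ^ k)) M)"
  for M :: "'k multiset"
  by (induction M) (simp_all add: freshmans_dream'[OF prime_char] char_2 power_0_left)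

lemma frobenius_inj:
  assumes "x ^ (2 ^ k) = (y :: 'k) ^ (2 ^ k)"
  shows "x = y"
proof -
  have "(x + y) ^ (2 ^ k) = x ^ (2 ^ k) + y ^ (2 ^ k)"
    by (rule freshmans_dream'[OF prime_char]) (simp add: char_2)
  then have "x + y = 0"
    using assms add_self by simp
  then show ?thesis
    using add_self[of y] by (metis add_right_cancel)
qed

lemma algebraic_int_root_of_unity: "0 < m \<Longrightarrow> z ^ m = 1 \<Longrightarrow> algebraic_int (z :: complex)"
  using algebraic_int_sum_roots_of_unity[of m "{#z#}"] by simp

lemma red_root_power:
  assumes "0 < m" "z ^ m = 1"
  shows "red (z ^ i) = red z ^ i"
proof (induction i)
  case (Suc i)
  have "(z ^ i) ^ m = 1"
    by (metis assms(2) power_commutes power_mult power_one mult.commute)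
  then show ?case
    using Suc red_mult[of z "z ^ i"] algebraic_int_root_of_unity assms by simp
qed (simp add: red_1)

lemma red_sum_mset:
  assumes m: "0 < m" and "\<And>z. z \<in># S \<Longrightarrow> z ^ m = 1"
  shows "red (\<Sum>\<^sub># S) = \<Sum>\<^sub># (image_mset red S)"
  using assms(2)
proof (induction S)
  case (add z S)
  then show ?case
    using red_add[of z "\<Sum>\<^sub># S"] algebraic_int_root_of_unity[OF m, of z]
      algebraic_int_sum_roots_of_unity[OF m, of S] by simp
qed (simp add: red_0)

text \<open>
A root of unity \<open>y \<noteq> 1\<close> has vanishing geometric sum, whereas \<open>red y = 1\<close> would make the reduction
of that sum equal to the odd number \<open>m\<close>.
\<close>

lemma red_eq_1_imp:
  assumes m: "odd m" and y: "y ^ m = 1" "red y = 1"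
  shows "y = 1"
proof (rule ccontr)
  assume "y \<noteq> 1"
  have m0: "0 < m"
    using m by (auto elim: oddE)
  have "(\<Sum>i<m. y ^ i) = 0"
    using \<open>y \<noteq> 1\<close> y(1) by (simp add: geometric_sum)
  then have "red (\<Sum>\<^sub># (image_mset (\<lambda>i. y ^ i) (mset_set {..<m}))) = 0"
    by (simp add: sum_unfold_sum_mset red_0)
  moreover have "z ^ m = 1" if "z \<in># image_mset (\<lambda>i. y ^ i) (mset_set {..<m})" for z
    using that y(1) by (auto simp: power_mult[symmetric] mult.commute[of _ m] power_mult)
  ultimately have "\<Sum>\<^sub># (image_mset red (image_mset (\<lambda>i. y ^ i) (mset_set {..<m}))) = 0"
    using red_sum_mset[OF m0] by metis
  then have "(\<Sum>i<m. red (y ^ i)) = 0"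
    by (simp add: sum_unfold_sum_mset image_mset.compositionality comp_def)
  then have "(of_nat m :: 'k) = 0"
    by (simp add: red_root_power[OF m0 y(1)] y(2))
  then show False
    using of_nat_odd m by simp
qed

lemma red_inj_on_roots:
  assumes m: "odd m" and "z ^ m = 1" "w ^ m = 1" "red z = red w"
  shows "z = w"
proof -
  have m0: "0 < m"
    using m by (auto elim: oddE)
  have wm: "w * w ^ (m - 1) = 1"
    using m0 assms(3) by (simp add: power_eq_if)
  have u: "(w ^ (m - 1)) ^ m = 1"
    using assms(3) by (metis mult.commute power_mult power_one)
  have "red (z * w ^ (m - 1)) = red w * red (w ^ (m - 1))"
    using red_mult algebraic_int_root_of_unity[OF m0] assms u by simp
  also have "\<dots> = red (w * w ^ (m - 1))"
    using red_mult algebraic_int_root_of_unity[OF m0] assms u by simp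
  finally have "red (z * w ^ (m - 1)) = 1"
    by (simp only: wm red_1)
  then have 1: "z * w ^ (m - 1) = 1"
    using red_eq_1_imp[OF m] assms u by (simp add: power_mult_distrib)
  have "z = z * (w * w ^ (m - 1))"
    by (simp only: wm mult_1_right)
  also have "\<dots> = w * (z * w ^ (m - 1))"
    by (simp only: mult.left_commute)
  finally show ?thesis
    by (simp only: 1 mult_1_right)
qed

text \<open>
By counting: \<open>red\<close> is injective on the \<open>m\<close> complex roots of unity, and the field \<open>'k\<close> has at most \<open>m\<close> of
them.
\<close>

lemma exists_root_lift:
  assumes m: "odd m" and a: "(a :: 'k) ^ m = 1"
  shows "\<exists>z. z ^ m = 1 \<and> red z = a"
proof -
  have m0: "0 < m"
    using m by (auto elim: oddE)
  let ?U = "{z::complex. z ^ m = 1}" and ?V = "{a::'k. a ^ m = 1}"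
  have cardV: "finite ?V" "card ?V \<le> m"
    using finite_roots_of_unity_bound[OF m0] by blast+
  have "red ` ?U \<subseteq> ?V"
    using red_root_power[OF m0] red_1 by (auto, metis)
  moreover have "card (red ` ?U) = m"
  proof -
    have "inj_on red ?U"
      using red_inj_on_roots[OF m] by (auto simp: inj_on_def)
    then show ?thesis
      using m0 by (simp add: card_image card_roots_unity_eq)
  qed
  ultimately have "red ` ?U = ?V"
    using cardV by (metis card_seteq)
  then have "a \<in> red ` ?U"
    using a by simp
  then show ?thesis
    by auto
qed

lemma brauer_lift_eqI:
  assumes "odd m" "z ^ m = 1" "red z = a"
  shows "brauer_lift red a = z"
  unfolding brauer_lift_def
proof (rule the_equality)
  show "(\<exists>m. coprime m CHAR('k) \<and> 0 < m \<and> z ^ m = 1) \<and> red z = a"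
    using assms by (auto simp: char_2 intro!: exI[of _ m] elim: oddE)
  fix w assume w: "(\<exists>m. coprime m CHAR('k) \<and> 0 < m \<and> w ^ m = 1) \<and> red w = a"
  then obtain m' where m': "odd m'" "w ^ m' = 1"
    by (auto simp: char_2)
  have "z ^ (m * m') = 1" "w ^ (m * m') = 1"
    using assms(2) m'(2) by (simp_all add: power_mult) (metis mult.commute power_mult power_one)
  then show "w = z"
    using red_inj_on_roots[of "m * m'" w z] assms m' w by simp
qed

lemma brauer_lift_props:
  assumes m: "odd m" and a: "(a :: 'k) ^ m = 1"
  shows "brauer_lift red a ^ m = 1" "red (brauer_lift red a) = a"
proof -
  obtain z where "z ^ m = 1" "red z = a"
    using exists_root_lift[OF assms] by blast
  moreover from this have "brauer_lift red a = z"
    by (rule brauer_lift_eqI[OF m])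
  ultimately show "brauer_lift red a ^ m = 1" "red (brauer_lift red a) = a"
    by simp_all
qed

lemma brauer_lift_power:
  assumes m: "odd m" and a: "(a :: 'k) ^ m = 1"
  shows "brauer_lift red (a ^ i) = brauer_lift red a ^ i"
proof (rule brauer_lift_eqI[OF m])
  show "(brauer_lift red a ^ i) ^ m = 1"
    using brauer_lift_props(1)[OF assms] by (metis mult.commute power_mult power_one)
  have "0 < m"
    using m by (auto elim: oddE)
  then show "red (brauer_lift red a ^ i) = a ^ i"
    using red_root_power brauer_lift_props[OF assms] by simp
qed

lemma brauer_lift_1: "brauer_lift red 1 = 1"
  by (rule brauer_lift_eqI[of 1]) (simp_all add: red_1)

lemma brauer_lift_nonzero:
  assumes "odd m" "(a :: 'k) ^ m = 1"
  shows "brauer_lift red a \<noteq> 0"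
  using brauer_lift_props(1)[OF assms] assms(1) by (auto simp: power_0_left elim: oddE)

lemma brauer_lift_inverse:
  assumes m: "odd m" and a: "(a :: 'k) ^ m = 1"
  shows "brauer_lift red (inverse a) = inverse (brauer_lift red a)"
    and "brauer_lift red (inverse a) = cnj (brauer_lift red a)"
proof -
  let ?z = "brauer_lift red a"
  have "inverse a = a ^ (m - 1)"
    using m a by (rule inverse_root_of_unity)
  then have "brauer_lift red (inverse a) = ?z ^ (m - 1)"
    by (simp add: brauer_lift_power[OF assms])
  moreover have "inverse ?z = ?z ^ (m - 1)"
    using m brauer_lift_props(1)[OF assms] by (rule inverse_root_of_unity)
  ultimately show 1: "brauer_lift red (inverse a) = inverse ?z"
    by simp
  have "cmod ?z ^ m = 1"
    using brauer_lift_props(1)[OF assms] by (simp add: norm_power[symmetric])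
  then have "cmod ?z = 1"
    using power_eq_imp_eq_base[of "cmod ?z" m 1] odd_pos[OF m] by simp
  then have "?z * cnj ?z = 1"
    by (simp add: complex_norm_square[symmetric])
  then show "brauer_lift red (inverse a) = cnj ?z"
    unfolding 1 by (rule inverse_unique)
qed

lemma brauer_lift_inj:
  assumes "odd m" "(a :: 'k) ^ m = 1" "b ^ m = 1" "brauer_lift red a = brauer_lift red b"
  shows "a = b"
  using assms brauer_lift_props(2) by metis

end

section \<open>Two-regular elements and Brauer characters\<close>

lemma exists_odd_part:
  assumes "0 < (n::nat)"
  shows "\<exists>k b. n = 2 ^ k * b \<and> odd b"
  using assms
proof (induction n rule: less_induct)
  case (less n)
  show ?case
  proof (cases "even n")
    case True
    then obtain n' where n': "n = 2 * n'"
      by (rule evenE)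
    then obtain k b where "n' = 2 ^ k * b" "odd b"
      using less.IH[of n'] less.prems by auto
    then show ?thesis
      using n' by (intro exI[of _ "Suc k"] exI[of _ b]) simp
  next
    case False
    then show ?thesis
      by (intro exI[of _ 0] exI[of _ n]) simp
  qed
qed

context finite_group
begin

lemma p_regular_2_iff: "g \<in> p_regular 2 G \<longleftrightarrow> g \<in> carrier G \<and> (\<exists>m::nat. odd m \<and> g [^] m = \<one>)"
proof -
  have "odd (ord g) \<longleftrightarrow> (\<exists>m::nat. odd m \<and> g [^] m = \<one>)" if g: "g \<in> carrier G"
  proof
    assume "odd (ord g)"
    then show "\<exists>m::nat. odd m \<and> g [^] m = \<one>"
      using pow_ord_eq_1[OF g] by (intro exI[of _ "ord g"] conjI)
  next
    assume "\<exists>m::nat. odd m \<and> g [^] m = \<one>"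
    then obtain m :: nat where "odd m" "g [^] m = \<one>"
      by (elim exE conjE)
    moreover from this have "ord g dvd m"
      using pow_eq_id[OF g, of m] by simp
    ultimately show "odd (ord g)"
      by (meson dvd_trans)
  qed
  then show ?thesis
    by (auto simp: p_regular_def)
qed

lemma p_regular_2_pow:
  assumes "g \<in> p_regular 2 G"
  shows "g [^] (i::nat) \<in> p_regular 2 G"
proof -
  obtain m :: nat where m: "g \<in> carrier G" "odd m" "g [^] m = \<one>"
    using assms by (auto simp: p_regular_2_iff)
  have "(g [^] i) [^] m = (g [^] m) [^] i"
    using m(1) by (simp add: nat_pow_pow mult.commute)
  then show ?thesis
    using m by (auto simp: p_regular_2_iff)
qed

lemma p_regular_2_inv:
  assumes "g \<in> p_regular 2 G"
  shows "inv g \<in> p_regular 2 G"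
proof -
  obtain m :: nat where m: "g \<in> carrier G" "odd m" "g [^] m = \<one>"
    using assms by (auto simp: p_regular_2_iff)
  then have "inv g [^] m = \<one>"
    by (simp add: nat_pow_inv)
  then show ?thesis
    using m by (auto simp: p_regular_2_iff)
qed

text \<open>
Raising to a power of 2, rather than projecting to the odd part of \<open>g\<close>, is compatible with traces in
characteristic 2 by Frobenius (\<open>trace_pow_2_power\<close> below).
\<close>

lemma exists_2_power_regular:
  assumes g: "g \<in> carrier G"
  shows "\<exists>k. g [^] ((2::nat) ^ k) \<in> p_regular 2 G"
proof -
  obtain k b where kb: "ord g = 2 ^ k * b" "odd b"
    using exists_odd_part[of "ord g"] ord_ge_1[OF finite_carrier g] by auto
  then have "(g [^] ((2::nat) ^ k)) [^] b = \<one>"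
    using g pow_ord_eq_1[OF g] by (simp add: nat_pow_pow)
  then show ?thesis
    using g kb(2) by (auto simp: p_regular_2_iff)
qed

lemma exists_odd_power_2_element:
  assumes g: "g \<in> carrier G"
  shows "\<exists>b k. odd b \<and> ord (g [^] (b::nat)) = 2 ^ k"
proof -
  obtain k b where kb: "ord g = 2 ^ k * b" "odd b"
    using exists_odd_part[of "ord g"] ord_ge_1[OF finite_carrier g] by auto
  have "(g [^] b) [^] ((2::nat) ^ k) = \<one>"
    using g pow_ord_eq_1[OF g] kb by (simp add: nat_pow_pow mult.commute)
  then have "ord (g [^] b) dvd 2 ^ k"
    using pow_eq_id[of "g [^] b"] g by simp
  then show ?thesis
    using kb(2) divides_primepow_nat[of 2] by auto
qed

lemma inverts_pow:
  assumes x: "x \<in> carrier G" and g: "g \<in> carrier G" and inv: "inverts G x g"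
  shows "inverts G x (g [^] (i::nat))"
proof -
  have "inv x \<otimes> g [^] i \<otimes> x = (inv x \<otimes> g \<otimes> x) [^] i"
  proof (induction i)
    case (Suc i)
    have "inv x \<otimes> g [^] Suc i \<otimes> x = (inv x \<otimes> g [^] i \<otimes> x) \<otimes> (inv x \<otimes> g \<otimes> x)"
    proof -
      have "x \<otimes> (inv x \<otimes> (g \<otimes> x)) = (x \<otimes> inv x) \<otimes> (g \<otimes> x)"
        using x g by (simp only: m_assoc inv_closed m_closed)
      then show ?thesis
        using x g by (simp add: m_assoc)
    qed
    then show ?case
      by (simp add: Suc.IH)
  qed (use x in simp)
  also have "\<dots> = inv (g [^] i)"
    using inv g by (simp add: inverts_def nat_pow_inv)
  finally show ?thesis
    by (simp add: inverts_def)
qed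

lemma inverts_iff:
  assumes "x \<in> carrier G" "g \<in> carrier G"
  shows "inverts G x g \<longleftrightarrow> g \<otimes> x = x \<otimes> inv g"
proof
  assume "inverts G x g"
  then have "x \<otimes> (inv x \<otimes> g \<otimes> x) = x \<otimes> inv g"
    by (simp add: inverts_def)
  moreover have "x \<otimes> (inv x \<otimes> g \<otimes> x) = (x \<otimes> inv x) \<otimes> g \<otimes> x"
    using assms by (simp only: m_assoc inv_closed m_closed)
  ultimately show "g \<otimes> x = x \<otimes> inv g"
    using assms by simp
next
  assume "g \<otimes> x = x \<otimes> inv g"
  then have "inv x \<otimes> (g \<otimes> x) = inv x \<otimes> (x \<otimes> inv g)"
    by simp
  then show "inverts G x g"
    using assms by (simp add: inverts_def m_assoc[symmetric])
qed

lemma inverts_swap: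
  assumes x: "x \<in> carrier G" and g: "g \<in> carrier G" and inv: "inverts G x g"
  shows "x \<otimes> g = inv g \<otimes> x"
proof -
  have 1: "g \<otimes> x = x \<otimes> inv g"
    using inv inverts_iff x g by simp
  have "x \<otimes> g = inv g \<otimes> (g \<otimes> x) \<otimes> g"
    using x g by (simp add: m_assoc[symmetric])
  also have "\<dots> = inv g \<otimes> x"
    unfolding 1 using x g by (simp add: m_assoc)
  finally show ?thesis .
qed

lemma inverts_odd_pow:
  assumes x: "x \<in> carrier G" and g: "g \<in> carrier G" and inv: "inverts G x g" and b: "odd b"
  shows "inverts G (x [^] (b::nat)) g"
proof -
  have 1: "g \<otimes> x = x \<otimes> inv g"
    using inv inverts_iff x g by simp
  have 2: "inv g \<otimes> x = x \<otimes> g"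
    using inverts_swap[OF x g inv] by simp
  have *: "g \<otimes> x [^] (2 * c) = x [^] (2 * c) \<otimes> g" for c :: nat
  proof (induction c)
    case (Suc c)
    have "g \<otimes> x [^] (2 * Suc c) = (g \<otimes> x [^] (2 * c)) \<otimes> x \<otimes> x"
      using x g by (simp add: m_assoc)
    also have "\<dots> = x [^] (2 * c) \<otimes> (g \<otimes> x) \<otimes> x"
      unfolding Suc.IH using x g by (simp add: m_assoc)
    also have "\<dots> = x [^] (2 * c) \<otimes> x \<otimes> (inv g \<otimes> x)"
      unfolding 1 using x g by (simp add: m_assoc)
    also have "\<dots> = x [^] (2 * Suc c) \<otimes> g"
      unfolding 2 using x g by (simp add: m_assoc)
    finally show ?case .
  qed (use g in simp)
  obtain c where c: "b = Suc (2 * c)"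
    using b by (auto elim: oddE)
  have "g \<otimes> x [^] b = (g \<otimes> x [^] (2 * c)) \<otimes> x"
    using x g by (simp add: c m_assoc)
  also have "\<dots> = x [^] (2 * c) \<otimes> (g \<otimes> x)"
    unfolding * using x g by (simp add: m_assoc)
  also have "\<dots> = x [^] b \<otimes> inv g"
    unfolding 1 using x g by (simp add: c m_assoc)
  finally show ?thesis
    using inverts_iff[of "x [^] b" g] x g by simp
qed

end

locale finite_matrix_rep = finite_group G + matrix_rep G n X
  for G :: "('g, 'b) monoid_scheme" (structure) and n and X :: "'g \<Rightarrow> 'k::alg_closed_field mat"
begin

lemma eigenvalues_rep_pow:
  "g \<in> carrier G \<Longrightarrow> eigenvalues (X (g [^] (i::nat))) = image_mset (\<lambda>a. a ^ i) (eigenvalues (X g))"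
  using eigenvalues_pow[of "X g" n i] by (simp add: X_pow)

lemma eigenvalues_rep_roots_of_unity:
  assumes "g \<in> carrier G" "g [^] (m::nat) = \<one>" "a \<in># eigenvalues (X g)"
  shows "a ^ m = 1"
  using eigenvalues_roots_of_unity[of "X g" n m a] assms by (simp add: X_pow[symmetric] X_one)

lemma trace_rep: "g \<in> carrier G \<Longrightarrow> mat_trace (X g) = \<Sum>\<^sub># (eigenvalues (X g))"
  by (rule trace_eq_sum_eigenvalues) auto

lemma eigenvalues_rep_inv:
  assumes g: "g \<in> carrier G"
  shows "eigenvalues (X (inv g)) = image_mset inverse (eigenvalues (X g))"
proof -
  obtain m where m: "ord g = Suc m"
    using ord_ge_1[OF finite_carrier g] by (cases "ord g") auto
  have gm: "g [^] Suc m = \<one>"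
    using pow_ord_eq_1[OF g] by (simp add: m)
  then have "inv g = g [^] m"
    using g by (intro inv_equality) auto
  then have "eigenvalues (X (inv g)) = image_mset (\<lambda>a. a ^ m) (eigenvalues (X g))"
    using eigenvalues_rep_pow[OF g] by simp
  also have "\<dots> = image_mset inverse (eigenvalues (X g))"
  proof (rule image_mset_cong)
    fix a assume "a \<in># eigenvalues (X g)"
    then have "a ^ Suc m = 1"
      using eigenvalues_rep_roots_of_unity[OF g gm] by simp
    then show "a ^ m = inverse a"
      by (intro inverse_unique[symmetric]) simp
  qed
  finally show ?thesis .
qed

end

locale brauer_rep = modular_reduction_2 red + finite_matrix_rep G n X
  for red :: "complex \<Rightarrow> 'k::alg_closed_field"
    and G :: "('g, 'b) monoid_scheme" (structure) and n and X :: "'g \<Rightarrow> 'k mat"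
begin

lemma brauer_character_eq:
  "g \<in> p_regular 2 G \<Longrightarrow>
    brauer_character red G X g = \<Sum>\<^sub># (image_mset (brauer_lift red) (eigenvalues (X g)))"
  by (simp add: brauer_character_def char_2)

lemma brauer_character_pow:
  assumes g: "g \<in> p_regular 2 G"
  shows "brauer_character red G X (g [^] (i::nat))
    = \<Sum>\<^sub># (image_mset (\<lambda>a. brauer_lift red a ^ i) (eigenvalues (X g)))"
proof -
  obtain m :: nat where gm: "g \<in> carrier G" "odd m" "g [^] m = \<one>"
    using g by (auto simp: p_regular_2_iff)
  have "brauer_lift red (a ^ i) = brauer_lift red a ^ i" if "a \<in># eigenvalues (X g)" for a
    using brauer_lift_power[OF gm(2)] eigenvalues_rep_roots_of_unity[OF gm(1,3) that] by simp
  then show ?thesis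
    unfolding brauer_character_eq[OF p_regular_2_pow[OF g]] eigenvalues_rep_pow[OF gm(1)]
      image_mset.compositionality comp_def
    by (intro arg_cong[of _ _ sum_mset] image_mset_cong)
qed

lemma brauer_character_inv:
  assumes g: "g \<in> p_regular 2 G"
  shows "brauer_character red G X (inv g) = cnj (brauer_character red G X g)"
proof -
  obtain m :: nat where gm: "g \<in> carrier G" "odd m" "g [^] m = \<one>"
    using g by (auto simp: p_regular_2_iff)
  have "brauer_character red G X (inv g)
      = \<Sum>\<^sub># (image_mset (\<lambda>a. brauer_lift red (inverse a)) (eigenvalues (X g)))"
    using gm(1) p_regular_2_inv[OF g] by (simp add: brauer_character_eq eigenvalues_rep_inv image_mset.compositionality comp_def)
  also have "\<dots> = \<Sum>\<^sub># (image_mset (\<lambda>a. cnj (brauer_lift red a)) (eigenvalues (X g)))"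
    using brauer_lift_inverse(2)[OF gm(2)] eigenvalues_rep_roots_of_unity[OF gm(1,3)]
    by (intro arg_cong[of _ _ sum_mset] image_mset_cong) simp
  also have "\<dots> = cnj (\<Sum>\<^sub># (image_mset (brauer_lift red) M))" if "M = eigenvalues (X g)" for M
    unfolding that[symmetric] by (induction M) simp_all
  finally show ?thesis
    using g by (simp add: brauer_character_eq)
qed

lemma red_brauer_character:
  assumes g: "g \<in> p_regular 2 G"
  shows "red (brauer_character red G X g) = mat_trace (X g)"
proof -
  obtain m :: nat where gm: "g \<in> carrier G" "odd m" "g [^] m = \<one>"
    using g by (auto simp: p_regular_2_iff)
  have unity: "a ^ m = 1" if "a \<in># eigenvalues (X g)" for a
    using eigenvalues_rep_roots_of_unity[OF gm(1,3) that] .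
  have "red (brauer_character red G X g)
      = \<Sum>\<^sub># (image_mset red (image_mset (brauer_lift red) (eigenvalues (X g))))"
    unfolding brauer_character_eq[OF g]
    using brauer_lift_props(1)[OF gm(2)] unity by (intro red_sum_mset[of m]) (auto simp: odd_pos[OF gm(2)])
  also have "\<dots> = \<Sum>\<^sub># (image_mset (\<lambda>a. a) (eigenvalues (X g)))"
    unfolding image_mset.compositionality comp_def
    using brauer_lift_props(2)[OF gm(2)] unity
    by (intro arg_cong[of _ _ sum_mset] image_mset_cong) simp
  finally show ?thesis
    using gm(1) by (simp add: trace_rep)
qed

lemma trace_pow_2_power:
  assumes "g \<in> carrier G"
  shows "mat_trace (X (g [^] ((2::nat) ^ k))) = mat_trace (X g) ^ (2 ^ k)"
  using assms by (simp add: trace_rep eigenvalues_rep_pow frobenius_sum_mset)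

text \<open>
Reducing \<open>\<phi> (h\<inverse>) = cnj (\<phi> h) = \<phi> h\<close> settles the 2-regular elements \<open>h\<close>; the general case follows from it by
injectivity of Frobenius.
\<close>

lemma trace_inv_of_real_brauer_character:
  assumes real: "brauer_character red G X ` p_regular 2 G \<subseteq> \<real>" and g: "g \<in> carrier G"
  shows "mat_trace (X (inv g)) = mat_trace (X g)"
proof -
  obtain k where k: "g [^] ((2::nat) ^ k) \<in> p_regular 2 G"
    using exists_2_power_regular[OF g] by blast
  let ?h = "g [^] ((2::nat) ^ k)"
  have inv: "inv ?h = inv g [^] ((2::nat) ^ k)"
    using g by (simp add: nat_pow_inv)
  have "brauer_character red G X ?h \<in> \<real>"
    using real k by blast
  then have "brauer_character red G X (inv ?h) = brauer_character red G X ?h"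
    using brauer_character_inv[OF k] by (simp add: Reals_cnj_iff)
  then have "mat_trace (X (inv ?h)) = mat_trace (X ?h)"
    using red_brauer_character[OF k] red_brauer_character[OF p_regular_2_inv[OF k]] by simp
  then have "mat_trace (X (inv g)) ^ (2 ^ k) = mat_trace (X g) ^ (2 ^ k)"
    unfolding inv using g trace_pow_2_power[of g k] trace_pow_2_power[of "inv g" k] by simp
  then show ?thesis
    by (rule frobenius_inj)
qed

theorem exists_real_2_regular_element_trace_nonzero:
  assumes irr: "irreducible_rep G n X" and real: "brauer_character red G X ` p_regular 2 G \<subseteq> \<real>"
  shows "\<exists>h. h \<in> p_regular 2 G \<and> real_element G h \<and> mat_trace (X h) \<noteq> 0"
proof -
  interpret finite_irreducible_rep G n X
    by unfold_locales (rule irr)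
  obtain g where g: "real_element G g" "mat_trace (X g) \<noteq> 0"
    using exists_real_element_trace_nonzero[OF char_2 trace_inv_of_real_brauer_character[OF real]] by blast
  then obtain x where x: "g \<in> carrier G" "x \<in> carrier G" "inverts G x g"
    by (auto simp: real_element_def)
  obtain k where k: "g [^] ((2::nat) ^ k) \<in> p_regular 2 G"
    using exists_2_power_regular[OF x(1)] by blast
  have "real_element G (g [^] ((2::nat) ^ k))"
    using x inverts_pow[OF x(2,1,3)] by (auto simp: real_element_def)
  moreover have "mat_trace (X (g [^] ((2::nat) ^ k))) \<noteq> 0"
    using g(2) trace_pow_2_power[OF x(1)] by simp
  ultimately show ?thesis
    using k by blast
qed

end

section \<open>The subgroup generated by an element of odd order and a 2-element inverting it\<close>

lemma (in finite_group) subgroup_of_mult_closed: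
  assumes H: "H \<subseteq> carrier G" "\<one> \<in> H" and mult: "\<And>x y. x \<in> H \<Longrightarrow> y \<in> H \<Longrightarrow> x \<otimes> y \<in> H"
  shows "subgroup H G"
proof (rule subgroupI)
  show "inv x \<in> H" if x: "x \<in> H" for x
  proof -
    have pow: "x [^] (i::nat) \<in> H" for i
      by (induction i) (use H x mult in auto)
    obtain d where d: "ord x = Suc d"
      using ord_ge_1[OF finite_carrier, of x] H x by (cases "ord x") auto
    have "x [^] d \<otimes> x = \<one>"
      using pow_ord_eq_1[of x] H x by (simp add: d subset_iff)
    then have "inv x = x [^] d"
      using H x by (intro inv_equality) auto
    then show ?thesis
      using pow by simp
  qed
qed (use H mult in auto)

text \<open>
Every element of the group generated by \<open>h\<close> and \<open>t\<close> is \<open>elem i j\<close> with natural number exponents; inversion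
of \<open>h\<close> is encoded as the power \<open>ord h - 1\<close>, which avoids integer exponents.
\<close>

locale inverting_pair = finite_group G for G :: "('g, 'b) monoid_scheme" (structure) +
  fixes h t :: 'g and k :: nat
  assumes h: "h \<in> carrier G" and t: "t \<in> carrier G" and inverts: "inverts G t h"
    and odd_ord_h: "odd (ord h)" and ord_t: "ord t = 2 ^ k"
begin

definition elem :: "nat \<Rightarrow> nat \<Rightarrow> 'g" where
  "elem i j = h [^] i \<otimes> t [^] j"

definition H :: "'g set" where
  "H = generate G {h} <#> generate G {t}"

lemma elem_closed [simp]: "elem i j \<in> carrier G"
  using h t by (simp add: elem_def)

lemma elem_0: "elem i 0 = h [^] i" "elem 0 j = t [^] j"
  using h t by (simp_all add: elem_def)

lemma generate_h: "generate G {h} = range (\<lambda>i::nat. h [^] i)"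
  and generate_t: "generate G {t} = range (\<lambda>j::nat. t [^] j)"
  using generate_pow_on_finite_carrier[OF finite_carrier] h t by auto

lemma H_eq: "H = {elem i j | i j. True}"
  by (auto simp: H_def generate_h generate_t set_mult_def elem_def)

lemma elem_in_H: "elem i j \<in> H"
  by (auto simp: H_eq)

lemma t_h_swap: "t [^] j \<otimes> h [^] i = h [^] ((ord h - 1) ^ j * i) \<otimes> t [^] j" for i j :: nat
proof -
  obtain d where d: "ord h = Suc d"
    using odd_ord_h by (cases "ord h") auto
  have "h [^] d \<otimes> h = \<one>"
    using pow_ord_eq_1[OF h] by (simp add: d)
  then have inv_h: "h [^] d = inv h"
    using h by (intro inv_equality[symmetric]) auto
  have 1: "t \<otimes> h = h [^] d \<otimes> t"
    unfolding inv_h by (rule inverts_swap[OF t h inverts])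
  have 2: "t \<otimes> h [^] i = h [^] (d * i) \<otimes> t" for i :: nat
  proof (induction i)
    case (Suc i)
    have "t \<otimes> h [^] Suc i = (t \<otimes> h [^] i) \<otimes> h"
      using h t by (simp add: m_assoc)
    also have "\<dots> = h [^] (d * i) \<otimes> (t \<otimes> h)"
      unfolding Suc.IH using h t by (simp add: m_assoc)
    also have "\<dots> = (h [^] (d * i) \<otimes> h [^] d) \<otimes> t"
      unfolding 1 using h t by (simp add: m_assoc)
    also have "\<dots> = h [^] (d * Suc i) \<otimes> t"
      using h by (simp add: nat_pow_mult add.commute)
    finally show ?case .
  qed (use t in simp)
  show ?thesis
  proof (induction j arbitrary: i)
    case (Suc j)
    have "t [^] Suc j \<otimes> h [^] i = t [^] j \<otimes> (t \<otimes> h [^] i)"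
      using h t by (simp add: m_assoc)
    also have "\<dots> = (t [^] j \<otimes> h [^] (d * i)) \<otimes> t"
      unfolding 2 using h t by (simp add: m_assoc)
    also have "\<dots> = h [^] ((ord h - 1) ^ j * (d * i)) \<otimes> t [^] Suc j"
      unfolding Suc.IH using h t by (simp add: m_assoc)
    finally show ?case
      by (simp add: d mult_ac)
  qed (use h in simp)
qed

lemma elem_mult: "elem i j \<otimes> elem i' j' = elem (i + (ord h - 1) ^ j * i') (j + j')"
proof -
  have "elem i j \<otimes> elem i' j' = h [^] i \<otimes> (t [^] j \<otimes> h [^] i') \<otimes> t [^] j'"
    using h t by (simp add: elem_def m_assoc)
  also have "\<dots> = (h [^] i \<otimes> h [^] ((ord h - 1) ^ j * i')) \<otimes> (t [^] j \<otimes> t [^] j')"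
    unfolding t_h_swap using h t by (simp add: m_assoc)
  also have "\<dots> = elem (i + (ord h - 1) ^ j * i') (j + j')"
    using h t by (simp add: elem_def nat_pow_mult)
  finally show ?thesis .
qed

lemma subgroup_H: "subgroup H G"
proof (rule subgroup_of_mult_closed)
  show "H \<subseteq> carrier G"
    by (auto simp: H_eq)
  show "\<one> \<in> H"
    using elem_in_H[of 0 0] by (simp add: elem_def)
  show "x \<otimes> y \<in> H" if "x \<in> H" "y \<in> H" for x y
    using that elem_mult elem_in_H by (auto simp: H_eq)
qed

lemma generate_inter: "generate G {h} \<inter> generate G {t} = {\<one>}"
proof -
  have "x = \<one>" if x: "x = h [^] i" "x = t [^] j" for x and i j :: nat
  proof -
    have "x [^] ord h = (h [^] ord h) [^] i" "x [^] ord t = (t [^] ord t) [^] j"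
      using h t x by (metis mult.commute nat_pow_pow)+
    then have "x [^] ord h = \<one>" "x [^] ord t = \<one>"
      using h t by simp_all
    moreover have "x \<in> carrier G"
      using x(1) h by simp
    ultimately have "ord x dvd ord h" "ord x dvd ord t"
      using pow_eq_id by simp_all
    moreover have "coprime (ord h) (ord t)"
      using odd_ord_h by (simp add: ord_t)
    ultimately have "ord x = 1"
      using coprime_common_divisor_nat by blast
    then show ?thesis
      using ord_eq_1 \<open>x \<in> carrier G\<close> by simp
  qed
  moreover have "\<one> = h [^] (0::nat)" "\<one> = t [^] (0::nat)"
    by simp_all
  ultimately show ?thesis
    unfolding generate_h generate_t by blast
qed

lemma elem_eq_iff: "elem i j = elem i' j' \<longleftrightarrow> h [^] i = h [^] i' \<and> t [^] j = t [^] j'"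
proof
  assume eq: "elem i j = elem i' j'"
  have sub: "subgroup (generate G {h}) G" "subgroup (generate G {t}) G"
    using h t by (intro generate_is_subgroup; simp)+
  have mem: "h [^] i \<in> generate G {h}" "h [^] i' \<in> generate G {h}"
      "t [^] j \<in> generate G {t}" "t [^] j' \<in> generate G {t}"
    unfolding generate_h generate_t by blast+
  note inv_gen = subgroup.m_inv_closed[OF sub(1) mem(2)] subgroup.m_inv_closed[OF sub(2) mem(3)]
  have "inv (h [^] i') \<otimes> h [^] i = inv (h [^] i') \<otimes> elem i j \<otimes> inv (t [^] j)"
    using h t by (simp add: elem_def m_assoc)
  also have "\<dots> = (inv (h [^] i') \<otimes> h [^] i') \<otimes> (t [^] j' \<otimes> inv (t [^] j))"
    unfolding eq unfolding elem_def using h t by (simp only: m_assoc inv_closed m_closed nat_pow_closed)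
  finally have *: "inv (h [^] i') \<otimes> h [^] i = t [^] j' \<otimes> inv (t [^] j)"
    using h t by simp
  have "inv (h [^] i') \<otimes> h [^] i \<in> generate G {h}"
    by (rule subgroup.m_closed[OF sub(1) inv_gen(1) mem(1)])
  moreover have "t [^] j' \<otimes> inv (t [^] j) \<in> generate G {t}"
    by (rule subgroup.m_closed[OF sub(2) mem(4) inv_gen(2)])
  ultimately have "inv (h [^] i') \<otimes> h [^] i = \<one>" "t [^] j' \<otimes> inv (t [^] j) = \<one>"
    using generate_inter * by auto
  then show "h [^] i = h [^] i' \<and> t [^] j = t [^] j'"
    using h t by (metis inv_closed inv_equality inv_inv nat_pow_closed)
qed (simp add: elem_def)

abbreviation GH :: "('g, 'b) monoid_scheme" where
  "GH \<equiv> G\<lparr>carrier := H\<rparr>"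

sublocale GH: finite_group GH
proof -
  have "group GH"
    by (rule subgroup.subgroup_is_group[OF subgroup_H is_group])
  moreover have "finite H"
    using finite_subset[OF subgroup.subset[OF subgroup_H] finite_carrier] .
  ultimately show "finite_group GH"
    by (simp add: finite_group_def finite_group_axioms_def)
qed

lemma GH_pow: "x [^]\<^bsub>GH\<^esub> (i::nat) = x [^] i"
  by (simp add: nat_pow_def)

lemma h_in_H: "h \<in> H" and t_in_H: "t \<in> H"
  using elem_in_H[of 1 0] elem_in_H[of 0 1] h t by (simp_all add: elem_def)

lemma internal_semidirect_product: "internal_semidirect_product G H (generate G {h}) (generate G {t})"
proof -
  have sub: "subgroup (generate G {x}) GH" if "x \<in> H" "x \<in> carrier G" for x
  proof (rule subgroup_incl[OF generate_is_subgroup subgroup_H])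
    show "generate G {x} \<subseteq> H"
      using that by (intro generate_subgroup_incl[OF _ subgroup_H]) auto
  qed (use that in auto)
  have "generate G {h} \<lhd> GH"
  proof (rule GH.normal_invI[OF sub[OF h_in_H h]])
    fix x y assume x: "x \<in> carrier GH" and y: "y \<in> generate G {h}"
    then obtain i j i' where ij: "x = elem i j" "y = h [^] (i'::nat)"
      by (auto simp: H_eq generate_h)
    have "x \<otimes> y = elem (i + (ord h - 1) ^ j * i') j"
      using elem_mult[of i j i' 0] by (simp add: ij elem_0)
    also have "\<dots> = (h [^] ((ord h - 1) ^ j * i') \<otimes> h [^] i) \<otimes> t [^] j"
      using h by (simp add: elem_def nat_pow_mult add.commute)
    also have "\<dots> = h [^] ((ord h - 1) ^ j * i') \<otimes> x"
      using h t by (simp add: ij elem_def m_assoc)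
    finally have "x \<otimes> y \<otimes> inv x = h [^] ((ord h - 1) ^ j * i')"
      using h by (simp add: ij m_assoc)
    moreover have "inv\<^bsub>GH\<^esub> x = inv x"
      using x m_inv_consistent[OF subgroup_H] by simp
    ultimately show "x \<otimes>\<^bsub>GH\<^esub> y \<otimes>\<^bsub>GH\<^esub> inv\<^bsub>GH\<^esub> x \<in> generate G {h}"
      by (simp add: generate_h)
  qed
  then show ?thesis
    unfolding internal_semidirect_product_def
    using subgroup_H sub[OF t_in_H t] generate_inter H_def by simp
qed

text \<open>
Modulo \<open>\<langle>h\<rangle>\<close> the group is the 2-group \<open>\<langle>t\<rangle>\<close>, which has no nontrivial element of odd order.
\<close>

lemma p_regular_GH: "p_regular 2 GH = generate G {h}"
proof
  show "generate G {h} \<subseteq> p_regular 2 GH"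
  proof
    fix x assume "x \<in> generate G {h}"
    then obtain i :: nat where x: "x = h [^] i"
      by (auto simp: generate_h)
    have "x [^] ord h = (h [^] ord h) [^] i"
      using h unfolding x by (metis mult.commute nat_pow_pow)
    then have "x [^]\<^bsub>GH\<^esub> ord h = \<one>\<^bsub>GH\<^esub>"
      using h by (simp add: GH_pow)
    moreover have "x \<in> H"
      using elem_in_H[of i 0] by (simp add: x elem_0)
    ultimately show "x \<in> p_regular 2 GH"
      using odd_ord_h by (auto simp: GH.p_regular_2_iff)
  qed
  show "p_regular 2 GH \<subseteq> generate G {h}"
  proof
    fix x assume "x \<in> p_regular 2 GH"
    then obtain r :: nat where xr: "x \<in> H" "odd r" "x [^] r = \<one>"
      by (auto simp: GH.p_regular_2_iff GH_pow)
    then obtain i j where ij: "x = elem i j"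
      by (auto simp: H_eq)
    have "\<exists>i'. x [^] r = elem i' (r * j)" for r :: nat
    proof (induction r)
      case (Suc r)
      then obtain i' where "x [^] r = elem i' (r * j)"
        by blast
      then show ?case
        using elem_mult by (auto simp: ij add.commute)
    qed (auto simp: elem_def intro: exI[of _ 0])
    then obtain i' where "x [^] r = elem i' (r * j)"
      by blast
    then have "elem i' (r * j) = elem 0 0"
      using xr(3) by (simp add: elem_0)
    then have "t [^] (r * j) = \<one>"
      by (simp add: elem_eq_iff)
    then have "2 ^ k dvd r * j"
      using pow_eq_id[OF t] by (simp add: ord_t)
    then have "2 ^ k dvd j"
      using xr(2) by (simp add: coprime_dvd_mult_right_iff)
    then have "t [^] j = \<one>"
      using pow_eq_id[OF t] by (simp add: ord_t)
    then show "x \<in> generate G {h}"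
      using h by (auto simp: ij elem_def generate_h)
  qed
qed

lemma h_pow_eq_imp:
  assumes "h [^] (i::nat) = h [^] (i'::nat)" and a: "(a :: 'f::field) ^ ord h = 1"
  shows "a ^ i = a ^ i'"
proof -
  have *: "a ^ i = a ^ i'" if "i \<le> i'" "h [^] i = h [^] i'" for i i' :: nat
  proof -
    have "h [^] (i' - i) = \<one>"
      using that h by (simp add: pow_eq_div2)
    then obtain r where "i' - i = ord h * r"
      using pow_eq_id[OF h] by auto
    then have "i' = i + ord h * r"
      using that(1) by simp
    then show ?thesis
      by (simp add: power_add power_mult a)
  qed
  show ?thesis
  proof (cases "i \<le> i'")
    case True
    then show ?thesis
      using assms(1) by (rule *)
  next
    case False
    then have "a ^ i' = a ^ i"
      by (intro *) (simp_all add: assms(1))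
    then show ?thesis
      by simp
  qed
qed

end

section \<open>Irreducible representations of that subgroup in characteristic 2\<close>

lemma span_one_vector_dim:
  fixes v :: "'k::field vec"
  assumes v: "v \<in> carrier_vec n" and span: "\<And>w. w \<in> carrier_vec n \<Longrightarrow> \<exists>\<alpha>. w = \<alpha> \<cdot>\<^sub>v v"
  shows "n \<le> 1"
proof (rule ccontr)
  assume "\<not> n \<le> 1"
  then have n: "0 < n" "1 < n"
    by auto
  obtain \<alpha> where \<alpha>: "unit_vec n 0 = \<alpha> \<cdot>\<^sub>v v"
    using span[of "unit_vec n 0"] by auto
  obtain \<beta> where \<beta>: "unit_vec n 1 = \<beta> \<cdot>\<^sub>v v"
    using span[of "unit_vec n 1"] by auto
  have "\<alpha> * v $ 0 = 1" "\<alpha> * v $ 1 = 0" "\<beta> * v $ 1 = 1"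
    using arg_cong[OF \<alpha>, of "\<lambda>w. w $ 0"] arg_cong[OF \<alpha>, of "\<lambda>w. w $ 1"]
      arg_cong[OF \<beta>, of "\<lambda>w. w $ 1"] n v by simp_all
  then show False
    by auto
qed

lemma span_two_vectors_dim:
  fixes v u :: "'k::field vec"
  assumes v: "v \<in> carrier_vec n" "u \<in> carrier_vec n"
    and span: "\<And>w. w \<in> carrier_vec n \<Longrightarrow> \<exists>\<alpha> \<beta>. w = \<alpha> \<cdot>\<^sub>v v + \<beta> \<cdot>\<^sub>v u"
  shows "n \<le> 2"
proof (rule ccontr)
  assume "\<not> n \<le> 2"
  then have n: "0 < n" "1 < n" "2 < n"
    by auto
  have "\<exists>\<alpha> \<beta>. \<forall>j<n. unit_vec n i $ j = \<alpha> * v $ j + \<beta> * u $ j" for i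
  proof -
    obtain \<alpha> \<beta> where "unit_vec n i = \<alpha> \<cdot>\<^sub>v v + \<beta> \<cdot>\<^sub>v u"
      using span[of "unit_vec n i"] by auto
    then show ?thesis
      using v by (intro exI[of _ \<alpha>] exI[of _ \<beta>]) simp
  qed
  then obtain \<alpha> \<beta> where ab: "\<And>i j. j < n \<Longrightarrow> unit_vec n i $ j = \<alpha> i * v $ j + \<beta> i * u $ j"
    by metis
  define d where "d i j = \<alpha> i * v $ j + \<beta> i * u $ j" for i j :: nat
  have "d i j = (if i = j then 1 else 0)" if "i < 3" "j < 3" for i j
  proof -
    have "d i j = unit_vec n i $ j"
      unfolding d_def by (rule ab[symmetric]) (use that n in simp)
    also have "\<dots> = (if i = j then 1 else 0)"
      using that n by simp
    finally show ?thesis .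
  qed
  \<comment> \<open>The determinant of a 3 by 3 matrix of rank at most 2 would be 1.\<close>
  then have "d 0 0 * (d 1 1 * d 2 2 - d 1 2 * d 2 1) - d 0 1 * (d 1 0 * d 2 2 - d 1 2 * d 2 0)
      + d 0 2 * (d 1 0 * d 2 1 - d 1 1 * d 2 0) = 1"
    by simp
  moreover have "d 0 0 * (d 1 1 * d 2 2 - d 1 2 * d 2 1) - d 0 1 * (d 1 0 * d 2 2 - d 1 2 * d 2 0)
      + d 0 2 * (d 1 0 * d 2 1 - d 1 1 * d 2 0) = 0"
    unfolding d_def by (simp add: algebra_simps)
  ultimately show False
    by simp
qed

text \<open>
The eigenvalues of \<open>h\<close> in the irreducible representation belonging to \<open>a\<close>: the inverse of \<open>a\<close> is listed
only if it differs from \<open>a\<close>.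
\<close>

definition inverse_pair :: "'k::field \<Rightarrow> 'k multiset" where
  "inverse_pair a = (if a = 1 then {#1#} else {#a, inverse a#})"

locale dihedral_rep = modular_reduction_2 red + inverting_pair G h t k
  for red :: "complex \<Rightarrow> 'k::alg_closed_field" and G :: "('g, 'b) monoid_scheme" (structure)
    and h t :: 'g and k :: nat
begin

lemma self_inverse_imp_1:
  assumes "(a :: 'k) = inverse a" "a \<noteq> 0"
  shows "a = 1"
proof (rule frobenius_inj[of _ 1])
  have "a * a = 1"
    using assms by (metis right_inverse)
  then show "a ^ 2 ^ 1 = 1 ^ 2 ^ 1"
    by (simp add: power2_eq_square)
qed

text \<open>
The central element \<open>t\<^sup>2\<close> acts as 1, so an eigenvector \<open>v\<close> of \<open>h\<close> with eigenvalue \<open>a\<close> and its image \<open>t v\<close>, an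
eigenvector with eigenvalue \<open>a\<inverse>\<close>, span an invariant subspace, that is, everything.  If \<open>a \<noteq> 1\<close> the two
eigenvalues differ and the dimension is 2.  If \<open>a = 1\<close> then \<open>h\<close> acts trivially, and \<open>v + t v\<close> (or \<open>v\<close>, if
this sum is 0) is fixed by \<open>t\<close> and spans everything.
\<close>

lemma irreducible_rep_GH_eigenvalues:
  assumes irr: "irreducible_rep GH n (Y :: 'g \<Rightarrow> 'k mat)"
  shows "\<exists>a. a ^ ord h = 1 \<and> eigenvalues (Y h) = inverse_pair a"
proof -
  have "Y \<in> hom GH (GL TYPE('k) n)" and n: "0 < n"
    using irr by (auto simp: irreducible_rep_def)
  then interpret Y: finite_matrix_rep GH n Y
    by (intro finite_matrix_rep.intro GH.finite_group_axioms matrix_repI GH.is_group)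
  have Yc: "Y x \<in> carrier_mat n n" if "x \<in> H" for x
    using Y.X_carrier that by simp
  have Yvc [simp]: "Y x *\<^sub>v w \<in> carrier_vec n" if "x \<in> H" "w \<in> carrier_vec n" for x w
    using Yc that by (intro mult_mat_vec_carrier)
  have Ym: "Y (x \<otimes> y) *\<^sub>v w = Y x *\<^sub>v (Y y *\<^sub>v w)" if "x \<in> H" "y \<in> H" "w \<in> carrier_vec n" for x y w
    using Y.X_mult[of x y] that assoc_mult_mat_vec[OF Yc Yc] by simp
  have Yadd: "Y x *\<^sub>v (v + w) = Y x *\<^sub>v v + Y x *\<^sub>v w"
    if "x \<in> H" "v \<in> carrier_vec n" "w \<in> carrier_vec n" for x v w
    using Yc that by (intro mult_add_distrib_mat_vec)
  have Ysm: "Y x *\<^sub>v (c \<cdot>\<^sub>v w) = c \<cdot>\<^sub>v (Y x *\<^sub>v w)" if "x \<in> H" "w \<in> carrier_vec n" for x c w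
    using Yc that by (intro mult_mat_vec)
  have Y1: "Y \<one> *\<^sub>v w = w" if "w \<in> carrier_vec n" for w
    using Y.X_one that by simp
  note HH = h_in_H t_in_H subgroup.m_closed[OF subgroup_H]
  have elem_split: "\<exists>i j. x = h [^] (i::nat) \<otimes> t [^] (j::nat)" if "x \<in> H" for x
    using that by (auto simp: H_eq elem_def)
  have hpow: "h [^] (i::nat) \<in> H" and tpow: "t [^] (j::nat) \<in> H" for i j
    using elem_in_H[of i 0] elem_in_H[of 0 j] by (simp_all add: elem_0)
  \<comment> \<open>A subspace is invariant as soon as it is invariant under the two generators.\<close>
  have invariant: "W = {0\<^sub>v n} \<or> W = carrier_vec n"
    if sub: "VectorSpace.subspace class_ring W (module_vec TYPE('k) n)" and W: "W \<subseteq> carrier_vec n"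
      and Wh: "\<And>w. w \<in> W \<Longrightarrow> Y h *\<^sub>v w \<in> W" and Wt: "\<And>w. w \<in> W \<Longrightarrow> Y t *\<^sub>v w \<in> W" for W
  proof -
    have 1: "Y (h [^] (i::nat)) *\<^sub>v w \<in> W" if "w \<in> W" for i w
      using that
    proof (induction i arbitrary: w)
      case (Suc i)
      have "Y (h [^] Suc i) *\<^sub>v w = Y (h [^] i) *\<^sub>v (Y h *\<^sub>v w)"
        using Ym[OF hpow h_in_H] Suc.prems W by auto
      then show ?case
        using Suc Wh by simp
    qed (use Y1 W in auto)
    have 2: "Y (t [^] (i::nat)) *\<^sub>v w \<in> W" if "w \<in> W" for i w
      using that
    proof (induction i arbitrary: w)
      case (Suc i)
      have "Y (t [^] Suc i) *\<^sub>v w = Y (t [^] i) *\<^sub>v (Y t *\<^sub>v w)"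
        using Ym[OF tpow t_in_H] Suc.prems W by auto
      then show ?case
        using Suc Wt by simp
    qed (use Y1 W in auto)
    have "Y x *\<^sub>v w \<in> W" if x: "x \<in> carrier GH" and w: "w \<in> W" for x w
    proof -
      obtain i j where "x = h [^] (i::nat) \<otimes> t [^] (j::nat)"
        using elem_split[of x] x by auto
      then have "Y x *\<^sub>v w = Y (h [^] i) *\<^sub>v (Y (t [^] j) *\<^sub>v w)"
        using Ym[OF hpow tpow] w W by auto
      then show ?thesis
        using 1 2 w by simp
    qed
    then show ?thesis
      using irr sub unfolding irreducible_rep_def by blast
  qed
  define z where "z = t \<otimes> t"
  have zH: "z \<in> H"
    using HH by (simp add: z_def)
  have ht: "h \<otimes> t = t \<otimes> inv h"
    using inverts inverts_iff t h by simp
  have inv_hH: "inv h \<in> H"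
    by (rule subgroup.m_inv_closed[OF subgroup_H h_in_H])
  have th: "t \<otimes> h = inv h \<otimes> t"
    by (rule inverts_swap[OF t h inverts])
  have zh: "h \<otimes> z = z \<otimes> h"
  proof -
    have "h \<otimes> z = (h \<otimes> t) \<otimes> t"
      using h t by (simp add: z_def m_assoc)
    also have "\<dots> = t \<otimes> (inv h \<otimes> t)"
      unfolding ht using h t by (simp add: m_assoc)
    also have "\<dots> = z \<otimes> h"
      unfolding th[symmetric] using h t by (simp add: z_def m_assoc)
    finally show ?thesis .
  qed
  have zt: "t \<otimes> z = z \<otimes> t"
    using t by (simp add: z_def m_assoc)
  \<comment> \<open>The central 2-element \<open>t\<^sup>2\<close> acts unipotently, hence trivially by irreducibility.\<close>
  have z_trivial: "Y z *\<^sub>v w = w" if "w \<in> carrier_vec n" for w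
  proof -
    obtain c v where v: "v \<in> carrier_vec n" "v \<noteq> 0\<^sub>v n" "Y z *\<^sub>v v = c \<cdot>\<^sub>v v"
      using exists_eigenvector[OF Yc[OF zH] n] by blast
    have "eigenvalue (Y z) c"
      unfolding eigenvalue_def eigenvector_def using v Yc[OF zH] by auto
    then have "c \<in># eigenvalues (Y z)"
      using eigenvalue_iff_in_eigenvalues[OF Yc[OF zH]] by simp
    moreover have "z [^] ((2::nat) ^ k) = \<one>"
    proof -
      have "z = t [^] (2::nat)"
        using t by (simp add: z_def numeral_2_eq_2)
      then have "z [^] ((2::nat) ^ k) = (t [^] ord t) [^] (2::nat)"
        using t by (simp add: nat_pow_pow ord_t mult.commute)
      then show ?thesis
        using t by simp
    qed
    then have "z [^]\<^bsub>GH\<^esub> ((2::nat) ^ k) = \<one>\<^bsub>GH\<^esub>"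
      by (simp add: GH_pow)
    ultimately have "c ^ 2 ^ k = 1"
      using Y.eigenvalues_rep_roots_of_unity[of z "2 ^ k" c] zH by simp
    then have "c = 1"
      using frobenius_inj[of c k 1] by simp
    then have zv: "Y z *\<^sub>v v = v"
      using v by simp
    define W where "W = {w \<in> carrier_vec n. Y z *\<^sub>v w = w}"
    have "W = {0\<^sub>v n} \<or> W = carrier_vec n"
    proof (rule invariant)
      have z0: "Y z *\<^sub>v 0\<^sub>v n = 0\<^sub>v n"
        using Yc[OF zH] by auto
      show "VectorSpace.subspace class_ring W (module_vec TYPE('k) n)"
        by (rule subspace_vecI) (use zH z0 in \<open>auto simp: W_def Yadd Ysm\<close>)
      show "W \<subseteq> carrier_vec n"
        by (auto simp: W_def)
      show "Y h *\<^sub>v w \<in> W" if "w \<in> W" for w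
      proof -
        have w: "w \<in> carrier_vec n" "Y z *\<^sub>v w = w"
          using that by (auto simp: W_def)
        have "Y z *\<^sub>v (Y h *\<^sub>v w) = Y h *\<^sub>v (Y z *\<^sub>v w)"
          using Ym[OF zH h_in_H w(1)] Ym[OF h_in_H zH w(1)] zh by simp
        then show ?thesis
          using w h_in_H by (simp add: W_def)
      qed
      show "Y t *\<^sub>v w \<in> W" if "w \<in> W" for w
      proof -
        have w: "w \<in> carrier_vec n" "Y z *\<^sub>v w = w"
          using that by (auto simp: W_def)
        have "Y z *\<^sub>v (Y t *\<^sub>v w) = Y t *\<^sub>v (Y z *\<^sub>v w)"
          using Ym[OF zH t_in_H w(1)] Ym[OF t_in_H zH w(1)] zt by simp
        then show ?thesis
          using w t_in_H by (simp add: W_def)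
      qed
    qed
    moreover have "v \<in> W"
      using v zv by (simp add: W_def)
    ultimately have "W = carrier_vec n"
      using v(2) by auto
    then show ?thesis
      using that by (auto simp: W_def)
  qed
  obtain a v where v: "v \<in> carrier_vec n" "v \<noteq> 0\<^sub>v n" "Y h *\<^sub>v v = a \<cdot>\<^sub>v v"
    using exists_eigenvector[OF Yc[OF h_in_H] n] by blast
  define u where "u = Y t *\<^sub>v v"
  have u: "u \<in> carrier_vec n"
    using v t_in_H by (simp add: u_def)
  have tu: "Y t *\<^sub>v u = v"
    using Ym[OF t_in_H t_in_H v(1)] z_trivial[OF v(1)] by (simp add: u_def z_def)
  have u0: "u \<noteq> 0\<^sub>v n"
  proof
    assume "u = 0\<^sub>v n"
    then have "Y t *\<^sub>v u = 0\<^sub>v n"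
      using Yc[OF t_in_H] by auto
    then show False
      using tu v by simp
  qed
  have ev_a: "a \<in># eigenvalues (Y h)"
    unfolding eigenvalue_iff_in_eigenvalues[OF Yc[OF h_in_H]] eigenvalue_def eigenvector_def
    using v Yc[OF h_in_H] by auto
  have "h [^]\<^bsub>GH\<^esub> ord h = \<one>\<^bsub>GH\<^esub>"
    using h by (simp add: GH_pow)
  then have a1: "a ^ ord h = 1"
    using Y.eigenvalues_rep_roots_of_unity[of h "ord h" a] ev_a h_in_H by simp
  have a0: "a \<noteq> 0"
    using a1 odd_pos[OF odd_ord_h] by (auto simp: power_0_left)
  have inv_v: "Y (inv h) *\<^sub>v v = inverse a \<cdot>\<^sub>v v"
  proof -
    have "v = Y (inv h) *\<^sub>v (Y h *\<^sub>v v)"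
      using Ym[OF inv_hH h_in_H v(1)] Y1 v(1) h by simp
    also have "\<dots> = a \<cdot>\<^sub>v (Y (inv h) *\<^sub>v v)"
      using v Ysm inv_hH by simp
    finally have "inverse a \<cdot>\<^sub>v v = inverse a \<cdot>\<^sub>v (a \<cdot>\<^sub>v (Y (inv h) *\<^sub>v v))"
      by simp
    also have "\<dots> = Y (inv h) *\<^sub>v v"
      using a0 by (simp add: smult_smult_assoc)
    finally show ?thesis
      by simp
  qed
  have hu: "Y h *\<^sub>v u = inverse a \<cdot>\<^sub>v u"
  proof -
    have "Y h *\<^sub>v u = Y t *\<^sub>v (Y (inv h) *\<^sub>v v)"
      using Ym[OF h_in_H t_in_H v(1)] Ym[OF t_in_H inv_hH v(1)] ht by (simp add: u_def)
    then show ?thesis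
      using inv_v v(1) Ysm t_in_H by (simp add: u_def)
  qed
  have ev_inv: "inverse a \<in># eigenvalues (Y h)"
    unfolding eigenvalue_iff_in_eigenvalues[OF Yc[OF h_in_H]] eigenvalue_def eigenvector_def
    using u u0 hu Yc[OF h_in_H] by auto
  define W where "W = {\<alpha> \<cdot>\<^sub>v v + \<beta> \<cdot>\<^sub>v u | \<alpha> \<beta>. True}"
  have W_mem: "\<alpha> \<cdot>\<^sub>v v + \<beta> \<cdot>\<^sub>v u \<in> W" for \<alpha> \<beta>
    unfolding W_def by blast
  have comb: "\<alpha> \<cdot>\<^sub>v v + \<beta> \<cdot>\<^sub>v u \<in> carrier_vec n" for \<alpha> \<beta>
    using u v by simp
  have "W = {0\<^sub>v n} \<or> W = carrier_vec n"
  proof (rule invariant)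
    show WC: "W \<subseteq> carrier_vec n"
      using u v by (auto simp: W_def)
    show "VectorSpace.subspace class_ring W (module_vec TYPE('k) n)"
    proof (rule subspace_vecI[OF WC])
      have "0\<^sub>v n = 0 \<cdot>\<^sub>v v + 0 \<cdot>\<^sub>v u"
        using u v by auto
      then show "0\<^sub>v n \<in> W"
        using W_mem by metis
      fix x assume "x \<in> W"
      then obtain \<alpha> \<beta> where x: "x = \<alpha> \<cdot>\<^sub>v v + \<beta> \<cdot>\<^sub>v u"
        by (auto simp: W_def)
      have "c \<cdot>\<^sub>v x = (c * \<alpha>) \<cdot>\<^sub>v v + (c * \<beta>) \<cdot>\<^sub>v u" for c
        unfolding x using u v by (intro eq_vecI) (auto simp: algebra_simps)
      then show "c \<cdot>\<^sub>v x \<in> W" for c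
        using W_mem by metis
      fix y assume "y \<in> W"
      then obtain \<alpha>' \<beta>' where y: "y = \<alpha>' \<cdot>\<^sub>v v + \<beta>' \<cdot>\<^sub>v u"
        by (auto simp: W_def)
      have "x + y = (\<alpha> + \<alpha>') \<cdot>\<^sub>v v + (\<beta> + \<beta>') \<cdot>\<^sub>v u"
        unfolding x y using u v by (intro eq_vecI) (auto simp: algebra_simps)
      then show "x + y \<in> W"
        using W_mem by metis
    qed
    fix w assume "w \<in> W"
    then obtain \<alpha> \<beta> where w: "w = \<alpha> \<cdot>\<^sub>v v + \<beta> \<cdot>\<^sub>v u"
      by (auto simp: W_def)
    have "Y h *\<^sub>v w = (\<alpha> * a) \<cdot>\<^sub>v v + (\<beta> * inverse a) \<cdot>\<^sub>v u"
      unfolding w using u v hu h_in_H by (simp add: Yadd Ysm smult_smult_assoc)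
    then show "Y h *\<^sub>v w \<in> W"
      using W_mem by metis
    have "Y t *\<^sub>v w = \<beta> \<cdot>\<^sub>v v + \<alpha> \<cdot>\<^sub>v u"
      unfolding w using u v tu t_in_H
      by (simp add: Yadd Ysm u_def[symmetric] comm_add_vec[of _ n])
    then show "Y t *\<^sub>v w \<in> W"
      using W_mem by metis
  qed
  moreover have "v \<in> W"
  proof -
    have "v = 1 \<cdot>\<^sub>v v + 0 \<cdot>\<^sub>v u"
      using u v by auto
    then show ?thesis
      using W_mem by metis
  qed
  ultimately have W_all: "W = carrier_vec n"
    using v(2) by auto
  have size: "size (eigenvalues (Y h)) = n"
    by (rule size_eigenvalues[OF Yc[OF h_in_H]])
  show ?thesis
  proof (cases "a = 1")
    case False
    then have ne: "a \<noteq> inverse a"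
      using self_inverse_imp_1 a0 by blast
    have "n \<le> 2"
      using span_two_vectors_dim[OF v(1) u] W_all by (auto simp: W_def)
    moreover have "{#a, inverse a#} \<subseteq># eigenvalues (Y h)"
      using ev_a ev_inv ne by (simp add: insert_subset_eq_iff in_diff_count)
    ultimately have "eigenvalues (Y h) = {#a, inverse a#}"
      using size mset_subset_size[of "{#a, inverse a#}" "eigenvalues (Y h)"]
      by (cases "{#a, inverse a#} = eigenvalues (Y h)") (auto simp: subset_mset.less_le)
    then show ?thesis
      using a1 False by (auto simp: inverse_pair_def)
  next
    case True
    \<comment> \<open>Now \<open>h\<close> acts trivially, and \<open>t\<close> has a fixed vector, which spans everything.\<close>
    have h_trivial: "Y h *\<^sub>v w = w" if wn: "w \<in> carrier_vec n" for w
    proof -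
      obtain \<alpha> \<beta> where w: "w = \<alpha> \<cdot>\<^sub>v v + \<beta> \<cdot>\<^sub>v u"
        using wn unfolding W_all[symmetric] by (auto simp: W_def)
      show ?thesis
        unfolding w using u v hu h_in_H True by (simp add: Yadd Ysm)
    qed
    obtain w where w: "w \<in> carrier_vec n" "w \<noteq> 0\<^sub>v n" "Y t *\<^sub>v w = w"
    proof (cases "v + u = 0\<^sub>v n")
      case False
      have "Y t *\<^sub>v (v + u) = v + u"
        using u v tu t_in_H by (simp add: Yadd u_def[symmetric] comm_add_vec[of _ n])
      then show ?thesis
        using that[of "v + u"] False u v by simp
    next
      case True
      have "u $ i = v $ i" if "i < n" for i
        using arg_cong[OF True, of "\<lambda>w. w $ i"] that u v add_self[of "u $ i"] 
        by (metis (no_types) add_right_cancel carrier_vecD index_add_vec(1) index_zero_vec(1))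
      then have "u = v"
        using u v by (intro eq_vecI) auto
      then show ?thesis
        using that[of v] v by (simp add: u_def)
    qed
    define L where "L = {\<alpha> \<cdot>\<^sub>v w | \<alpha>. True}"
    have L_mem: "\<alpha> \<cdot>\<^sub>v w \<in> L" for \<alpha>
      unfolding L_def by blast
    have "L = {0\<^sub>v n} \<or> L = carrier_vec n"
    proof (rule invariant)
      show LC: "L \<subseteq> carrier_vec n"
        using w by (auto simp: L_def)
      show "VectorSpace.subspace class_ring L (module_vec TYPE('k) n)"
      proof (rule subspace_vecI[OF LC])
        have "0\<^sub>v n = 0 \<cdot>\<^sub>v w"
          using w by auto
        then show "0\<^sub>v n \<in> L"
          using L_mem by metis
        fix x assume "x \<in> L"
        then obtain \<alpha> where x: "x = \<alpha> \<cdot>\<^sub>v w"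
          by (auto simp: L_def)
        show "c \<cdot>\<^sub>v x \<in> L" for c
          using L_mem by (simp add: x smult_smult_assoc)
        fix y assume "y \<in> L"
        then obtain \<alpha>' where y: "y = \<alpha>' \<cdot>\<^sub>v w"
          by (auto simp: L_def)
        have "x + y = (\<alpha> + \<alpha>') \<cdot>\<^sub>v w"
          unfolding x y by (simp add: add_smult_distrib_vec)
        then show "x + y \<in> L"
          using L_mem by metis
      qed
      fix x assume "x \<in> L"
      then obtain \<alpha> where x: "x = \<alpha> \<cdot>\<^sub>v w"
        by (auto simp: L_def)
      show "Y h *\<^sub>v x \<in> L" "Y t *\<^sub>v x \<in> L"
        unfolding x using w L_mem h_in_H t_in_H by (simp_all add: Ysm h_trivial)
    qed
    moreover have "w \<in> L"
      using L_mem[of 1] w by simp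
    ultimately have "L = carrier_vec n"
      using w(2) by auto
    then have "n \<le> 1"
      using span_one_vector_dim[OF w(1)] by (auto simp: L_def)
    then have "n = 1"
      using n by simp
    then have "eigenvalues (Y h) = {#1#}"
      using size ev_a True size_1_singleton_mset by fastforce
    then show ?thesis
      using True a1 by (auto simp: inverse_pair_def)
  qed
qed

end

section \<open>Its irreducible Brauer characters and their multiplicities\<close>

text \<open>
With \<open>s\<close> true the matrix is diagonal with entries \<open>u\<close> and \<open>u\<inverse>\<close>; with \<open>s\<close> false it is the product of this
diagonal matrix with the swap of the two coordinates.
\<close>

definition dihedral_mat :: "'k::field \<Rightarrow> bool \<Rightarrow> 'k mat" where
  "dihedral_mat u s = mat 2 2 (\<lambda>(p, q). if (p = q) = s then (if p = 0 then u else inverse u) else 0)"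

lemma less_2_eq: "{..<2::nat} = {0, 1}"
  by auto

lemma dihedral_mat_carrier [simp]: "dihedral_mat u s \<in> carrier_mat 2 2"
  by (simp add: dihedral_mat_def)

lemma dihedral_mat_mult:
  assumes "u \<noteq> 0" "w \<noteq> 0"
  shows "dihedral_mat u s * dihedral_mat w s' = dihedral_mat (u * (if s then w else inverse w)) (s = s')"
proof (rule eq_matI)
  fix i j
  assume "i < dim_row (dihedral_mat (u * (if s then w else inverse w)) (s = s'))"
    and "j < dim_col (dihedral_mat (u * (if s then w else inverse w)) (s = s'))"
  then have "i = 0 \<or> i = 1" "j = 0 \<or> j = 1"
    by (auto simp: dihedral_mat_def)
  then show "(dihedral_mat u s * dihedral_mat w s') $$ (i, j)
      = dihedral_mat (u * (if s then w else inverse w)) (s = s') $$ (i, j)"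
    by (cases s; cases s'; elim disjE)
      (simp_all add: dihedral_mat_def scalar_prod_def atLeast0LessThan less_2_eq)
qed (auto simp: dihedral_mat_def)

lemma dihedral_mat_1: "dihedral_mat 1 True = 1\<^sub>m 2"
  by (rule eq_matI) (auto simp: dihedral_mat_def less_2_cases_iff)

lemma dihedral_mat_unit:
  assumes "u \<noteq> 0"
  shows "dihedral_mat (u :: 'k::field) s \<in> carrier (GL TYPE('k) 2)"
proof -
  let ?w = "if s then inverse u else u"
  have "dihedral_mat u s * dihedral_mat ?w s = 1\<^sub>m 2" "dihedral_mat ?w s * dihedral_mat u s = 1\<^sub>m 2"
    using assms by (simp_all add: dihedral_mat_mult dihedral_mat_1)
  then show ?thesis
    unfolding GL_def units_of_def Units_def
    by (auto simp: ring_mat_simps intro!: bexI[of _ "dihedral_mat ?w s"])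
qed

lemma eigenvalues_dihedral_mat:
  "eigenvalues (dihedral_mat (u :: 'k::field) True) = {#u, inverse u#}"
proof -
  have "eigenvalues (dihedral_mat u True)
      = image_mset (\<lambda>i. dihedral_mat u True $$ (i, i)) (mset [0..<2])"
    by (rule eigenvalues_upper_triangular) (auto simp: dihedral_mat_def)
  also have "[0..<2] = [0, 1]"
    by (simp add: upt_rec)
  finally show ?thesis
    by (simp add: dihedral_mat_def add_mset_commute)
qed

lemma subspace_vecD:
  fixes W :: "'k::field vec set"
  assumes "VectorSpace.subspace class_ring W (module_vec TYPE('k) n)"
  shows "W \<subseteq> carrier_vec n" "0\<^sub>v n \<in> W"
    and "\<And>v w. v \<in> W \<Longrightarrow> w \<in> W \<Longrightarrow> v + w \<in> W"
    and "\<And>c v. v \<in> W \<Longrightarrow> c \<cdot>\<^sub>v v \<in> W"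
proof -
  have s: "submodule class_ring W (module_vec TYPE('k) n)"
    using assms by (simp add: VectorSpace.subspace_def)
  show "W \<subseteq> carrier_vec n" "0\<^sub>v n \<in> W"
    using submodule.subset[OF s] submodule.zero_closed[OF s] by (simp_all add: module_vec_simps)
  show "v + w \<in> W" if "v \<in> W" "w \<in> W" for v w
    using submodule.m_closed[OF s that] by (simp add: module_vec_simps)
  show "c \<cdot>\<^sub>v v \<in> W" if "v \<in> W" for c v
    using submodule.smult_closed[OF s, of c v] that by (simp add: module_vec_simps)
qed

lemma irreducible_rep_one_dim:
  assumes "X \<in> hom G (GL TYPE('k::field) 1)"
  shows "irreducible_rep G 1 X"
  unfolding irreducible_rep_def
proof (intro conjI allI impI)
  fix W :: "'k vec set"
  assume "VectorSpace.subspace class_ring W (module_vec TYPE('k) 1) \<and> (\<forall>g\<in>carrier G. \<forall>w\<in>W. X g *\<^sub>v w \<in> W)"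
  then have sub: "VectorSpace.subspace class_ring W (module_vec TYPE('k) 1)"
    by blast
  note W = subspace_vecD[OF sub]
  show "W = {0\<^sub>v 1} \<or> W = carrier_vec 1"
  proof (cases "W \<subseteq> {0\<^sub>v 1}")
    case False
    then obtain w where w: "w \<in> W" "w \<noteq> 0\<^sub>v 1"
      by blast
    then have wc: "w \<in> carrier_vec 1"
      using W(1) by blast
    have w0: "w $ 0 \<noteq> 0"
    proof
      assume "w $ 0 = 0"
      then have "w = 0\<^sub>v 1"
        using wc by (intro eq_vecI) auto
      then show False
        using w(2) by simp
    qed
    have "x \<in> W" if x: "x \<in> carrier_vec 1" for x
    proof -
      have "x = (x $ 0 / w $ 0) \<cdot>\<^sub>v w"
        using x wc w0 by (intro eq_vecI) auto
      then show ?thesis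
        using W(4)[OF w(1)] by metis
    qed
    then show ?thesis
      using W(1) by blast
  qed (use W(2) in blast)
qed (use assms in auto)

lemma one_dim_unit: "(c :: 'k::field) \<noteq> 0 \<Longrightarrow> mat 1 1 (\<lambda>_. c) \<in> carrier (GL TYPE('k) 1)"
  unfolding GL_def units_of_def Units_def
  by (auto simp: ring_mat_simps scalar_prod_def intro!: bexI[of _ "mat 1 1 (\<lambda>_. inverse c)"] eq_matI)

context dihedral_rep
begin

text \<open>
Exponents are determined only modulo the orders of \<open>h\<close> and \<open>t\<close>; \<open>dihedral_elem\<close> shows that the choice does
not affect the representations below.
\<close>

definition exponents :: "'g \<Rightarrow> nat \<times> nat" where
  "exponents x = (SOME p. x = elem (fst p) (snd p))"

lemma exponents: "x \<in> H \<Longrightarrow> x = elem (fst (exponents x)) (snd (exponents x))"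
  unfolding exponents_def by (rule someI_ex) (auto simp: H_eq)

definition dihedral_dim :: "'k \<Rightarrow> nat" where
  "dihedral_dim a = (if a = 1 then 1 else 2)"

definition dihedral :: "'k \<Rightarrow> 'g \<Rightarrow> 'k mat" where
  "dihedral a x = (if a = 1 then 1\<^sub>m 1 else dihedral_mat (a ^ fst (exponents x)) (even (snd (exponents x))))"

lemma root_nonzero: "(a :: 'k) ^ ord h = 1 \<Longrightarrow> a \<noteq> 0"
  using odd_pos[OF odd_ord_h] by (auto simp: power_0_left)

text \<open>
Since \<open>a \<noteq> 1\<close>, the element \<open>h\<close> is nontrivial of odd order, so \<open>h \<noteq> h\<inverse>\<close> and \<open>t\<close> is not trivial; hence the
order of \<open>t\<close> is even and the parity of its exponent is well defined.
\<close>

lemma dihedral_elem: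
  assumes a: "a ^ ord h = 1" "a \<noteq> 1"
  shows "dihedral a (elem i j) = dihedral_mat (a ^ i) (even j)"
proof -
  let ?i = "fst (exponents (elem i j))" and ?j = "snd (exponents (elem i j))"
  have "elem ?i ?j = elem i j"
    using exponents[OF elem_in_H] by simp
  then have eq: "h [^] ?i = h [^] i" "t [^] ?j = t [^] j"
    by (simp_all add: elem_eq_iff)
  have "a ^ ?i = a ^ i"
    by (rule h_pow_eq_imp[OF eq(1) a(1)])
  moreover have "even ?j = even j"
  proof -
    have "k \<noteq> 0"
    proof
      assume "k = 0"
      then have "t = \<one>"
        using ord_t ord_eq_1[OF t] by simp
      then have "h = inv h"
        using inverts h by (simp add: inverts_def)
      then have "h \<otimes> h = \<one>"
        using r_inv[OF h] by simp
      then have "h [^] (2::nat) = \<one>"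
        using h by (simp add: numeral_2_eq_2)
      then have "ord h dvd 2"
        using pow_eq_id[OF h] by simp
      then have "ord h = 1 \<or> ord h = 2"
        using two_is_prime_nat prime_nat_iff by blast
      then have "ord h = 1"
        using odd_ord_h by auto
      then show False
        using a by simp
    qed
    then have 2: "2 dvd (2::nat) ^ k"
      by simp
    have *: "even j' = even j''" if eq': "t [^] j' = t [^] j''" and le: "j'' \<le> j'" for j' j'' :: nat
    proof -
      have "t [^] (j' - j'') = \<one>"
        using eq' le t by (simp add: pow_eq_div2)
      then have "2 ^ k dvd j' - j''"
        using pow_eq_id[OF t] by (simp add: ord_t)
      with 2 have "2 dvd j' - j''"
        by (rule dvd_trans)
      then show ?thesis
        using le by (simp add: even_diff_nat)
    qed
    show ?thesis
    proof (cases "?j \<le> j")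
      case True
      then show ?thesis
        using *[OF eq(2)[symmetric]] by simp
    next
      case False
      then show ?thesis
        using *[OF eq(2)] by simp
    qed
  qed
  ultimately show ?thesis
    using a(2) by (simp add: dihedral_def)
qed

lemma dihedral_hom:
  assumes a: "a ^ ord h = 1"
  shows "dihedral a \<in> hom GH (GL TYPE('k) (dihedral_dim a))"
proof (cases "a = 1")
  case True
  have "1\<^sub>m 1 = (mat 1 1 (\<lambda>_. 1) :: 'k mat)"
    by (rule eq_matI) auto
  then have "(1\<^sub>m 1 :: 'k mat) \<in> carrier (GL TYPE('k) 1)"
    using one_dim_unit[of "1::'k"] by simp
  then show ?thesis
    using True by (auto simp: hom_def dihedral_def dihedral_dim_def GL_def units_of_def ring_mat_simps)
next
  case False
  have a0: "a \<noteq> 0"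
    using root_nonzero[OF a] .
  have inv: "inverse a = a ^ (ord h - 1)"
    using odd_ord_h a by (rule inverse_root_of_unity)
  have pow: "a ^ ((ord h - 1) ^ j * i) = (if even j then a ^ i else inverse (a ^ i))" for i j
  proof (induction j)
    case (Suc j)
    have "a ^ ((ord h - 1) ^ Suc j * i) = (a ^ (ord h - 1)) ^ ((ord h - 1) ^ j * i)"
      by (simp add: power_mult[symmetric] mult_ac)
    also have "\<dots> = inverse (a ^ ((ord h - 1) ^ j * i))"
      unfolding inv[symmetric] by (simp add: power_inverse)
    finally show ?case
      unfolding Suc.IH by simp
  qed simp
  show ?thesis
    unfolding hom_def
  proof (intro CollectI conjI ballI funcsetI)
    fix x assume "x \<in> carrier GH"
    then show "dihedral a x \<in> carrier (GL TYPE('k) (dihedral_dim a))"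
      using False a0 dihedral_mat_unit[of "a ^ fst (exponents x)" "even (snd (exponents x))"]
      by (simp add: dihedral_def dihedral_dim_def)
    fix y assume "y \<in> carrier GH"
    then obtain i j i' j' where xy: "x = elem i j" "y = elem i' j'"
      using \<open>x \<in> carrier GH\<close> by (auto simp: H_eq)
    have "dihedral a (x \<otimes> y) = dihedral_mat (a ^ (i + (ord h - 1) ^ j * i')) (even (j + j'))"
      by (simp only: xy elem_mult dihedral_elem[OF a False])
    also have "\<dots> = dihedral_mat (a ^ i * (if even j then a ^ i' else inverse (a ^ i'))) (even j = even j')"
      by (simp only: power_add pow even_add)
    also have "\<dots> = dihedral a x * dihedral a y"
      using a0 by (simp add: xy dihedral_elem[OF a False] dihedral_mat_mult)
    finally show "dihedral a (x \<otimes>\<^bsub>GH\<^esub> y)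
        = dihedral a x \<otimes>\<^bsub>GL TYPE('k) (dihedral_dim a)\<^esub> dihedral a y"
      by (simp add: GL_def units_of_def ring_mat_simps)
  qed
qed

lemma eigenvalues_dihedral:
  assumes a: "a ^ ord h = 1"
  shows "eigenvalues (dihedral a h) = inverse_pair a"
proof (cases "a = 1")
  case True
  then show ?thesis
    by (simp add: dihedral_def inverse_pair_def eigenvalues_one)
next
  case False
  have "h = elem 1 0"
    using h by (simp add: elem_def)
  then have "dihedral a h = dihedral_mat a True"
    using dihedral_elem[OF a False, of 1 0] by simp
  then show ?thesis
    using False by (simp add: eigenvalues_dihedral_mat inverse_pair_def)
qed

lemma dihedral_irreducible:
  assumes a: "a ^ ord h = 1"
  shows "irreducible_rep GH (dihedral_dim a) (dihedral a)"
proof (cases "a = 1")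
  case True
  then show ?thesis
    using dihedral_hom[OF a] irreducible_rep_one_dim[of "dihedral a" GH]
    by (simp add: dihedral_dim_def)
next
  case False
  have a0: "a \<noteq> 0"
    using root_nonzero[OF a] .
  have ne: "a - inverse a \<noteq> 0"
    using self_inverse_imp_1[OF _ a0] False by auto
  have dim: "dihedral_dim a = 2"
    using False by (simp add: dihedral_dim_def)
  have dh: "dihedral a h = dihedral_mat a True"
    using dihedral_elem[OF a False, of 1 0] h by (simp add: elem_def)
  have dt: "dihedral a t = dihedral_mat 1 False"
    using dihedral_elem[OF a False, of 0 1] t by (simp add: elem_def)
  show ?thesis
    unfolding irreducible_rep_def dim
  proof (intro conjI allI impI)
    show "dihedral a \<in> hom GH (GL TYPE('k) 2)"
      using dihedral_hom[OF a] dim by simp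
    fix W :: "'k vec set"
    assume asm: "VectorSpace.subspace class_ring W (module_vec TYPE('k) 2) \<and>
        (\<forall>g\<in>carrier GH. \<forall>w\<in>W. dihedral a g *\<^sub>v w \<in> W)"
    then have sub: "VectorSpace.subspace class_ring W (module_vec TYPE('k) 2)"
      by blast
    note W = subspace_vecD[OF sub]
    have inv: "dihedral_mat a True *\<^sub>v w \<in> W" "dihedral_mat 1 False *\<^sub>v w \<in> W" if "w \<in> W" for w
      using asm that h_in_H t_in_H dh dt by auto
    have h_act: "dihedral_mat a True *\<^sub>v w = vec 2 (\<lambda>i. if i = 0 then a * w $ 0 else inverse a * w $ 1)"
      and t_act: "dihedral_mat 1 False *\<^sub>v w = vec 2 (\<lambda>i. if i = 0 then w $ 1 else w $ 0)"
      if "w \<in> carrier_vec 2" for w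
      using that by (auto simp: dihedral_mat_def scalar_prod_def atLeast0LessThan less_2_eq
          less_2_cases_iff intro!: eq_vecI)
    show "W = {0\<^sub>v 2} \<or> W = carrier_vec 2"
    proof (cases "W \<subseteq> {0\<^sub>v 2}")
      case False
      then obtain w where w: "w \<in> W" "w \<noteq> 0\<^sub>v 2"
        by blast
      have wc: "w \<in> carrier_vec 2"
        using w(1) W(1) by blast
      \<comment> \<open>Swapping coordinates if necessary gives a vector with nonzero first coordinate.\<close>
      obtain x where x: "x \<in> W" "x $ 0 \<noteq> 0"
      proof (cases "w $ 0 = 0")
        case True
        have "w $ 1 \<noteq> 0"
        proof
          assume "w $ 1 = 0"
          then have "w = 0\<^sub>v 2"
            using True wc by (intro eq_vecI) (auto simp: less_2_cases_iff)
          then show False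
            using w(2) by simp
        qed
        then show ?thesis
          using that[of "dihedral_mat 1 False *\<^sub>v w"] inv(2)[OF w(1)] t_act[OF wc] by simp
      next
        case False
        then show ?thesis
          using that w(1) by blast
      qed
      have xc: "x \<in> carrier_vec 2"
        using x(1) W(1) by blast
      define D where "D = (a - inverse a) * x $ 0"
      have D: "D \<noteq> 0" "a * x $ 0 - inverse a * x $ 0 = D"
        using ne x(2) by (simp_all add: D_def left_diff_distrib)
      define e where "e = inverse D \<cdot>\<^sub>v
        (dihedral_mat a True *\<^sub>v x + (- inverse a) \<cdot>\<^sub>v x)"
      have eW: "e \<in> W"
        unfolding e_def using W(3,4) inv(1) x(1) by blast
      have e_unit: "e = unit_vec 2 0"
        unfolding e_def h_act[OF xc] using xc D
        by (intro eq_vecI) (auto simp: less_2_cases_iff)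
      have "dihedral_mat 1 False *\<^sub>v e = unit_vec 2 1"
        unfolding e_unit by (subst t_act) (auto simp: less_2_cases_iff intro!: eq_vecI)
      then have e1W: "unit_vec 2 1 \<in> W"
        using inv(2)[OF eW] by simp
      have "y \<in> W" if y: "y \<in> carrier_vec 2" for y
      proof -
        have "y = y $ 0 \<cdot>\<^sub>v unit_vec 2 0 + y $ 1 \<cdot>\<^sub>v unit_vec 2 1"
          using y by (intro eq_vecI) (auto simp: less_2_cases_iff)
        then show ?thesis
          using W(3,4) eW e1W unfolding e_unit by metis
      qed
      then show ?thesis
        using W(1) by blast
    qed (use W(2) in blast)
  qed simp
qed

definition \<theta> :: "'k \<Rightarrow> 'g \<Rightarrow> complex" where
  "\<theta> a = brauer_character red GH (dihedral a)"

definition roots :: "'k set" where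
  "roots = {a. a ^ ord h = 1}"

lemma finite_roots: "finite roots"
  unfolding roots_def using odd_pos[OF odd_ord_h] by (rule finite_roots_of_unity_bound)

lemma brauer_rep_GH:
  assumes "Y \<in> hom GH (GL TYPE('k) n)"
  shows "brauer_rep red GH n (Y :: 'g \<Rightarrow> 'k mat)"
  using matrix_repI[OF GH.is_group assms]
  by (intro brauer_rep.intro finite_matrix_rep.intro modular_reduction_2_axioms GH.finite_group_axioms)

lemma h_regular: "h \<in> p_regular 2 GH"
  using h_in_H h odd_ord_h by (auto simp: GH.p_regular_2_iff GH_pow intro!: exI[of _ "ord h"])

lemma p_regular_GH_pow: "g \<in> p_regular 2 GH \<longleftrightarrow> (\<exists>i::nat. g = h [^] i)"
  by (auto simp: p_regular_GH generate_h)

lemma brauer_character_GH_pow: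
  assumes "Y \<in> hom GH (GL TYPE('k) n)"
  shows "brauer_character red GH Y (h [^] (i::nat))
    = \<Sum>\<^sub># (image_mset (\<lambda>a. brauer_lift red a ^ i) (eigenvalues (Y h)))"
proof -
  interpret Y: brauer_rep red GH n Y
    by (rule brauer_rep_GH[OF assms])
  show ?thesis
    using Y.brauer_character_pow[OF h_regular, of i] by (simp add: GH_pow)
qed

lemma brauer_character_GH_eqI:
  assumes "Y \<in> hom GH (GL TYPE('k) n)" "Z \<in> hom GH (GL TYPE('k) n')"
    and "eigenvalues (Y h) = eigenvalues (Z h)"
  shows "brauer_character red GH Y = brauer_character red GH Z"
proof (rule ext)
  fix g
  show "brauer_character red GH Y g = brauer_character red GH Z g"
  proof (cases "g \<in> p_regular 2 GH")
    case True
    then obtain i :: nat where "g = h [^] i"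
      using p_regular_GH_pow by blast
    then show ?thesis
      using brauer_character_GH_pow[OF assms(1)] brauer_character_GH_pow[OF assms(2)] assms(3) by simp
  next
    case False
    then show ?thesis
      by (simp add: brauer_character_def char_2)
  qed
qed

lemma \<theta>_pow:
  assumes "a \<in> roots"
  shows "\<theta> a (h [^] (i::nat)) = \<Sum>\<^sub># (image_mset (\<lambda>a. brauer_lift red a ^ i) (inverse_pair a))"
  using assms brauer_character_GH_pow[OF dihedral_hom] eigenvalues_dihedral
  by (simp add: roots_def \<theta>_def)

lemma IBr_GH: "IBr red GH = \<theta> ` roots"
proof
  show "\<theta> ` roots \<subseteq> IBr red GH"
    using dihedral_irreducible by (auto simp: IBr_def \<theta>_def roots_def)
  show "IBr red GH \<subseteq> \<theta> ` roots"
  proof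
    fix \<psi> assume "\<psi> \<in> IBr red GH"
    then obtain n and Y :: "'g \<Rightarrow> 'k mat" where Y: "irreducible_rep GH n Y"
        "\<psi> = brauer_character red GH Y"
      by (auto simp: IBr_def)
    obtain a where a: "a ^ ord h = 1" "eigenvalues (Y h) = inverse_pair a"
      using irreducible_rep_GH_eigenvalues[OF Y(1)] by blast
    have "Y \<in> hom GH (GL TYPE('k) n)"
      using Y(1) by (simp add: irreducible_rep_def)
    then have "\<psi> = \<theta> a"
      unfolding Y(2) \<theta>_def
      by (rule brauer_character_GH_eqI[OF _ dihedral_hom[OF a(1)]]) (simp add: a eigenvalues_dihedral)
    then show "\<psi> \<in> \<theta> ` roots"
      using a(1) by (simp add: roots_def)
  qed
qed

lemma \<theta>_real:
  assumes a: "a \<in> roots"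
  shows "\<theta> a ` p_regular 2 GH \<subseteq> \<real>"
proof
  fix z assume "z \<in> \<theta> a ` p_regular 2 GH"
  then obtain i :: nat where z: "z = \<theta> a (h [^] i)"
    using p_regular_GH_pow by auto
  have am: "a ^ ord h = 1"
    using a by (simp add: roots_def)
  have "z = cnj z"
    unfolding z \<theta>_pow[OF a] inverse_pair_def
    using brauer_lift_inverse(2)[OF odd_ord_h am] by (simp add: brauer_lift_1 add.commute)
  then show "z \<in> \<real>"
    by (simp add: Reals_cnj_iff)
qed

text \<open>
The inner product of the restriction of \<open>f\<close> to \<open>\<langle>h\<rangle>\<close> with the linear character that maps \<open>h\<close> to the lift of
\<open>b\<close>.
\<close>

definition fourier :: "'k \<Rightarrow> ('g \<Rightarrow> complex) \<Rightarrow> complex" where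
  "fourier b f = (\<Sum>i<ord h. f (h [^] i) * cnj (brauer_lift red b ^ i)) / of_nat (ord h)"

lemma lift_orthogonal:
  assumes a: "a \<in> roots" and b: "b \<in> roots"
  shows "(\<Sum>i<ord h. brauer_lift red a ^ i * cnj (brauer_lift red b ^ i))
    = (if a = b then of_nat (ord h) else 0)"
proof -
  have am: "a ^ ord h = 1" and bm: "b ^ ord h = 1"
    using a b by (simp_all add: roots_def)
  define r where "r = brauer_lift red a * cnj (brauer_lift red b)"
  have r: "r = brauer_lift red a / brauer_lift red b"
    using brauer_lift_inverse[OF odd_ord_h bm] by (simp add: r_def divide_inverse)
  have "(\<Sum>i<ord h. brauer_lift red a ^ i * cnj (brauer_lift red b ^ i)) = (\<Sum>i<ord h. r ^ i)"
    by (simp add: r_def power_mult_distrib)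
  also have "\<dots> = (if a = b then of_nat (ord h) else 0)"
  proof (cases "a = b")
    case True
    then have "r = 1"
      using r brauer_lift_nonzero[OF odd_ord_h bm] by simp
    then show ?thesis
      using True by simp
  next
    case False
    then have "brauer_lift red a \<noteq> brauer_lift red b"
      using brauer_lift_inj[OF odd_ord_h am bm] by blast
    then have "r \<noteq> 1"
      using r brauer_lift_nonzero[OF odd_ord_h bm] by simp
    moreover have "r ^ ord h = 1"
      using brauer_lift_props(1)[OF odd_ord_h] am bm by (simp add: r power_divide)
    ultimately show ?thesis
      using False by (simp add: geometric_sum)
  qed
  finally show ?thesis .
qed

lemma fourier_eigenvalues:
  assumes b: "b \<in> roots" and M: "set_mset M \<subseteq> roots"
    and f: "\<And>i::nat. f (h [^] i) = \<Sum>\<^sub># (image_mset (\<lambda>a. brauer_lift red a ^ i) M)"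
  shows "fourier b f = of_nat (count M b)"
proof -
  have "(\<Sum>i<ord h. \<Sum>\<^sub># (image_mset (\<lambda>a. brauer_lift red a ^ i) M) * cnj (brauer_lift red b ^ i))
      = of_nat (count M b) * of_nat (ord h)"
    using M
  proof (induction M)
    case (add a M)
    have "(\<Sum>i<ord h. \<Sum>\<^sub># (image_mset (\<lambda>a. brauer_lift red a ^ i) (add_mset a M)) * cnj (brauer_lift red b ^ i))
        = (\<Sum>i<ord h. brauer_lift red a ^ i * cnj (brauer_lift red b ^ i))
          + (\<Sum>i<ord h. \<Sum>\<^sub># (image_mset (\<lambda>a. brauer_lift red a ^ i) M) * cnj (brauer_lift red b ^ i))"
      by (simp add: distrib_right sum.distrib)
    also have "\<dots> = of_nat (count (add_mset a M) b) * of_nat (ord h)"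
      using add lift_orthogonal[of a b] b by (simp add: algebra_simps del: complex_cnj_power)
    finally show ?case .
  qed simp
  then show ?thesis
    using odd_pos[OF odd_ord_h] by (simp add: fourier_def f)
qed

lemma count_inverse_pair:
  assumes "a \<in> roots"
  shows "count (inverse_pair a) b = (if b = a \<or> b = inverse a then 1 else 0)"
  using self_inverse_imp_1[of a] root_nonzero[of a] assms
  by (auto simp: inverse_pair_def roots_def)

lemma inverse_in_roots: "a \<in> roots \<Longrightarrow> inverse a \<in> roots"
  by (simp add: roots_def power_inverse)

lemma inverse_pair_subset: "a \<in> roots \<Longrightarrow> set_mset (inverse_pair a) \<subseteq> roots"
  using inverse_in_roots by (auto simp: inverse_pair_def)

lemma fourier_\<theta>:
  assumes "a \<in> roots" "b \<in> roots"
  shows "fourier b (\<theta> a) = (if b = a \<or> b = inverse a then 1 else 0)"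
  using fourier_eigenvalues[OF assms(2) inverse_pair_subset[OF assms(1)], of "\<theta> a"]
    \<theta>_pow[OF assms(1)] count_inverse_pair[OF assms(1)] by simp

lemma \<theta>_eq_iff:
  assumes a: "a \<in> roots" and b: "b \<in> roots"
  shows "\<theta> a = \<theta> b \<longleftrightarrow> b = a \<or> b = inverse a"
proof
  assume "\<theta> a = \<theta> b"
  then have "fourier b (\<theta> a) = fourier b (\<theta> b)"
    by simp
  then show "b = a \<or> b = inverse a"
    using fourier_\<theta>[OF a b] fourier_\<theta>[OF b b] by (simp split: if_splits)
next
  assume "b = a \<or> b = inverse a"
  then have "inverse_pair b = inverse_pair a"
    by (auto simp: inverse_pair_def add_mset_commute)
  then show "\<theta> a = \<theta> b"
    unfolding \<theta>_def using a b
    by (intro brauer_character_GH_eqI[OF dihedral_hom dihedral_hom])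
      (simp_all add: eigenvalues_dihedral roots_def)
qed

lemma fourier_sum:
  assumes "finite S"
  shows "fourier b (\<lambda>g. \<Sum>\<psi>\<in>S. c \<psi> * \<psi> g) = (\<Sum>\<psi>\<in>S. c \<psi> * fourier b \<psi>)"
proof -
  have "(\<Sum>i<ord h. (\<Sum>\<psi>\<in>S. c \<psi> * \<psi> (h [^] i)) * cnj (brauer_lift red b ^ i))
      = (\<Sum>\<psi>\<in>S. c \<psi> * (\<Sum>i<ord h. \<psi> (h [^] i) * cnj (brauer_lift red b ^ i)))"
    by (simp add: sum_distrib_right sum_distrib_left mult.assoc sum.swap[of _ S])
  then show ?thesis
    unfolding fourier_def by (simp only: sum_divide_distrib[of _ S] times_divide_eq_right)
qed

text \<open>
Grouping the linear constituents of \<open>f\<close> into pairs \<open>{a, a\<inverse>}\<close> expands \<open>f\<close> in irreducible Brauer characters,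
and the coefficient of \<open>\<theta> b\<close> in any expansion is recovered by the Fourier coefficient at \<open>b\<close>, because no
other irreducible Brauer character contains that linear character.
\<close>

theorem brauer_multiplicity_GH:
  assumes b: "b \<in> roots" and M: "set_mset M \<subseteq> roots" and sym: "image_mset inverse M = M"
    and f: "\<And>i::nat. f (h [^] i) = \<Sum>\<^sub># (image_mset (\<lambda>a. brauer_lift red a ^ i) M)"
  shows "brauer_multiplicity red GH f (\<theta> b) = count M b"
  unfolding brauer_multiplicity_def char_2
proof (rule the_equality)
  have count_inv: "count M (inverse a) = count M a" for a
  proof -
    have "count M (inverse a) = count (image_mset inverse M) (inverse a)"
      by (simp only: sym)
    also have "\<dots> = count M a"
      by (induction M) simp_all
    finally show ?thesis .
  qed
  define c where "c \<psi> = count M (SOME a. a \<in> roots \<and> \<theta> a = \<psi>)" for \<psi>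
  have c: "c (\<theta> a) = count M a" if a: "a \<in> roots" for a
  proof -
    let ?a = "SOME a'. a' \<in> roots \<and> \<theta> a' = \<theta> a"
    have "?a \<in> roots \<and> \<theta> ?a = \<theta> a"
      by (rule someI[of _ a]) (simp add: a)
    then have "?a = a \<or> ?a = inverse a"
      using \<theta>_eq_iff[OF a, of ?a] by simp
    then show ?thesis
      unfolding c_def using count_inv by auto
  qed
  have expand: "f g = (\<Sum>\<psi>\<in>IBr red GH. of_nat (c \<psi>) * \<psi> g)" if g: "g \<in> p_regular 2 GH" for g
  proof -
    obtain i :: nat where gi: "g = h [^] i"
      using g p_regular_GH_pow by blast
    have fiber: "(\<Sum>a\<in>{x \<in> roots. \<theta> x = \<psi>}. of_nat (count M a) * brauer_lift red a ^ i)
        = of_nat (c \<psi>) * \<psi> g" if \<psi>: "\<psi> \<in> \<theta> ` roots" for \<psi>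
    proof -
      obtain a where a: "a \<in> roots" "\<psi> = \<theta> a"
        using \<psi> by blast
      have "\<theta> x = \<theta> a \<longleftrightarrow> x = a \<or> x = inverse a" if "x \<in> roots" for x
        using \<theta>_eq_iff[OF a(1) that] by (simp only: eq_commute[of "\<theta> x" "\<theta> a"])
      then have "{x \<in> roots. \<theta> x = \<psi>} = {a, inverse a}"
        using a inverse_in_roots[OF a(1)] by auto
      moreover have "a = inverse a \<longleftrightarrow> a = 1"
        using self_inverse_imp_1[of a] root_nonzero[of a] a(1) by (auto simp: roots_def)
      ultimately show ?thesis
        using \<theta>_pow[OF a(1), of i] c[OF a(1)] count_inv[of a]
        by (cases "a = 1") (simp_all add: gi a(2) inverse_pair_def algebra_simps)
    qed
    have "f g = (\<Sum>a\<in>roots. of_nat (count M a) * brauer_lift red a ^ i)"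
      unfolding gi f using M
    proof (induction M)
      case (add x M)
      have "(\<Sum>a\<in>roots. of_nat (count (add_mset x M) a) * brauer_lift red a ^ i)
          = (\<Sum>a\<in>roots. of_nat (count M a) * brauer_lift red a ^ i
              + (if a = x then brauer_lift red x ^ i else 0))"
        by (intro sum.cong refl) (simp add: algebra_simps)
      then show ?case
        using add finite_roots by (simp add: sum.distrib add.commute)
    qed simp
    also have "\<dots> = (\<Sum>\<psi>\<in>\<theta> ` roots. \<Sum>a\<in>{x \<in> roots. \<theta> x = \<psi>}. of_nat (count M a) * brauer_lift red a ^ i)"
      by (rule sum.image_gen[OF finite_roots])
    also have "\<dots> = (\<Sum>\<psi>\<in>IBr red GH. of_nat (c \<psi>) * \<psi> g)"
      unfolding IBr_GH by (intro sum.cong refl fiber)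
    finally show ?thesis .
  qed
  show "\<exists>c. (\<forall>g\<in>p_regular 2 GH. f g = (\<Sum>\<psi>\<in>IBr red GH. of_nat (c \<psi>) * \<psi> g)) \<and> count M b = c (\<theta> b)"
    using expand c[OF b] by (intro exI[of _ c]) simp
  fix m assume "\<exists>c. (\<forall>g\<in>p_regular 2 GH. f g = (\<Sum>\<psi>\<in>IBr red GH. of_nat (c \<psi>) * \<psi> g)) \<and> m = c (\<theta> b)"
  then obtain c' :: "('g \<Rightarrow> complex) \<Rightarrow> nat" where
    c': "\<And>g. g \<in> p_regular 2 GH \<Longrightarrow> f g = (\<Sum>\<psi>\<in>IBr red GH. of_nat (c' \<psi>) * \<psi> g)" "m = c' (\<theta> b)"
    by blast
  have fin: "finite (IBr red GH)"
    using finite_roots by (simp add: IBr_GH)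
  have "of_nat (count M b) = fourier b f"
    using fourier_eigenvalues[OF b M f] by simp
  also have "\<dots> = fourier b (\<lambda>g. \<Sum>\<psi>\<in>IBr red GH. of_nat (c' \<psi>) * \<psi> g)"
    unfolding fourier_def using c'(1) p_regular_GH_pow
    by (intro arg_cong2[of _ _ _ _ "(/)"] sum.cong refl) auto
  also have "\<dots> = (\<Sum>\<psi>\<in>IBr red GH. of_nat (c' \<psi>) * fourier b \<psi>)"
    by (rule fourier_sum[OF fin])
  also have "\<dots> = (\<Sum>\<psi>\<in>IBr red GH. if \<psi> = \<theta> b then of_nat (c' \<psi>) else 0)"
  proof (intro sum.cong refl)
    fix \<psi> assume "\<psi> \<in> IBr red GH"
    then obtain a where a: "a \<in> roots" "\<psi> = \<theta> a"
      by (auto simp: IBr_GH)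
    then show "of_nat (c' \<psi>) * fourier b \<psi> = (if \<psi> = \<theta> b then of_nat (c' \<psi>) else 0)"
      using fourier_\<theta>[OF a(1) b] \<theta>_eq_iff[OF a(1) b] by simp
  qed
  also have "\<dots> = of_nat m"
    using fin b by (simp add: c'(2) IBr_GH)
  finally show "m = count M b"
    by simp
qed

end

section \<open>The restriction to the cyclic subgroup, and the theorem\<close>

context dihedral_rep
begin

definition linear_rep :: "'k \<Rightarrow> 'g \<Rightarrow> complex mat" where
  "linear_rep b x = mat 1 1 (\<lambda>_. brauer_lift red b ^ (SOME i. x = h [^] (i::nat)))"

lemma linear_rep_pow:
  assumes b: "b \<in> roots"
  shows "linear_rep b (h [^] (i::nat)) = mat 1 1 (\<lambda>_. brauer_lift red b ^ i)"
proof -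
  have "h [^] i = h [^] (SOME i'. h [^] i = h [^] (i'::nat))"
    by (rule someI[of _ i]) (rule refl)
  then have "brauer_lift red b ^ i = brauer_lift red b ^ (SOME i'. h [^] i = h [^] (i'::nat))"
    using b brauer_lift_props(1)[OF odd_ord_h] by (intro h_pow_eq_imp) (simp_all add: roots_def)
  then show ?thesis
    by (simp add: linear_rep_def)
qed

lemma linear_rep_hom:
  assumes b: "b \<in> roots"
  shows "linear_rep b \<in> hom (G\<lparr>carrier := generate G {h}\<rparr>) (GL TYPE(complex) 1)"
  unfolding hom_def
proof (intro CollectI conjI ballI funcsetI)
  fix x assume x: "x \<in> carrier (G\<lparr>carrier := generate G {h}\<rparr>)"
  then obtain i :: nat where i: "x = h [^] i"
    by (auto simp: generate_h)
  have nz: "brauer_lift red b \<noteq> 0"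
    using b brauer_lift_nonzero[OF odd_ord_h] by (simp add: roots_def)
  show "linear_rep b x \<in> carrier (GL TYPE(complex) 1)"
    unfolding i linear_rep_pow[OF b] by (rule one_dim_unit) (simp add: nz)
  fix y assume "y \<in> carrier (G\<lparr>carrier := generate G {h}\<rparr>)"
  then obtain j :: nat where j: "y = h [^] j"
    by (auto simp: generate_h)
  have "linear_rep b (x \<otimes> y) = linear_rep b x * linear_rep b y"
    using h unfolding i j nat_pow_mult[OF h] linear_rep_pow[OF b]
    by (intro eq_matI) (simp_all add: scalar_prod_def power_add)
  then show "linear_rep b (x \<otimes>\<^bsub>G\<lparr>carrier := generate G {h}\<rparr>\<^esub> y)
      = linear_rep b x \<otimes>\<^bsub>GL TYPE(complex) 1\<^esub> linear_rep b y"
    by (simp add: GL_def units_of_def ring_mat_simps)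
qed

text \<open>
The irreducible character is the linear one with value \<open>brauer_lift red b\<close> at \<open>h\<close>.
\<close>

theorem exists_Irr_fourier:
  assumes b: "b \<in> roots"
  shows "\<exists>\<mu>\<in>Irr (G\<lparr>carrier := generate G {h}\<rparr>).
    char_inner (G\<lparr>carrier := generate G {h}\<rparr>) f \<mu> = fourier b f"
proof
  define \<mu> where "\<mu> = (\<lambda>g\<in>generate G {h}. \<Sum>i<1. linear_rep b g $$ (i, i))"
  show "\<mu> \<in> Irr (G\<lparr>carrier := generate G {h}\<rparr>)"
    unfolding Irr_def \<mu>_def
    by (intro CollectI exI[of _ 1] exI[of _ "linear_rep b"] conjI
        irreducible_rep_one_dim[OF linear_rep_hom[OF b]]) simp
  have \<mu>: "\<mu> (h [^] i) = brauer_lift red b ^ i" for i :: nat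
    by (simp add: \<mu>_def generate_h linear_rep_pow[OF b])
  have inj: "inj_on (\<lambda>i::nat. h [^] i) {..<ord h}"
  proof -
    have "{0..ord h - 1} = {..<ord h}"
      using odd_pos[OF odd_ord_h] by auto
    then show ?thesis
      using ord_inj[OF h] by simp
  qed
  have img: "generate G {h} = (\<lambda>i::nat. h [^] i) ` {..<ord h}"
  proof (rule sym, rule card_seteq)
    show "finite (generate G {h})"
      using finite_subset[OF generate_incl finite_carrier, of "{h}"] h by simp
    show "card (generate G {h}) \<le> card ((\<lambda>i::nat. h [^] i) ` {..<ord h})"
      using inj generate_pow_card[OF h] by (simp add: card_image)
  qed (auto simp: generate_h)
  have order: "Coset.order (G\<lparr>carrier := generate G {h}\<rparr>) = ord h"
    using generate_pow_card[OF h] by (simp add: Coset.order_def)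
  have "(\<Sum>g\<in>generate G {h}. f g * cnj (\<mu> g)) = (\<Sum>i<ord h. f (h [^] i) * cnj (\<mu> (h [^] i)))"
    unfolding img by (simp add: sum.reindex[OF inj])
  then show "char_inner (G\<lparr>carrier := generate G {h}\<rparr>) f \<mu> = fourier b f"
    by (simp add: char_inner_def order fourier_def \<mu>)
qed

end

theorem theorem6p2:
  fixes G :: "('g, 'b) monoid_scheme"
    and red :: "complex \<Rightarrow> 'k::alg_closed_field"
    and \<phi> :: "'g \<Rightarrow> complex"
  assumes "group G" and "finite (carrier G)"
    and "CHAR('k) = 2" and "modular_reduction red"
    and "\<phi> \<in> IBr red G"
    and "\<phi> ` p_regular 2 G \<subseteq> \<real>"
    and "\<phi> \<noteq> (\<lambda>g\<in>p_regular 2 G. 1)"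
  shows "\<exists>H \<theta>.
      subgroup H G \<and>
      \<theta> \<in> IBr red (G\<lparr>carrier := H\<rparr>) \<and>
      \<theta> ` p_regular 2 (G\<lparr>carrier := H\<rparr>) \<subseteq> \<real> \<and>
      odd (brauer_multiplicity red (G\<lparr>carrier := H\<rparr>)
             (restrict \<phi> (p_regular 2 (G\<lparr>carrier := H\<rparr>))) \<theta>) \<and>
      (\<exists>h t.
         real_element G h \<and> odd (group.ord G h) \<and>
         t \<in> carrier G \<and> (\<exists>k. group.ord G t = 2 ^ k) \<and> inverts G t h \<and>
         internal_semidirect_product G H (generate G {h}) (generate G {t}) \<and>
         (\<exists>\<mu>\<in>Irr (G\<lparr>carrier := generate G {h}\<rparr>). \<exists>m :: int. odd m \<and>
            char_inner (G\<lparr>carrier := generate G {h}\<rparr>)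
              (restrict \<phi> (generate G {h})) \<mu> = of_int m))"
proof -
  interpret modular_reduction_2 red
    using assms by unfold_locales
  obtain n X where X: "irreducible_rep G n X" "\<phi> = brauer_character red G X"
    using assms(5) by (auto simp: IBr_def)
  interpret finite_group G
    using assms by (simp add: finite_group_def finite_group_axioms_def)
  have "X \<in> hom G (GL TYPE('k) n)"
    using X(1) by (simp add: irreducible_rep_def)
  then interpret brauer_rep red G n X
    by (intro brauer_rep.intro finite_matrix_rep.intro matrix_repI modular_reduction_2_axioms
        finite_group_axioms is_group)
  obtain h where h: "h \<in> p_regular 2 G" "real_element G h" "mat_trace (X h) \<noteq> 0"
    using exists_real_2_regular_element_trace_nonzero[OF X(1)] assms(6) X(2) by blast
  then obtain x where x: "h \<in> carrier G" "x \<in> carrier G" "inverts G x h"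
    by (auto simp: real_element_def)
  have odd_h: "odd (ord h)"
    using h(1) by (simp add: p_regular_def)
  obtain b k where bk: "odd b" "ord (x [^]\<^bsub>G\<^esub> (b::nat)) = 2 ^ k"
    using exists_odd_power_2_element[OF x(2)] by blast
  define t where "t = x [^]\<^bsub>G\<^esub> b"
  have t: "t \<in> carrier G" "inverts G t h" "ord t = 2 ^ k"
    using x bk inverts_odd_pow[OF x(2,1,3) bk(1)] by (simp_all add: t_def)
  interpret D: dihedral_rep red G h t k
    using x(1) t odd_h by unfold_locales
  define M where "M = eigenvalues (X h)"
  have M_roots: "set_mset M \<subseteq> D.roots"
    using eigenvalues_rep_roots_of_unity[OF x(1) pow_ord_eq_1[OF x(1)]]
    by (auto simp: M_def D.roots_def)
  have M_inv: "image_mset inverse M = M"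
  proof -
    have "eigenvalues (X (inv\<^bsub>G\<^esub> h)) = eigenvalues (X h)"
    proof (rule eigenvalues_similar, rule similar_matI)
      let ?P = "X (inv\<^bsub>G\<^esub> t)" and ?Q = "X t"
      show "{X (inv\<^bsub>G\<^esub> h), X h, ?P, ?Q} \<subseteq> carrier_mat n n"
        using x(1) t(1) by auto
      show "?P * ?Q = 1\<^sub>m n" "?Q * ?P = 1\<^sub>m n"
        using t(1) X_mult[of "inv\<^bsub>G\<^esub> t" t] X_mult[of t "inv\<^bsub>G\<^esub> t"] X_one by simp_all
      show "X (inv\<^bsub>G\<^esub> h) = ?P * X h * ?Q"
        using t x(1) by (simp add: X_mult[symmetric] inverts_def)
    qed
    then show ?thesis
      using eigenvalues_rep_inv[OF x(1)] by (simp add: M_def)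
  qed
  have \<phi>_pow: "\<phi> (h [^]\<^bsub>G\<^esub> i) = \<Sum>\<^sub># (image_mset (\<lambda>a. brauer_lift red a ^ i) M)" for i :: nat
    using brauer_character_pow[OF h(1)] by (simp add: X(2) M_def)
  \<comment> \<open>In characteristic 2 the eigenvalues of even multiplicity do not contribute to the trace.\<close>
  obtain a where a: "odd (count M a)"
  proof (rule ccontr)
    assume "\<not> thesis"
    then have even: "even (count M a)" for a
      using that by blast
    have "mat_trace (X h) = (\<Sum>z\<in>set_mset M. of_nat (count M z) * z)"
      using trace_rep[OF x(1)] sum_mset_eq_sum_count[of "set_mset M" M] by (simp add: M_def)
    also have "\<dots> = 0"
      using even by (intro sum.neutral) (simp add: of_nat_eq_0_iff_char_dvd char_2)
    finally show False
      using h(3) by simp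
  qed
  then have a_root: "a \<in> D.roots"
    using M_roots by (metis count_eq_zero_iff even_zero subsetD)
  have multiplicity: "brauer_multiplicity red D.GH (restrict \<phi> (p_regular 2 D.GH)) (D.\<theta> a) = count M a"
    using D.p_regular_GH_pow \<phi>_pow
    by (intro D.brauer_multiplicity_GH a_root M_roots M_inv) auto
  obtain \<mu> where \<mu>: "\<mu> \<in> Irr (G\<lparr>carrier := generate G {h}\<rparr>)"
      "char_inner (G\<lparr>carrier := generate G {h}\<rparr>) (restrict \<phi> (generate G {h})) \<mu>
        = D.fourier a (restrict \<phi> (generate G {h}))"
    using D.exists_Irr_fourier[OF a_root] by blast
  have "D.fourier a (restrict \<phi> (generate G {h})) = of_nat (count M a)"
    using \<phi>_pow D.generate_h by (intro D.fourier_eigenvalues a_root M_roots) auto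
  then have inner: "char_inner (G\<lparr>carrier := generate G {h}\<rparr>) (restrict \<phi> (generate G {h})) \<mu>
      = of_int (int (count M a))"
    using \<mu>(2) by simp
  show ?thesis
  proof (intro exI[of _ D.H] exI[of _ "D.\<theta> a"] conjI)
    show "subgroup D.H G"
      by (rule D.subgroup_H)
    show "D.\<theta> a \<in> IBr red D.GH"
      using a_root by (simp add: D.IBr_GH)
    show "D.\<theta> a ` p_regular 2 D.GH \<subseteq> \<real>"
      by (rule D.\<theta>_real[OF a_root])
    show "odd (brauer_multiplicity red D.GH (restrict \<phi> (p_regular 2 D.GH)) (D.\<theta> a))"
      using a by (simp add: multiplicity)
    have "\<exists>m :: int. odd m \<and> char_inner (G\<lparr>carrier := generate G {h}\<rparr>) (restrict \<phi> (generate G {h})) \<mu> = of_int m"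
      using a inner by (intro exI[of _ "int (count M a)"]) simp
    then show "\<exists>h' t'. real_element G h' \<and> odd (group.ord G h') \<and>
         t' \<in> carrier G \<and> (\<exists>k. group.ord G t' = 2 ^ k) \<and> inverts G t' h' \<and>
         internal_semidirect_product G D.H (generate G {h'}) (generate G {t'}) \<and>
         (\<exists>\<mu>\<in>Irr (G\<lparr>carrier := generate G {h'}\<rparr>). \<exists>m :: int. odd m \<and>
            char_inner (G\<lparr>carrier := generate G {h'}\<rparr>) (restrict \<phi> (generate G {h'})) \<mu> = of_int m)"
      using h(2) odd_h t D.internal_semidirect_product \<mu>(1) by blast
  qed
qed

end
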